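(* Let $n\ge 2$ and let $K\subset\mathbb{R}^n$ be a centrally symmetric convex body. Then $K$ is a zonoid if and only if for every $u\in\mathbb{S}^{n-1}$ the $u$-spin $K_u$ of $K$ is a zonoid.
   Context: $\mathbb{S}^{n-1}$ is the Euclidean unit sphere of $\mathbb{R}^n$ and $\langle\cdot,\cdot\rangle$ is the standard inner product. A convex body is a nonempty compact convex subset of $\mathbb{R}^n$; centrally symmetric means symmetric about the origin, i.e. $K=-K$. The support function of $K$ is $h_K(x)=\max_{y\in K}\langle x,y\rangle$, for $x\in\mathbb{R}^n$; it is determined by its restriction to $\mathbb{S}^{n-1}$ via positive homogeneity of degree 1. A centrally symmetric convex body $K$ is a zonoid if there is a finite positive (i.e. nonnegative) Borel measure $\mu$ on $\mathbb{S}^{n-1}$ such that $h_K(x)=\int_{\mathbb{S}^{n-1}}|\langle x,y\rangle|\,d\mu(y)$ for all $x$. For $u\in\mathbb{S}^{n-1}$, let $O(u)$ be the subgroup of orthogonal transformations $T$ of $\mathbb{R}^n$ with $Tu=u$, equipped with its normalized Haar measure $m$. For $f\in C(\mathbb{S}^{n-1})$ define $(S_uf)(x)=\int_{O(u)}f(Tx)\,dm(T)$. The $u$-spin of a centrally symmetric convex body $K$ is the convex body $K_u$ whose support function is $S_uh_K$, i.e. $h_{K_u}(x)=\int_{O(u)}h_K(Tx)\,dm(T)$. *)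

theory Defs
  imports "HOL-Probability.Probability"
begin

definition convex_body :: "(real ^ 'n) set \<Rightarrow> bool" where
  "convex_body K \<longleftrightarrow> K \<noteq> {} \<and> compact K \<and> convex K"

definition centrally_symmetric :: "(real ^ 'n) set \<Rightarrow> bool" where
  "centrally_symmetric K \<longleftrightarrow> uminus ` K = K"

text \<open>The supremum is only meaningful, and is then attained, for nonempty compact \<open>K\<close>.\<close>

definition support_fun :: "(real ^ 'n) set \<Rightarrow> real ^ 'n \<Rightarrow> real" where
  "support_fun K x = (SUP y\<in>K. x \<bullet> y)"

definition zonoid :: "(real ^ 'n) set \<Rightarrow> bool" where
  "zonoid K \<longleftrightarrow> convex_body K \<and> centrally_symmetric K \<and>
    (\<exists>\<mu> :: (real ^ 'n) measure.
       sets \<mu> = sets (restrict_space borel (sphere 0 1)) \<and> finite_measure \<mu> \<and>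
       (\<forall>x. support_fun K x = (\<integral>y. \<bar>x \<bullet> y\<bar> \<partial>\<mu>)))"

text \<open>Linear maps of the space are represented by their matrices, so a group of orthogonal
  transformations is a set of matrices with the topology of the matrix space.\<close>

definition stabilizer_O :: "real ^ 'n \<Rightarrow> (real ^ 'n ^ 'n) set" where
  "stabilizer_O u = {T. orthogonal_matrix T \<and> T *v u = u}"

text \<open>A left-invariant Borel probability measure on a matrix group \<open>G\<close>. If \<open>G\<close> is
  compact there is exactly one, and it is also right-invariant.\<close>

definition normalized_haar :: "(real ^ 'n ^ 'n) set \<Rightarrow> (real ^ 'n ^ 'n) measure \<Rightarrow> bool" where
  "normalized_haar G m \<longleftrightarrow>
    sets m = sets (restrict_space borel G) \<and> prob_space m \<and>
    (\<forall>S\<in>G. distr m m (\<lambda>T. S ** T) = m)"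

definition haar :: "(real ^ 'n ^ 'n) set \<Rightarrow> (real ^ 'n ^ 'n) measure" where
  "haar G = (THE m. normalized_haar G m)"

text \<open>The averaging operator is applied to functions on the whole space. As orthogonal maps
  preserve spheres, this agrees on the unit sphere with the operator on functions given there,
  and it preserves positive homogeneity.\<close>

definition spin_op :: "real ^ 'n \<Rightarrow> (real ^ 'n \<Rightarrow> real) \<Rightarrow> real ^ 'n \<Rightarrow> real" where
  "spin_op u f x = (\<integral>T. f (T *v x) \<partial>haar (stabilizer_O u))"

definition spin :: "real ^ 'n \<Rightarrow> (real ^ 'n) set \<Rightarrow> (real ^ 'n) set" where
  "spin u K = (THE L. convex_body L \<and> support_fun L = spin_op u (support_fun K))"

end

theory Submission
  imports Defs
begin

text \<open>
  Write \<open>h\<close> for the support function of \<open>K\<close>. If \<open>h\<close> is the cosine transform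
  \<open>x \<mapsto> \<integral> \<bar>x \<bullet> y\<bar> d\<mu>(y)\<close>, then the support function of the spin is the cosine transform of
  the image of \<open>haar \<otimes> \<mu>\<close> under \<open>(T, y) \<mapsto> T\<^sup>t y\<close> (\<open>zonoid_spin\<close>). So spins of zonoids
  are zonoids.

  For the converse, regard \<open>h\<close> as a tempered distribution on the whole space. Off the origin, its
  Fourier transform is \<open>- c\<close> times the generating measure, spread radially with weight
  \<open>dr / r\<^sup>2\<close>. So \<open>K\<close> is a zonoid if \<open>h\<close> is nonpositive against test functions with
  nonnegative Fourier transform that vanishes at the origin, provided that these transforms can be
  concentrated near an arbitrary pair \<open>\<plusminus> w\<close>. The test functions used here are
    \<open>\<psi>(y) = (cos (y \<bullet> w) - exp (- R\<^sup>2 \<bar>w\<bar>\<^sup>2 / 2)) exp (- \<bar>y\<bar>\<^sup>2 / (2 R\<^sup>2))\<close>,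
  whose Fourier transform is a positive multiple of
    \<open>exp (- R\<^sup>2 (\<bar>\<xi>\<bar>\<^sup>2 + \<bar>w\<bar>\<^sup>2) / 2) (cosh (R\<^sup>2 (w \<bullet> \<xi>)) - 1) \<ge> 0\<close>.
  They are invariant under the stabilizer of \<open>u = w / \<bar>w\<bar>\<close>. Because of this invariance,
  \<open>h\<close> and the support function of the \<open>u\<close>-spin have the same integral against \<open>\<psi>\<close>
  (\<open>spin_op_test_fun\<close>), and this integral is nonpositive as soon as that one spin is a zonoid
  (\<open>zonoid_test_fun_nonpos\<close>). Hence zonoids as spins in all directions give a nonnegative density
  \<open>w \<mapsto> - \<integral> h \<psi>\<close> for every \<open>R\<close>.

  It remains to get \<open>h\<close> back from these densities (\<open>cosine_transform_of_measure\<close>). The cosine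
  transform of the density, cut off by a fixed Gaussian in \<open>w\<close>, equals a constant multiple of
  \<open>h(x) ln R\<close> up to an error that is bounded in \<open>R\<close>; the logarithm is the total weight of
  \<open>dr / r\<close> over the scales between the Gaussian that smooths and the one that cuts off.
  After division by the logarithm, \<open>h\<close> is a pointwise limit of cosine transforms of positive
  measures, and such a limit is again a cosine transform by weak compactness
  (\<open>cosine_transform_closed\<close>).

  The definition of the spin presupposes two facts of independent interest. A sublinear function
  is the support function of exactly one convex body (\<open>sublinear_is_support_fun\<close>,
  \<open>support_fun_inject\<close>). A compact group of orthogonal matrices has exactly one normalized Haar
  measure (\<open>normalized_haar_haar\<close>); it is obtained as a weak limit of Lebesgue measure on
  shrinking neighbourhoods of the group. Weak compactness in Euclidean space, in turn, is reduced to
  Helly's selection theorem on the line by means of a space-filling curve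
  (\<open>prob_measures_cball_compact\<close>).
\<close>

section \<open>A space-filling curve\<close>

text \<open>A continuous function of period 2 that is 0 on \<open>[0, 1/3]\<close> and 1 on \<open>[2/3, 1]\<close>. Schoenberg's
  curve uses it to read ternary digits continuously.\<close>

definition tooth :: "real \<Rightarrow> real" where
  "tooth t = min 1 (max 0 (1/2 - cos (pi * t)))"

lemma tooth_bounds: "0 \<le> tooth t" "tooth t \<le> 1"
  by (auto simp: tooth_def)

lemma continuous_on_tooth: "continuous_on UNIV tooth"
  unfolding tooth_def by (intro continuous_intros)

lemma tooth_periodic: "tooth (2 * real m + t) = tooth t"
proof -
  have "cos (pi * (2 * real m + t)) = cos (2 * real m * pi + pi * t)"
    by (simp add: algebra_simps)
  also have "\<dots> = cos (pi * t)"
    by (simp add: cos_add)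
  finally have "cos (pi * (2 * real m + t)) = cos (pi * t)" .
  then show ?thesis by (simp add: tooth_def)
qed

lemma tooth_left: "0 \<le> t \<Longrightarrow> t \<le> 1/3 \<Longrightarrow> tooth t = 0"
proof -
  assume "0 \<le> t" "t \<le> 1/3"
  then have "cos (pi/3) \<le> cos (pi * t)"
    by (intro cos_monotone_0_pi_le) (auto simp: field_simps)
  then show ?thesis by (simp add: tooth_def cos_60)
qed

lemma tooth_right: "2/3 \<le> t \<Longrightarrow> t \<le> 1 \<Longrightarrow> tooth t = 1"
proof -
  assume "2/3 \<le> t" "t \<le> 1"
  then have "cos (pi * t) \<le> cos (2 * pi/3)"
    by (intro cos_monotone_0_pi_le) (auto simp: field_simps)
  then show ?thesis by (simp add: tooth_def cos_120 min_def max_def)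
qed

text \<open>Multiplication by \<open>3 ^ k\<close> shifts the ternary point. The digits 0 and 2 in front of it sum to an
  even integer, which the period absorbs; the first digit behind it decides whether the rest lies in
  the lower or in the upper third.\<close>

lemma tooth_ternary:
  fixes a :: "nat \<Rightarrow> nat"
  assumes a: "\<And>k. a k \<le> 1"
  defines "t \<equiv> (\<Sum>k. 2 * real (a k) / 3 ^ Suc k)"
  shows "t \<in> {0..1}" and "tooth (3 ^ k * t) = real (a k)"
proof -
  let ?g = "\<lambda>k. 2 * real (a k) / 3 ^ Suc k"
  have geo: "(\<lambda>k. (2/3) * (1/3::real) ^ k) sums 1"
    using sums_mult[OF geometric_sums[of "1/3::real"], of "2/3"] by simp
  have tail: "summable (\<lambda>j. 2 * real (b j) / 3 ^ Suc j)
      \<and> 0 \<le> (\<Sum>j. 2 * real (b j) / 3 ^ Suc j) \<and> (\<Sum>j. 2 * real (b j) / 3 ^ Suc j) \<le> 1"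
    if b: "\<And>k. b k \<le> 1" for b :: "nat \<Rightarrow> nat"
  proof -
    have le: "2 * real (b j) / 3 ^ Suc j \<le> (2/3) * (1/3::real) ^ j" for j
      using b[of j] by (simp add: power_one_over field_simps)
    have s: "summable (\<lambda>j. 2 * real (b j) / 3 ^ Suc j)"
      by (rule summable_comparison_test[OF _ sums_summable[OF geo]]) (use le in auto)
    have "(\<Sum>j. 2 * real (b j) / 3 ^ Suc j) \<le> (\<Sum>j. (2/3) * (1/3::real) ^ j)"
      by (rule suminf_le[OF le s sums_summable[OF geo]])
    with s show ?thesis using sums_unique[OF geo] by (auto intro!: suminf_nonneg)
  qed
  show "t \<in> {0..1}" using tail[OF a] by (simp add: t_def)
  define r where "r = (\<Sum>j. 2 * real (a (j + Suc k)) / 3 ^ Suc j)"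
  have r: "0 \<le> r" "r \<le> 1" using tail[of "\<lambda>j. a (j + Suc k)"] a by (auto simp: r_def)
  have "t = (\<Sum>j. ?g (j + Suc k)) + (\<Sum>j<Suc k. ?g j)"
    unfolding t_def using tail[OF a] by (intro suminf_split_initial_segment) auto
  also have "(\<Sum>j. ?g (j + Suc k)) = (\<Sum>j. (1 / 3 ^ Suc k) * (2 * real (a (j + Suc k)) / 3 ^ Suc j))"
    by (simp add: power_add field_simps)
  also have "\<dots> = r / 3 ^ Suc k"
    unfolding r_def using tail[of "\<lambda>j. a (j + Suc k)"] a by (subst suminf_mult) auto
  finally have t: "3 ^ k * t = r / 3 + 2 * real (a k) / 3 + (\<Sum>j<k. 3 ^ k * ?g j)"
    by (simp add: field_simps sum_distrib_left)
  have "(\<Sum>j<k. 3 ^ k * ?g j) = (\<Sum>j<k. 2 * real (a j * 3 ^ (k - Suc j)))"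
    by (intro sum.cong refl) (auto simp: field_simps power_add[symmetric] simp flip: power_Suc)
  also have "\<dots> = 2 * real (\<Sum>j<k. a j * 3 ^ (k - Suc j))"
    by (simp add: sum_distrib_left)
  finally have "tooth (3 ^ k * t) = tooth (2 * real (\<Sum>j<k. a j * 3 ^ (k - Suc j)) + (r / 3 + 2 * real (a k) / 3))"
    unfolding t by (simp add: add_ac)
  also have "\<dots> = tooth (r / 3 + 2 * real (a k) / 3)"
    by (rule tooth_periodic)
  also have "\<dots> = real (a k)"
    using a[of k] r by (cases "a k = 0") (auto simp: tooth_left tooth_right le_Suc_eq)
  finally show "tooth (3 ^ k * t) = real (a k)" .
qed

lemma binary_expansion:
  fixes y :: real
  assumes "y \<in> {0..1}"
  obtains b :: "nat \<Rightarrow> nat" where "\<And>j. b j \<le> 1" "(\<lambda>j. real (b j) * (1/2) ^ Suc j) sums y"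
proof -
  define r where "r = rec_nat y (\<lambda>_ x. if x \<ge> 1/2 then 2 * x - 1 else 2 * x)"
  define b :: "nat \<Rightarrow> nat" where "b j = (if r j \<ge> 1/2 then 1 else 0)" for j
  have r0: "r 0 = y" and rS: "r (Suc j) = 2 * r j - real (b j)" for j
    by (auto simp: r_def b_def)
  have r01: "0 \<le> r j \<and> r j \<le> 1" for j
  proof (induction j)
    case 0 then show ?case using assms r0 by auto
  next
    case (Suc j) then show ?case unfolding rS b_def by auto
  qed
  have part: "(\<Sum>j<n. real (b j) * (1/2) ^ Suc j) = y - r n * (1/2) ^ n" for n
    by (induction n) (auto simp: r0 rS field_simps)
  have "(\<lambda>n. r n * (1/2) ^ n) \<longlonglongrightarrow> 0"
  proof (rule tendsto_sandwich[of "\<lambda>_. 0" _ _ "\<lambda>n. (1/2::real) ^ n"])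
    show "(\<lambda>n. (1/2::real) ^ n) \<longlonglongrightarrow> 0" by (intro LIMSEQ_power_zero) simp
  qed (use r01 in \<open>auto simp: field_simps\<close>)
  then have "(\<lambda>j. real (b j) * (1/2) ^ Suc j) sums y"
    unfolding sums_def part using tendsto_diff[OF tendsto_const, of _ 0 sequentially y] by auto
  then show thesis by (intro that[of b]) (auto simp: b_def)
qed

text \<open>Coordinate \<open>c\<close> of Schoenberg's curve: its binary digits are the ternary digits of \<open>t\<close> at the
  positions \<open>prod_encode (c, j)\<close>. Different coordinates use disjoint sets of digits and can
  therefore be prescribed independently.\<close>

definition schoenberg :: "nat \<Rightarrow> real \<Rightarrow> real" where
  "schoenberg c t = (\<Sum>j. tooth (3 ^ prod_encode (c, j) * t) * (1/2) ^ Suc j)"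

lemma half_sums: "(\<lambda>j. (1/2::real) ^ Suc j) sums 1"
  using power_half_series by simp

lemma schoenberg_summable: "summable (\<lambda>j. tooth (3 ^ prod_encode (c, j) * t) * (1/2) ^ Suc j)"
  by (rule summable_comparison_test[OF _ sums_summable[OF half_sums]])
     (use tooth_bounds in \<open>auto simp: abs_mult intro!: exI[of _ 0] mult_left_le_one_le\<close>)

lemma schoenberg_bounds: "0 \<le> schoenberg c t" "schoenberg c t \<le> 1"
proof -
  show "0 \<le> schoenberg c t" unfolding schoenberg_def
    by (intro suminf_nonneg[OF schoenberg_summable]) (auto simp: tooth_bounds)
  have "schoenberg c t \<le> (\<Sum>j. (1/2::real) ^ Suc j)" unfolding schoenberg_def
    by (intro suminf_le[OF _ schoenberg_summable sums_summable[OF half_sums]])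
       (auto simp: tooth_bounds intro!: mult_left_le_one_le)
  then show "schoenberg c t \<le> 1" using sums_unique[OF half_sums] by simp
qed

lemma continuous_on_schoenberg: "continuous_on UNIV (schoenberg c)"
proof (rule uniform_limit_theorem)
  show "uniform_limit UNIV (\<lambda>n t. \<Sum>j<n. tooth (3 ^ prod_encode (c, j) * t) * (1/2) ^ Suc j)
      (schoenberg c) sequentially"
    unfolding schoenberg_def
  proof (rule Weierstrass_m_test[OF _ sums_summable[OF half_sums]])
    fix j :: nat and t :: real
    show "norm (tooth (3 ^ prod_encode (c, j) * t) * (1/2) ^ Suc j) \<le> (1/2) ^ Suc j"
      using tooth_bounds[of "3 ^ prod_encode (c, j) * t"]
      by (simp add: abs_mult)
  qed
  have "continuous_on UNIV (\<lambda>t. tooth (s * t))" for s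
    by (intro continuous_on_compose2[OF continuous_on_tooth] continuous_intros) auto
  then show "\<forall>\<^sub>F n in sequentially. continuous_on UNIV
      (\<lambda>t. \<Sum>j<n. tooth (3 ^ prod_encode (c, j) * t) * (1/2) ^ Suc j)"
    by (intro always_eventually allI continuous_intros)
qed auto

lemma schoenberg_onto:
  fixes y :: "nat \<Rightarrow> real"
  assumes "\<And>c. y c \<in> {0..1}"
  shows "\<exists>t\<in>{0..1}. \<forall>c. schoenberg c t = y c"
proof -
  have "\<exists>b :: nat \<Rightarrow> nat. (\<forall>j. b j \<le> 1) \<and> (\<lambda>j. real (b j) * (1/2) ^ Suc j) sums y c" for c
    using binary_expansion[OF assms[of c]] by metis
  then obtain b :: "nat \<Rightarrow> nat \<Rightarrow> nat" where
    b: "\<And>c j. b c j \<le> 1" "\<And>c. (\<lambda>j. real (b c j) * (1/2) ^ Suc j) sums y c"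
    by metis
  define a where "a k = (case prod_decode k of (c, j) \<Rightarrow> b c j)" for k
  define t where "t = (\<Sum>k. 2 * real (a k) / 3 ^ Suc k)"
  have a: "a k \<le> 1" for k using b(1) by (auto simp: a_def split: prod.split)
  have "schoenberg c t = y c" for c
    using tooth_ternary(2)[of a, OF a] sums_unique[OF b(2)]
    by (simp add: schoenberg_def t_def a_def)
  then show ?thesis using tooth_ternary(1)[of a, OF a] unfolding t_def by blast
qed

lemma space_filling_curve:
  fixes B :: real
  assumes "B > 0"
  obtains \<phi> :: "real \<Rightarrow> 'a::euclidean_space" where
    "continuous_on UNIV \<phi>" "bounded (range \<phi>)" "cball 0 B \<subseteq> \<phi> ` {0..1}"
proof -
  define \<phi> :: "real \<Rightarrow> 'a" where
    "\<phi> t = (\<Sum>i\<in>Basis. (2 * B * schoenberg (to_nat_on Basis i) t - B) *\<^sub>R i)" for t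
  have "continuous_on UNIV \<phi>" unfolding \<phi>_def
    by (intro continuous_intros continuous_on_schoenberg)
  moreover have "bounded (range \<phi>)"
  proof (rule boundedI, safe)
    fix t
    have "norm (\<phi> t) \<le> (\<Sum>i\<in>(Basis::'a set). norm ((2 * B * schoenberg (to_nat_on Basis i) t - B) *\<^sub>R i))"
      unfolding \<phi>_def by (rule norm_sum)
    also have "\<dots> \<le> (\<Sum>i\<in>(Basis::'a set). B)"
    proof (rule sum_mono)
      fix i :: 'a assume "i \<in> Basis"
      have "\<bar>2 * B * schoenberg c t - B\<bar> \<le> B" for c
        using schoenberg_bounds[of c t] assms mult_left_mono[of "schoenberg c t" 1 "2 * B"] by (auto simp: abs_le_iff)
      then show "norm ((2 * B * schoenberg (to_nat_on Basis i) t - B) *\<^sub>R i) \<le> B"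
        using \<open>i \<in> Basis\<close> by simp
    qed
    finally show "norm (\<phi> t) \<le> (\<Sum>i\<in>(Basis::'a set). B)" .
  qed
  moreover have "cball 0 B \<subseteq> \<phi> ` {0..1}"
  proof
    fix y :: 'a assume y: "y \<in> cball 0 B"
    define z where "z c = (if c \<in> to_nat_on Basis ` (Basis :: 'a set)
        then (y \<bullet> from_nat_into Basis c + B) / (2 * B) else 0)" for c
    have "z c \<in> {0..1}" for c
    proof (cases "c \<in> to_nat_on Basis ` (Basis :: 'a set)")
      case True
      then have "from_nat_into Basis c \<in> (Basis :: 'a set)"
        by (auto intro: from_nat_into)
      then have "\<bar>y \<bullet> from_nat_into Basis c\<bar> \<le> B"
        using y Basis_le_norm[of "from_nat_into Basis c" y] by auto
      then show ?thesis using True assms by (auto simp: z_def field_simps)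
    qed (auto simp: z_def)
    then obtain t where t: "t \<in> {0..1}" "\<And>c. schoenberg c t = z c"
      using schoenberg_onto by metis
    have "\<phi> t = (\<Sum>i\<in>Basis. (y \<bullet> i) *\<^sub>R i)"
      unfolding \<phi>_def t
    proof (intro sum.cong refl)
      fix i :: 'a assume "i \<in> Basis"
      then have "z (to_nat_on Basis i) = (y \<bullet> i + B) / (2 * B)"
        by (simp add: z_def countable_finite)
      then show "(2 * B * z (to_nat_on Basis i) - B) *\<^sub>R i = (y \<bullet> i) *\<^sub>R i"
        using assms by simp
    qed
    then show "y \<in> \<phi> ` {0..1}" using t(1) by (auto simp: euclidean_representation)
  qed
  ultimately show thesis by (rule that)
qed

section \<open>Weak compactness of probability measures on a ball\<close>

text \<open>A space-filling curve transports the problem to the unit interval: lift the measures along a Borel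
  section of the curve, apply Helly's selection theorem there, and push the limit forward along the
  curve. As the curve is continuous, weak convergence survives.\<close>

lemma prob_measures_cball_compact:
  fixes P :: "nat \<Rightarrow> 'a::euclidean_space measure"
  assumes sets: "\<And>k. sets (P k) = sets borel" and prob: "\<And>k. prob_space (P k)"
    and supp: "\<And>k. AE x in P k. norm x \<le> B"
  shows "\<exists>r M. strict_mono (r :: nat \<Rightarrow> nat) \<and> sets M = sets borel \<and> prob_space M \<and>
    (\<exists>b. AE x in M. norm x \<le> b) \<and>
    (\<forall>f :: 'a \<Rightarrow> real. continuous_on UNIV f \<longrightarrow> (\<lambda>k. \<integral>x. f x \<partial>P (r k)) \<longlonglongrightarrow> (\<integral>x. f x \<partial>M))"
proof -
  define C where "C = max B 1"
  obtain \<phi> :: "real \<Rightarrow> 'a" where \<phi>: "continuous_on UNIV \<phi>" "bounded (range \<phi>)" "cball 0 C \<subseteq> \<phi> ` {0..1}"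
    using space_filling_curve[of C] by (metis C_def less_max_iff_disj zero_less_one)
  have \<phi>_cont: "continuous_on A \<phi>" for A using \<phi>(1) continuous_on_subset by blast
  \<comment> \<open>The smallest preimage is a Borel section because its sublevel sets are compact.\<close>
  define E where "E y = (if y \<in> \<phi> ` {0..1} then Inf {t\<in>{0..1}. \<phi> t = y} else 0)" for y
  have E: "E y \<in> {0..1}" "\<phi> (E y) = y" "\<And>t. t \<in> {0..1} \<Longrightarrow> \<phi> t = y \<Longrightarrow> E y \<le> t"
    if "y \<in> \<phi> ` {0..1}" for y
  proof -
    have "closed ({0..1} \<inter> \<phi> -` {y})"
      by (intro continuous_closed_preimage \<phi>_cont) auto
    moreover have "{0..1} \<inter> \<phi> -` {y} = {t\<in>{0..1}. \<phi> t = y}" by auto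
    ultimately have cl: "closed {t\<in>{0..1}. \<phi> t = y}" by simp
    have bdd: "bdd_below {t\<in>{0..1}. \<phi> t = y}" by (auto intro!: bdd_belowI[of _ 0])
    have "Inf {t\<in>{0..1}. \<phi> t = y} \<in> {t\<in>{0..1}. \<phi> t = y}"
      using that by (intro closed_contains_Inf cl bdd) auto
    then show "E y \<in> {0..1}" "\<phi> (E y) = y" using that by (auto simp: E_def)
    show "E y \<le> t" if "t \<in> {0..1}" "\<phi> t = y" for t
      using that \<open>y \<in> \<phi> ` {0..1}\<close> by (auto simp: E_def intro!: cInf_lower bdd)
  qed
  have E01: "E y \<in> {0..1}" for y using E(1)[of y] by (cases "y \<in> \<phi> ` {0..1}") (auto simp: E_def)
  have E_meas [measurable]: "E \<in> borel_measurable borel"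
    unfolding borel_measurable_iff_le
  proof
    fix c :: real
    have im: "closed (\<phi> ` {a..b})" for a b
      by (intro compact_imp_closed compact_continuous_image \<phi>_cont) auto
    have "{y. E y \<le> c} = (if c < 0 then {} else - (\<phi> ` {0..1}) \<union> \<phi> ` {0..min c 1})" (is "_ = ?R")
    proof (intro set_eqI iffI)
      fix y assume "y \<in> {y. E y \<le> c}"
      then have le: "E y \<le> c" by simp
      with E01[of y] have "c \<ge> 0" by auto
      show "y \<in> ?R"
      proof (cases "y \<in> \<phi> ` {0..1}")
        case True
        then have "y \<in> \<phi> ` {0..min c 1}"
          using E(1,2)[OF True] le by (intro image_eqI[of _ _ "E y"]) auto
        then show ?thesis using \<open>c \<ge> 0\<close> by auto
      qed (use \<open>c \<ge> 0\<close> in auto)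
    next
      fix y assume y: "y \<in> ?R"
      then have c: "c \<ge> 0" by (auto split: if_splits)
      show "y \<in> {y. E y \<le> c}"
      proof (cases "y \<in> \<phi> ` {0..1}")
        case True
        then obtain t where "t \<in> {0..min c 1}" "\<phi> t = y" using y c by auto
        then show ?thesis using E(3)[OF True, of t] by auto
      qed (use c in \<open>auto simp: E_def\<close>)
    qed
    also have "\<dots> \<in> sets borel" using im by (auto intro!: borel_closed)
    finally show "{y \<in> space borel. E y \<le> c} \<in> sets borel" by simp
  qed
  have [measurable]: "\<phi> \<in> borel_measurable borel"
    by (rule borel_measurable_continuous_onI[OF \<phi>(1)])
  note [measurable_cong] = sets
  define Q where "Q k = distr (P k) borel E" for k
  have rd: "real_distribution (Q k)" for k
    unfolding real_distribution_def real_distribution_axioms_def Q_def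
    by (auto intro!: prob_space.prob_space_distr prob)
  have "tight Q"
    unfolding tight_def
  proof (intro conjI allI impI rd)
    fix e :: real assume "e > 0"
    have "measure (Q k) {-1<..1} > 1 - e" for k
    proof -
      interpret prob_space "P k" by (rule prob)
      have "measure (Q k) {-1<..1} = measure (P k) (space (P k))"
        unfolding Q_def using E01 by (subst measure_distr) (auto intro!: arg_cong[of _ _ "measure (P k)"] simp: less_le_trans[of "-1" 0])
      then show ?thesis using \<open>e > 0\<close> by (simp add: prob_space)
    qed
    then show "\<exists>a b. a < b \<and> (\<forall>k. measure (Q k) {a<..b} > 1 - e)"
      by (intro exI[of _ "-1"] exI[of _ 1]) simp
  qed
  then obtain r N where r: "strict_mono r" and N: "real_distribution N" "weak_conv_m (Q \<circ> id \<circ> r) N"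
    using tight_imp_convergent_subsubsequence[of Q id] strict_mono_id by (metis eq_id_iff)
  interpret N: real_distribution N by (rule N)
  have N_sets [measurable_cong]: "sets N = sets borel" by simp
  define M where "M = distr N borel \<phi>"
  show ?thesis
  proof (rule exI[of _ r], rule exI[of _ M], intro conjI allI impI r)
    show "sets M = sets borel" by (simp add: M_def)
    show "prob_space M" unfolding M_def by (intro N.prob_space_distr) simp
    obtain b where b: "\<And>t. norm (\<phi> t) \<le> b" using \<phi>(2) by (auto simp: bounded_iff)
    show "\<exists>b. AE x in M. norm x \<le> b"
      unfolding M_def by (intro exI[of _ b], subst AE_distr_iff) (auto simp: b)
    fix f :: "'a \<Rightarrow> real" assume f: "continuous_on UNIV f"
    then have [measurable]: "f \<in> borel_measurable borel" by (rule borel_measurable_continuous_onI)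
    have "bounded (f ` closure (range \<phi>))"
      by (intro compact_imp_bounded compact_continuous_image)
         (use f \<phi>(2) in \<open>auto intro: continuous_on_subset simp: compact_closure\<close>)
    then obtain D where D: "\<And>t. norm (f (\<phi> t)) \<le> D"
      unfolding bounded_iff using closure_subset by (metis image_eqI rangeI subsetD)
    have cont: "isCont (\<lambda>t. f (\<phi> t)) t" for t
      by (rule continuous_on_interior[of UNIV], rule continuous_on_compose2[OF f \<phi>(1)]) auto
    have "(\<lambda>k. \<integral>t. f (\<phi> t) \<partial>(Q \<circ> id \<circ> r) k) \<longlonglongrightarrow> (\<integral>t. f (\<phi> t) \<partial>N)"
      by (rule weak_conv_imp_integral_bdd_continuous_conv[OF _ N(1) N(2) cont D]) (use rd in auto)
    moreover have "(\<integral>t. f (\<phi> t) \<partial>N) = (\<integral>x. f x \<partial>M)"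
      unfolding M_def by (subst integral_distr) auto
    moreover have "(\<integral>t. f (\<phi> t) \<partial>Q k) = (\<integral>x. f x \<partial>P k)" for k
    proof -
      have "(\<integral>t. f (\<phi> t) \<partial>Q k) = (\<integral>x. f (\<phi> (E x)) \<partial>P k)"
        unfolding Q_def by (subst integral_distr) auto
      also have "\<dots> = (\<integral>x. f x \<partial>P k)"
      proof (rule integral_cong_AE)
        show "AE x in P k. f (\<phi> (E x)) = f x"
          using supp[of k]
        proof eventually_elim
          case (elim x)
          then have "x \<in> \<phi> ` {0..1}" using \<phi>(3) by (auto simp: C_def)
          then show ?case using E(2) by simp
        qed
      qed auto
      finally show ?thesis .
    qed
    ultimately show "(\<lambda>k. \<integral>x. f x \<partial>P (r k)) \<longlonglongrightarrow> (\<integral>x. f x \<partial>M)" by (simp add: o_def)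
  qed
qed

text \<open>The indicator of a closed set is the decreasing limit of continuous functions of the distance to
  it, and closed sets generate the Borel sets.\<close>

lemma finite_borel_measure_eqI:
  fixes M N :: "'a::euclidean_space measure"
  assumes sets: "sets M = sets borel" "sets N = sets borel"
    and fin: "finite_measure M" "finite_measure N"
    and eq: "\<And>f :: 'a \<Rightarrow> real. continuous_on UNIV f \<Longrightarrow> (\<And>x. f x \<in> {0..1}) \<Longrightarrow> (\<integral>x. f x \<partial>M) = (\<integral>x. f x \<partial>N)"
  shows "M = N"
proof -
  interpret M: finite_measure M by (rule fin)
  interpret N: finite_measure N by (rule fin)
  note [measurable_cong] = sets
  have closed_eq: "emeasure M C = emeasure N C" if C: "closed C" for C
  proof (cases "C = {}")
    case False
    have [measurable]: "C \<in> sets borel" using C by simp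
    define f where "f k x = max 0 (1 - real k * infdist x C)" for k x
    have cont: "continuous_on UNIV (f k)" for k unfolding f_def by (intro continuous_intros)
    then have [measurable]: "f k \<in> borel_measurable borel" for k by (rule borel_measurable_continuous_onI)
    have bd: "f k x \<in> {0..1}" for k x using infdist_nonneg[of x C] by (auto simp: f_def)
    have lim: "(\<lambda>k. f k x) \<longlonglongrightarrow> indicator C x" for x
    proof (cases "x \<in> C")
      case True then show ?thesis by (simp add: f_def)
    next
      case False
      then have pos: "infdist x C > 0"
        using C \<open>C \<noteq> {}\<close> in_closed_iff_infdist_zero[of C x] infdist_nonneg[of x C] by fastforce
      then obtain m :: nat where m: "1 < real m * infdist x C" using reals_Archimedean3 by blast
      then have "f k x = 0" if "k \<ge> m" for k
      proof -
        have "real m * infdist x C \<le> real k * infdist x C" using that pos by simp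
        with m show ?thesis by (simp add: f_def)
      qed
      then have "eventually (\<lambda>k. f k x = 0) sequentially" by (auto simp: eventually_at_top_linorder)
      then show ?thesis using False by (simp add: tendsto_eventually)
    qed
    have conv: "(\<lambda>k. \<integral>x. f k x \<partial>L) \<longlonglongrightarrow> measure L C"
      if L: "sets L = sets borel" "finite_measure L" for L
    proof -
      interpret finite_measure L by (rule L)
      note [measurable_cong] = L(1)
      have "(\<lambda>k. \<integral>x. f k x \<partial>L) \<longlonglongrightarrow> (\<integral>x. indicator C x \<partial>L)"
        by (rule integral_dominated_convergence[where w="\<lambda>_. 1"]) (use lim bd in auto)
      then show ?thesis by (simp add: L(1))
    qed
    have "measure M C = measure N C"
      using LIMSEQ_unique[OF conv[OF sets(1) fin(1)]] conv[OF sets(2) fin(2)] eq[OF cont bd] by simp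
    then show ?thesis by (simp add: M.emeasure_eq_measure N.emeasure_eq_measure)
  qed simp
  show ?thesis
  proof (rule measure_eqI_generator_eq[where E="Collect closed" and A="\<lambda>_. UNIV" and \<Omega>=UNIV])
    show "sets M = sigma_sets UNIV (Collect closed)" "sets N = sigma_sets UNIV (Collect closed)"
      using sets by (simp_all add: borel_eq_closed)
  qed (use closed_eq in \<open>auto simp: Int_stable_def\<close>)
qed

section \<open>Orthogonal invariance of Lebesgue measure\<close>

text \<open>The image \<open>M\<close> of Lebesgue measure \<open>\<lambda>\<close> is again translation invariant. Evaluating
  \<open>\<integral>\<integral> 1\<^sub>A(x) 1\<^sub>B(y - x) d\<lambda>(y) dM(x)\<close> for the unit ball \<open>B\<close> in both orders gives
  \<open>\<lambda>(B) M(A) = M(B) \<lambda>(A)\<close>, and \<open>M(B) = \<lambda>(B)\<close> because the ball is preserved.\<close>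

lemma lborel_distr_orthogonal:
  fixes T :: "'a::euclidean_space \<Rightarrow> 'a"
  assumes T: "orthogonal_transformation T"
  shows "distr lborel borel T = lborel"
proof -
  have lin: "linear T" using T by (rule orthogonal_transformation_linear)
  have [measurable]: "T \<in> borel_measurable borel"
    using lin by (intro borel_measurable_continuous_onI linear_continuous_on linear_conv_bounded_linear[THEN iffD1])
  let ?M = "distr lborel borel T"
  have ball: "T -` ball 0 1 = ball 0 1" 
    using T by (auto simp: orthogonal_transformation_norm)
  have ballneg: "uminus -` ball 0 1 = (ball 0 1 :: 'a set)" by auto
  have emT: "emeasure ?M (ball 0 1) = emeasure lborel (ball (0::'a) 1)"
    by (subst emeasure_distr) (auto simp: ball)
  have trans: "distr ?M borel (\<lambda>x. x + y) = ?M" for y :: 'a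
  proof -
    obtain z where z: "T z = y" using orthogonal_transformation_surj[OF T] by (metis surjD)
    have "distr ?M borel (\<lambda>x. x + y) = distr lborel borel (\<lambda>x. T (x + z))"
      by (subst distr_distr) (auto simp: o_def z linear_add[OF lin])
    also have "\<dots> = distr (distr lborel borel (\<lambda>x. z + x)) borel T"
      by (subst distr_distr) (auto simp: o_def add.commute)
    also have "distr lborel borel (\<lambda>x. z + x) = lborel"
      using lborel_affine[of 1 z] by (simp add: density_1)
    finally show ?thesis .
  qed
  have fin: "sigma_finite_measure ?M"
  proof
    show "\<exists>A. countable A \<and> A \<subseteq> sets ?M \<and> \<Union> A = space ?M \<and> (\<forall>a\<in>A. emeasure ?M a \<noteq> \<infinity>)"
    proof (intro exI[of _ "range (\<lambda>n::nat. ball 0 (real n))"] conjI ballI)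
      show "\<Union> (range (\<lambda>n::nat. ball 0 (real n))) = space ?M"
        using reals_Archimedean2 by (auto simp: dist_norm)
      fix A :: "'a set" assume "A \<in> range (\<lambda>n::nat. ball 0 (real n))"
      then obtain n :: nat where A: "A = ball 0 (real n)" by auto
      have "T -` A = A" using T by (auto simp: A orthogonal_transformation_norm)
      then have "emeasure ?M A = emeasure lborel A" by (subst emeasure_distr) (auto simp: A)
      then show "emeasure ?M A \<noteq> \<infinity>" using emeasure_lborel_ball_finite[of "0::'a" "real n"] by (simp add: A less_top)
    qed auto
  qed
  interpret M: sigma_finite_measure ?M by (rule fin)
  interpret pair_sigma_finite lborel ?M ..
  have B0: "emeasure lborel (ball (0::'a) 1) \<noteq> 0" "emeasure lborel (ball (0::'a) 1) \<noteq> \<top>"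
    using emeasure_lborel_ball_finite[of "0::'a" 1] content_ball_pos[of 1 "0::'a"]
    by (auto simp: emeasure_lborel_ball_finite less_top measure_def)
  show ?thesis
  proof (rule measure_eqI)
    fix A assume "A \<in> sets ?M"
    then have [measurable]: "A \<in> sets borel" by simp
    let ?B = "ball (0::'a) 1"
    have [measurable]: "?B \<in> sets borel" by simp
    have tr: "(\<integral>\<^sup>+y. g (y - x) \<partial>lborel) = (\<integral>\<^sup>+y. g y \<partial>lborel)"
      if [measurable]: "g \<in> borel_measurable borel" for g and x :: 'a
      using arg_cong[OF lborel_affine[of 1 "-x"], of "\<lambda>M. \<integral>\<^sup>+y. g y \<partial>M"]
      by (simp add: density_1 nn_integral_distr)
    have trM: "(\<integral>\<^sup>+x. g (x + y) \<partial>?M) = (\<integral>\<^sup>+x. g x \<partial>?M)"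
      if [measurable]: "g \<in> borel_measurable borel" for g and y :: 'a
      by (subst (2) trans[of y, symmetric]) (simp add: nn_integral_distr)
    have "emeasure lborel ?B * emeasure ?M A
        = (\<integral>\<^sup>+x. indicator A x * (\<integral>\<^sup>+y. indicator ?B (y - x) \<partial>lborel) \<partial>?M)"
      by (subst tr) (auto simp: nn_integral_cmult nn_integral_multc mult.commute)
    also have "\<dots> = (\<integral>\<^sup>+x. (\<integral>\<^sup>+y. indicator A x * indicator ?B (y - x) \<partial>lborel) \<partial>?M)"
      by (subst nn_integral_cmult) auto
    also have "\<dots> = (\<integral>\<^sup>+y. (\<integral>\<^sup>+x. indicator A x * indicator ?B (y - x) \<partial>?M) \<partial>lborel)"
      by (rule Fubini') (simp add: split_beta')
    also have "\<dots> = (\<integral>\<^sup>+y. (\<integral>\<^sup>+x. indicator A (x + y) * indicator ?B (y - (x + y)) \<partial>?M) \<partial>lborel)"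
      by (subst trM) auto
    also have "\<dots> = (\<integral>\<^sup>+y. (\<integral>\<^sup>+x. indicator ?B x * indicator A (y + x) \<partial>?M) \<partial>lborel)"
      by (intro nn_integral_cong) (auto simp: indicator_def add.commute)
    also have "\<dots> = (\<integral>\<^sup>+x. (\<integral>\<^sup>+y. indicator ?B x * indicator A (y + x) \<partial>lborel) \<partial>?M)"
      by (rule Fubini'[symmetric]) (simp add: split_beta')
    also have "\<dots> = (\<integral>\<^sup>+x. indicator ?B x * (\<integral>\<^sup>+y. indicator A (y - (-x)) \<partial>lborel) \<partial>?M)"
      by (subst nn_integral_cmult) auto
    also have "\<dots> = emeasure lborel A * emeasure ?M ?B"
      by (subst tr) (auto simp: nn_integral_cmult_indicator mult.commute)
    finally have "emeasure lborel ?B * emeasure ?M A = emeasure lborel ?B * emeasure lborel A"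
      unfolding emT by (simp add: mult.commute)
    then show "emeasure ?M A = emeasure lborel A"
      using B0 by (simp add: ennreal_mult_cancel_left)
  qed simp
qed

section \<open>Haar measure of a compact group of orthogonal matrices\<close>

lemma continuous_on_matrix_vector_mult [continuous_intros]:
  fixes f :: "'a::topological_space \<Rightarrow> real ^ 'n ^ 'm" and g :: "'a \<Rightarrow> real ^ 'n"
  assumes "continuous_on A f" "continuous_on A g"
  shows "continuous_on A (\<lambda>x. f x *v g x)"
  unfolding matrix_vector_mult_def by (intro continuous_intros assms)

lemma continuous_on_matrix_matrix_mult [continuous_intros]:
  fixes f :: "'a::topological_space \<Rightarrow> real ^ 'n ^ 'm" and g :: "'a \<Rightarrow> real ^ 'k ^ 'n"
  assumes "continuous_on A f" "continuous_on A g"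
  shows "continuous_on A (\<lambda>x. f x ** g x)"
  unfolding matrix_matrix_mult_def by (intro continuous_intros assms)

lemma continuous_on_transpose [continuous_intros]:
  fixes f :: "'a::topological_space \<Rightarrow> real ^ 'n ^ 'm"
  assumes "continuous_on A f"
  shows "continuous_on A (\<lambda>x. transpose (f x))"
  unfolding transpose_def by (intro continuous_intros assms)

lemma borel_measurable_matrix_vector_mult [measurable]:
  "(\<lambda>p. fst p *v snd p) \<in> borel_measurable (borel \<Otimes>\<^sub>M borel :: ((real ^ 'n ^ 'm) \<times> (real ^ 'n)) measure)"
  unfolding borel_prod by (intro borel_measurable_continuous_onI continuous_intros)

lemma orthogonal_transformation_matrix_mult:
  fixes S :: "real ^ 'n ^ 'n"
  assumes S: "orthogonal_matrix S"
  shows "orthogonal_transformation (\<lambda>M :: real ^ 'k ^ 'n. S ** M)"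
  unfolding orthogonal_transformation
proof (intro conjI allI)
  show "linear (\<lambda>M :: real ^ 'k ^ 'n. S ** M)"
    by (intro linearI) (simp_all add: matrix_add_ldistrib matrix_scalar_ac scalar_matrix_assoc)
  fix M :: "real ^ 'k ^ 'n"
  have norm_sq: "(norm A)\<^sup>2 = (\<Sum>j\<in>UNIV. (norm (column j A))\<^sup>2)" for A :: "real ^ 'k ^ 'n"
    unfolding power2_norm_eq_inner inner_vec_def column_def vec_lambda_beta by (rule sum.swap)
  have col: "column j (S ** M) = S *v column j M" for j
    by (simp add: column_def matrix_matrix_mult_def matrix_vector_mult_def vec_eq_iff)
  have "norm (S *v x) = norm x" for x
    using S orthogonal_transformation_matrix[of "(*v) S"] orthogonal_transformation_norm[of "(*v) S"] by auto
  then have "(norm (S ** M))\<^sup>2 = (norm M)\<^sup>2"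
    unfolding norm_sq col by simp
  then show "norm (S ** M) = norm M" by simp
qed

locale compact_orthogonal_group =
  fixes G :: "(real ^ 'n ^ 'n) set"
  assumes G_compact: "compact G"
    and G_orthogonal: "S \<in> G \<Longrightarrow> orthogonal_matrix S"
    and G_one: "mat 1 \<in> G"
    and G_mult: "S \<in> G \<Longrightarrow> T \<in> G \<Longrightarrow> S ** T \<in> G"
    and G_inv: "S \<in> G \<Longrightarrow> transpose S \<in> G"
begin

lemma transpose_mult_self: "S \<in> G \<Longrightarrow> transpose S ** S = mat 1" "S \<in> G \<Longrightarrow> S ** transpose S = mat 1"
  using G_orthogonal by (auto simp: orthogonal_matrix_def)

lemma borel_G [measurable]: "G \<in> sets borel"
  using G_compact by (simp add: borel_closed compact_imp_closed)

text \<open>Consequently the metric neighbourhoods of the group are invariant under left multiplication.\<close>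

lemma infdist_G_mult:
  assumes "S \<in> G"
  shows "infdist (S ** M) G = infdist M G"
proof -
  have *: "infdist (S ** M) G \<le> infdist M G" if "S \<in> G" for S M
  proof -
    obtain T where T: "T \<in> G" "infdist M G = dist M T"
      using infdist_attains_inf[of G M] G_compact G_one compact_imp_closed by blast
    have "infdist (S ** M) G \<le> dist (S ** M) (S ** T)"
      using that T(1) by (intro infdist_le G_mult)
    also have "\<dots> = norm (S ** (M - T))"
      using linear_diff[OF orthogonal_transformation_linear[OF orthogonal_transformation_matrix_mult[OF G_orthogonal[OF that]]], of M T]
      by (simp add: dist_norm)
    also have "\<dots> = norm (M - T)"
      using orthogonal_transformation_norm[OF orthogonal_transformation_matrix_mult[OF G_orthogonal[OF that]]] .
    finally show ?thesis using T(2) by (simp add: dist_norm)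
  qed
  have "infdist (transpose S ** (S ** M)) G = infdist M G"
    using transpose_mult_self(1)[OF assms] by (simp add: matrix_mul_assoc)
  then show ?thesis
    using *[OF assms, of M] *[OF G_inv[OF assms], of "S ** M"] by simp
qed

lemma left_mult_measurable [measurable]: "(\<lambda>M. S ** M) \<in> borel_measurable (borel :: (real ^ 'n ^ 'n) measure)"
  by (intro borel_measurable_continuous_onI continuous_intros)

text \<open>Normalized Lebesgue measure on the neighbourhood \<open>U k\<close> of the group is invariant under left
  multiplication by the group. A weak limit inherits the invariance, and it lives on the group since
  the mean distance to the group tends to 0.\<close>

lemma normalized_haar_exists: "\<exists>m. normalized_haar G m"
proof -
  define U where "U k = {M. infdist M G < 1 / real (Suc k)}" for k
  define P where "P k = uniform_measure lborel (U k)" for k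
  have U_open: "open (U k)" for k
    unfolding U_def by (intro open_Collect_less continuous_intros)
  then have [measurable]: "U k \<in> sets borel" for k by simp
  obtain b where b: "\<And>T. T \<in> G \<Longrightarrow> norm T \<le> b"
    using compact_imp_bounded[OF G_compact] by (auto simp: bounded_iff)
  have U_bdd: "norm M \<le> b + 1" if "M \<in> U k" for M k
  proof -
    obtain T where T: "T \<in> G" "infdist M G = dist M T"
      using infdist_attains_inf[of G M] G_compact G_one compact_imp_closed by blast
    have "1 / real (Suc k) \<le> 1" by simp
    moreover have "norm (M - T) < 1 / real (Suc k)"
      using that T(2) unfolding U_def by (simp add: dist_norm)
    ultimately have "norm (M - T) \<le> 1" by linarith
    then show ?thesis using b[OF T(1)] norm_triangle_sub[of M T] by simp
  qed
  have mat1: "mat 1 \<in> U k" for k using G_one by (simp add: U_def)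
  have U_fin: "emeasure lborel (U k) \<noteq> \<infinity>" for k
  proof -
    have "emeasure lborel (U k) \<le> emeasure lborel (cball (0 :: real ^ 'n ^ 'n) (b + 1))"
      using U_bdd by (intro emeasure_mono) auto
    then show ?thesis using emeasure_lborel_cball_finite[of "0 :: real ^ 'n ^ 'n" "b + 1"]
      by (auto simp: top_unique)
  qed
  have U_pos: "emeasure lborel (U k) \<noteq> 0" for k
  proof -
    obtain e where e: "e > 0" "ball (mat 1) e \<subseteq> U k" using U_open mat1 openE by blast
    have "0 < measure lborel (ball (mat 1 :: real ^ 'n ^ 'n) e)" using content_ball_pos[OF e(1)] by simp
    then have "0 < emeasure lborel (ball (mat 1 :: real ^ 'n ^ 'n) e)"
      by (metis measure_eq_0_null_sets not_gr_zero null_setsI order_less_irrefl sets_lborel borel_open open_ball)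
    also have "\<dots> \<le> emeasure lborel (U k)" using e(2) by (intro emeasure_mono) auto
    finally show ?thesis by simp
  qed
  have Psets: "sets (P k) = sets borel" for k by (simp add: P_def)
  note [measurable_cong] = Psets
  have Pprob: "prob_space (P k)" for k
    unfolding P_def by (rule prob_space_uniform_measure[OF U_pos U_fin])
  have PU: "AE M in P k. M \<in> U k" for k
    unfolding P_def by (intro AE_uniform_measureI) auto
  have Pbdd: "AE M in P k. norm M \<le> b + 1" for k
    using PU[of k] by eventually_elim (rule U_bdd)
  obtain r M where r: "strict_mono r" and M: "sets M = sets borel" "prob_space M"
    and conv: "\<And>f :: real ^ 'n ^ 'n \<Rightarrow> real. continuous_on UNIV f \<Longrightarrow>
       (\<lambda>k. \<integral>x. f x \<partial>P (r k)) \<longlonglongrightarrow> (\<integral>x. f x \<partial>M)"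
    using prob_measures_cball_compact[where P=P and B="b + 1", OF Psets Pprob Pbdd] by blast
  interpret M: prob_space M by (rule M)
  note [measurable_cong] = M(1)
  have P_inv: "distr (P k) borel (\<lambda>T. S ** T) = P k" if S: "S \<in> G" for S k
  proof -
    have inv: "distr lborel borel (\<lambda>T. S ** T) = (lborel :: (real ^ 'n ^ 'n) measure)"
      using lborel_distr_orthogonal[OF orthogonal_transformation_matrix_mult[OF G_orthogonal[OF S]]] .
    show ?thesis
    proof (rule measure_eqI)
      fix A assume "A \<in> sets (distr (P k) borel (\<lambda>T. S ** T))"
      then have [measurable]: "A \<in> sets borel" by simp
      have "(\<lambda>T. S ** T) -` U k = U k" by (auto simp: U_def infdist_G_mult[OF S])
      then have "U k \<inter> (\<lambda>T. S ** T) -` A = (\<lambda>T. S ** T) -` (U k \<inter> A)" by auto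
      moreover have "emeasure lborel ((\<lambda>T. S ** T) -` (U k \<inter> A)) = emeasure lborel (U k \<inter> A)"
        by (subst (2) inv[symmetric]) (simp add: emeasure_distr)
      moreover have "(\<lambda>T. S ** T) -` A \<in> sets lborel"
        using measurable_sets[OF left_mult_measurable, of A S] by simp
      ultimately show "emeasure (distr (P k) borel (\<lambda>T. S ** T)) A = emeasure (P k) A"
        by (simp add: emeasure_distr P_def emeasure_uniform_measure)
    qed (simp add: Psets)
  qed
  have M_inv: "distr M borel (\<lambda>T. S ** T) = M" if S: "S \<in> G" for S
  proof (rule finite_borel_measure_eqI)
    show "finite_measure (distr M borel (\<lambda>T. S ** T))"
      by (intro M.finite_measure_distr) measurable
    fix f :: "real ^ 'n ^ 'n \<Rightarrow> real" assume f: "continuous_on UNIV f"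
    have fS: "continuous_on UNIV (\<lambda>T. f (S ** T))"
      by (intro continuous_on_compose2[OF f] continuous_intros) auto
    have [measurable]: "f \<in> borel_measurable borel" using f by (rule borel_measurable_continuous_onI)
    have "(\<integral>T. f (S ** T) \<partial>P k) = (\<integral>T. f T \<partial>P k)" for k
      by (subst (2) P_inv[OF S, of k, symmetric]) (simp add: integral_distr)
    then have "(\<integral>T. f (S ** T) \<partial>M) = (\<integral>T. f T \<partial>M)"
      using conv[OF fS] conv[OF f] LIMSEQ_unique by simp
    then show "(\<integral>T. f T \<partial>distr M borel (\<lambda>T. S ** T)) = (\<integral>T. f T \<partial>M)"
      by (simp add: integral_distr)
  qed (auto simp: M(1) intro: M.finite_measure_axioms)
  have M_G: "AE T in M. T \<in> G"
  proof -
    have infc: "continuous_on UNIV (\<lambda>T. min 1 (infdist T G))" by (intro continuous_intros)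
    then have [measurable]: "(\<lambda>T. min 1 (infdist T G)) \<in> borel_measurable borel"
      by (rule borel_measurable_continuous_onI)
    have "(\<lambda>k. \<integral>T. min 1 (infdist T G) \<partial>P (r k)) \<longlonglongrightarrow> 0"
    proof (rule tendsto_sandwich[of "\<lambda>_. 0" _ _ "\<lambda>k. 1 / real (Suc (r k))"])
      show "(\<lambda>k. 1 / real (Suc (r k))) \<longlonglongrightarrow> 0"
        using LIMSEQ_subseq_LIMSEQ[OF LIMSEQ_Suc[OF lim_1_over_n] r] by (simp add: o_def)
      show "\<forall>\<^sub>F k in sequentially. (\<integral>T. min 1 (infdist T G) \<partial>P (r k)) \<le> 1 / real (Suc (r k))"
      proof (intro always_eventually allI)
        fix k
        interpret Pk: prob_space "P (r k)" by (rule Pprob)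
        have "(\<integral>T. min 1 (infdist T G) \<partial>P (r k)) \<le> (\<integral>T. 1 / real (Suc (r k)) \<partial>P (r k))"
        proof (rule integral_mono_AE)
          show "integrable (P (r k)) (\<lambda>T. min 1 (infdist T G))"
            by (intro Pk.integrable_const_bound[where B=1]) (auto simp: infdist_nonneg)
          show "AE T in P (r k). min 1 (infdist T G) \<le> 1 / real (Suc (r k))"
            using PU by eventually_elim (auto simp: U_def)
        qed simp
        then show "(\<integral>T. min 1 (infdist T G) \<partial>P (r k)) \<le> 1 / real (Suc (r k))"
          by (simp add: Pk.prob_space)
      qed
    qed (auto intro!: always_eventually integral_nonneg_AE simp: infdist_nonneg)
    then have "(\<integral>T. min 1 (infdist T G) \<partial>M) = 0"
      using conv[OF infc] LIMSEQ_unique by blast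
    moreover have "integrable M (\<lambda>T. min 1 (infdist T G))"
      by (intro M.integrable_const_bound[where B=1]) (auto simp: infdist_nonneg)
    ultimately have "AE T in M. min 1 (infdist T G) = 0"
      by (subst (asm) integral_nonneg_eq_0_iff_AE) (auto simp: infdist_nonneg)
    then show ?thesis
    proof eventually_elim
      case (elim T)
      then have "infdist T G = 0" by (auto simp: min_def split: if_splits)
      then show ?case
        using in_closed_iff_infdist_zero[of G T] G_compact G_one compact_imp_closed by auto
    qed
  qed
  let ?m = "restrict_space M G"
  have "normalized_haar G ?m"
    unfolding normalized_haar_def
  proof (intro conjI ballI)
    show sm: "sets ?m = sets (restrict_space borel G)"
      using M(1) by (rule sets_restrict_space_cong)
    have "emeasure M (G \<inter> space M) = 1"
      using M_G M.emeasure_eq_1_AE[of G] M(1) sets_eq_imp_space_eq[OF M(1)] by simp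
    then show pm: "prob_space ?m"
      using M(1) sets_eq_imp_space_eq[OF M(1)]
      by (intro prob_space_restrict_space) auto
    fix S assume S: "S \<in> G"
    have spm: "space ?m = G" using sets_eq_imp_space_eq[OF M(1)] by (simp add: space_restrict_space)
    have Sm: "(\<lambda>T. S ** T) \<in> measurable ?m ?m"
      unfolding measurable_cong_sets[OF sm sm]
      by (intro measurable_restrict_space2 measurable_restrict_space1 left_mult_measurable)
         (auto simp: space_restrict_space G_mult[OF S])
    show "distr ?m ?m (\<lambda>T. S ** T) = ?m"
    proof (rule measure_eqI)
      fix A assume "A \<in> sets (distr ?m ?m (\<lambda>T. S ** T))"
      then have A: "A \<in> sets ?m" by simp
      then have A': "A \<in> sets M" "A \<subseteq> G"
        using sets_restrict_space_iff[of G borel A] unfolding sm M(1) by simp_all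
      have pre: "(\<lambda>T. S ** T) -` A \<inter> G = (\<lambda>T. S ** T) -` A"
      proof (intro equalityI subsetI)
        fix T assume T: "T \<in> (\<lambda>T. S ** T) -` A"
        then have "S ** T \<in> G" using A'(2) by auto
        then have "transpose S ** (S ** T) \<in> G" by (rule G_mult[OF G_inv[OF S]])
        then show "T \<in> (\<lambda>T. S ** T) -` A \<inter> G"
          using T transpose_mult_self(1)[OF S] by (simp add: matrix_mul_assoc)
      qed auto
      have "emeasure (distr ?m ?m (\<lambda>T. S ** T)) A = emeasure ?m ((\<lambda>T. S ** T) -` A \<inter> G)"
        using A Sm by (simp add: emeasure_distr spm)
      also have "\<dots> = emeasure M ((\<lambda>T. S ** T) -` A)"
        unfolding pre using M(1) pre by (subst emeasure_restrict_space) auto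
      also have "\<dots> = emeasure (distr M borel (\<lambda>T. S ** T)) A"
        using A'(1) M(1) sets_eq_imp_space_eq[OF M(1)] by (simp add: emeasure_distr)
      also have "\<dots> = emeasure ?m A"
        unfolding M_inv[OF S] using A' M(1) by (subst emeasure_restrict_space) auto
      finally show "emeasure (distr ?m ?m (\<lambda>T. S ** T)) A = emeasure ?m A" .
    qed simp
  qed
  then show ?thesis by blast
qed

text \<open>For left-invariant \<open>m1\<close> and \<open>m2\<close>, evaluating the law of \<open>T\<^sup>t S\<close> for independent \<open>S\<close>
  and \<open>T\<close> with these laws in both orders shows that \<open>m1\<close> is the image of \<open>m2\<close> under
  inversion. So both given measures are the image of one and the same measure.\<close>

lemma normalized_haar_unique:
  assumes m: "normalized_haar G m" and m': "normalized_haar G m'"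
  shows "m = m'"
proof -
  have eq_transpose: "m1 = m2'"
    if "normalized_haar G m1" "normalized_haar G m2"
      and m2': "m2' = distr m2 (restrict_space borel G) transpose" for m1 m2 m2'
  proof -
    have s1 [measurable_cong]: "sets m1 = sets (restrict_space borel G)" and p1: "prob_space m1"
      and i1: "\<And>S. S \<in> G \<Longrightarrow> distr m1 m1 (\<lambda>T. S ** T) = m1"
      using that(1) by (auto simp: normalized_haar_def)
    have s2 [measurable_cong]: "sets m2 = sets (restrict_space borel G)" and p2: "prob_space m2"
      and i2: "\<And>S. S \<in> G \<Longrightarrow> distr m2 m2 (\<lambda>T. S ** T) = m2"
      using that(2) by (auto simp: normalized_haar_def)
    interpret m1: prob_space m1 by (rule p1)
    interpret m2: prob_space m2 by (rule p2)
    interpret pair_prob_space m1 m2 ..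
    have sp: "space m1 = G" "space m2 = G"
      using sets_eq_imp_space_eq[OF s1] sets_eq_imp_space_eq[OF s2] by (auto simp: space_restrict_space)
    have tm [measurable]: "transpose \<in> measurable (restrict_space borel G) (restrict_space borel G)"
      by (intro measurable_restrict_space2 measurable_restrict_space1 borel_measurable_continuous_onI continuous_intros)
         (auto simp: space_restrict_space G_inv)
    have mm [measurable]: "(\<lambda>p. fst p ** snd p) \<in> measurable (restrict_space borel G \<Otimes>\<^sub>M restrict_space borel G) (restrict_space borel G)"
    proof (rule measurable_restrict_space2)
      have id: "(\<lambda>T. T) \<in> measurable (restrict_space borel G) borel"
        by (intro measurable_restrict_space1) simp
      have pr: "(\<lambda>p. (fst p, snd p)) \<in> measurable (restrict_space borel G \<Otimes>\<^sub>M restrict_space borel G) (borel \<Otimes>\<^sub>M borel)"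
        by (intro measurable_Pair measurable_compose[OF _ id] measurable_fst measurable_snd)
      have mult: "(\<lambda>p. fst p ** snd p) \<in> measurable (borel \<Otimes>\<^sub>M borel) (borel :: (real ^ 'n ^ 'n) measure)"
        unfolding borel_prod by (intro borel_measurable_continuous_onI continuous_intros)
      show "(\<lambda>p. fst p ** snd p) \<in> measurable (restrict_space borel G \<Otimes>\<^sub>M restrict_space borel G) borel"
        using measurable_compose[OF pr mult] unfolding fst_conv snd_conv .
    qed (auto simp: space_restrict_space space_pair_measure G_mult)
    show "m1 = m2'"
    proof (rule measure_eqI)
      show "sets m1 = sets m2'" by (simp add: m2' s1)
      fix A assume "A \<in> sets m1"
      then have A [measurable]: "A \<in> sets (restrict_space borel G)" using s1 by simp
      \<comment> \<open>Conditionally on \<open>T\<close>, invariance of \<open>m1\<close> removes the factor \<open>T\<^sup>t\<close>; conditionally on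
        \<open>S\<close>, invariance of \<open>m2\<close> removes \<open>S\<close> from \<open>T\<^sup>t S = (S\<^sup>t T)\<^sup>t\<close>.\<close>
      have 1: "(\<integral>\<^sup>+S. indicator A (transpose T ** S) \<partial>m1) = emeasure m1 A" if "T \<in> G" for T
      proof -
        have "(\<integral>\<^sup>+S. indicator A S \<partial>distr m1 m1 (\<lambda>S. transpose T ** S)) = (\<integral>\<^sup>+S. indicator A (transpose T ** S) \<partial>m1)"
        proof (rule nn_integral_distr)
          have "(\<lambda>S. (\<lambda>p. fst p ** snd p) (transpose T, S)) \<in> measurable m1 m1"
            using G_inv[OF that] unfolding measurable_cong_sets[OF s1 s1]
            by (intro measurable_compose[OF _ mm] measurable_Pair) (auto simp: space_restrict_space)
          then show "(\<lambda>S. transpose T ** S) \<in> measurable m1 m1" by simp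
        qed (use A s1 in simp)
        then show ?thesis using i1[OF G_inv[OF that]] A s1 by simp
      qed
      have 2: "(\<integral>\<^sup>+T. indicator A (transpose T ** S) \<partial>m2) = emeasure m2' A" if "S \<in> G" for S
      proof -
        have eq: "transpose T ** S = transpose (transpose S ** T)" for T :: "real ^ 'n ^ 'n"
          by (simp add: matrix_transpose_mul)
        have fm: "(\<lambda>T. indicator A (transpose T)) \<in> borel_measurable m2" by measurable
        have "(\<integral>\<^sup>+T. indicator A (transpose T) \<partial>distr m2 m2 (\<lambda>T. transpose S ** T)) = (\<integral>\<^sup>+T. indicator A (transpose (transpose S ** T)) \<partial>m2)"
        proof (rule nn_integral_distr)
          have "(\<lambda>T. (\<lambda>p. fst p ** snd p) (transpose S, T)) \<in> measurable m2 m2"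
            using G_inv[OF that] unfolding measurable_cong_sets[OF s2 s2]
            by (intro measurable_compose[OF _ mm] measurable_Pair) (auto simp: space_restrict_space)
          then show "(\<lambda>T. transpose S ** T) \<in> measurable m2 m2" by simp
        qed (use fm in simp)
        moreover have "(\<integral>\<^sup>+T. indicator A (transpose T) \<partial>m2) = emeasure m2' A"
        proof -
          have "emeasure m2' A = (\<integral>\<^sup>+T. indicator A T \<partial>m2')" by (simp add: m2')
          also have "\<dots> = (\<integral>\<^sup>+T. indicator A (transpose T) \<partial>m2)"
            unfolding m2' by (subst nn_integral_distr) auto
          finally show ?thesis by simp
        qed
        ultimately show ?thesis using i2[OF G_inv[OF that]] unfolding eq by simp
      qed
      have meas: "(\<lambda>(S, T). indicator A (transpose T ** S) :: ennreal) \<in> borel_measurable (m1 \<Otimes>\<^sub>M m2)"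
      proof -
        have "(\<lambda>p. (\<lambda>q. fst q ** snd q) (transpose (snd p), fst p)) \<in> measurable (m1 \<Otimes>\<^sub>M m2) (restrict_space borel G)"
          by (intro measurable_compose[OF _ mm] measurable_Pair measurable_compose[OF _ tm]) measurable
        then show ?thesis by (simp add: split_beta')
      qed
      have "emeasure m1 A = (\<integral>\<^sup>+T. (\<integral>\<^sup>+S. indicator A (transpose T ** S) \<partial>m1) \<partial>m2)"
        by (subst nn_integral_cong[OF 1]) (auto simp: sp m2.emeasure_space_1[unfolded sp])
      also have "\<dots> = (\<integral>\<^sup>+S. (\<integral>\<^sup>+T. indicator A (transpose T ** S) \<partial>m2) \<partial>m1)"
        using Fubini'[OF meas] by simp
      also have "\<dots> = emeasure m2' A"
        by (subst nn_integral_cong[OF 2]) (auto simp: sp m1.emeasure_space_1[unfolded sp])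
      finally show "emeasure m1 A = emeasure m2' A" .
    qed
  qed
  show ?thesis using eq_transpose[OF m m' refl] eq_transpose[OF m' m' refl] by simp
qed

lemma normalized_haar_haar: "normalized_haar G (haar G)"
  unfolding haar_def by (rule theI') (use normalized_haar_exists normalized_haar_unique in auto)

end

lemma compact_orthogonal_group_stabilizer_O:
  fixes u :: "real ^ 'n"
  shows "compact_orthogonal_group (stabilizer_O u)"
proof
  have norm_orth: "norm (A *v x) = norm x" if "orthogonal_matrix A" for A :: "real ^ 'n ^ 'n" and x
    using that orthogonal_transformation_matrix[of "(*v) A"] orthogonal_transformation_norm[of "(*v) A"] by auto
  have "closed {T :: real ^ 'n ^ 'n. transpose T ** T = mat 1 \<and> T ** transpose T = mat 1 \<and> T *v u = u}"
    by (intro closed_Collect_conj closed_Collect_eq continuous_intros)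
  then have "closed (stabilizer_O u)"
    by (simp add: stabilizer_O_def orthogonal_matrix_def conj_assoc)
  moreover have "bounded (stabilizer_O u)"
  proof (rule boundedI)
    fix T assume "T \<in> stabilizer_O u"
    then have T: "orthogonal_matrix T" by (simp add: stabilizer_O_def)
    have "norm T = norm (T ** mat 1)" by simp
    also have "\<dots> = norm (mat 1 :: real ^ 'n ^ 'n)"
      by (rule orthogonal_transformation_norm[OF orthogonal_transformation_matrix_mult[OF T]])
    finally show "norm T \<le> norm (mat 1 :: real ^ 'n ^ 'n)" by simp
  qed
  ultimately show "compact (stabilizer_O u)" by (simp add: compact_eq_bounded_closed)
  show "transpose S \<in> stabilizer_O u" if "S \<in> stabilizer_O u" for S
  proof -
    have "transpose S *v u = transpose S *v (S *v u)" using that by (simp add: stabilizer_O_def)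
    also have "\<dots> = (transpose S ** S) *v u" by (simp only: matrix_vector_mul_assoc)
    also have "\<dots> = u" using that by (simp add: stabilizer_O_def orthogonal_matrix_def)
    finally show ?thesis using that by (simp add: stabilizer_O_def del: transpose_matrix_vector)
  qed
  show "S ** T \<in> stabilizer_O u" if "S \<in> stabilizer_O u" "T \<in> stabilizer_O u" for S T
  proof -
    have "(S ** T) *v u = S *v (T *v u)" by (simp only: matrix_vector_mul_assoc)
    then show ?thesis using that by (simp add: stabilizer_O_def orthogonal_matrix_mul)
  qed
qed (auto simp: stabilizer_O_def orthogonal_matrix_id)

section \<open>Support functions of convex bodies\<close>

lemma support_fun_bdd:
  assumes "convex_body K"
  shows "bdd_above ((\<lambda>y. x \<bullet> y) ` K)"
  using assms unfolding convex_body_def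
  by (intro bounded_imp_bdd_above compact_imp_bounded compact_continuous_image continuous_intros) auto

lemma support_fun_upper:
  assumes "convex_body K" "y \<in> K"
  shows "x \<bullet> y \<le> support_fun K x"
  unfolding support_fun_def by (intro cSUP_upper support_fun_bdd assms)

lemma support_fun_least:
  assumes "convex_body K" "\<And>y. y \<in> K \<Longrightarrow> x \<bullet> y \<le> c"
  shows "support_fun K x \<le> c"
  unfolding support_fun_def using assms by (intro cSUP_least) (auto simp: convex_body_def)

locale sublinear =
  fixes f :: "'a::euclidean_space \<Rightarrow> real"
  assumes subadditive: "f (x + y) \<le> f x + f y"
    and homogeneous: "c \<ge> 0 \<Longrightarrow> f (c *\<^sub>R x) = c * f x"
begin

lemma zero [simp]: "f 0 = 0" using homogeneous[of 0 0] by simp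

lemma bound: "\<exists>B>0. \<forall>x. f x \<le> B * norm x"
proof -
  define B where "B = (\<Sum>i\<in>Basis. \<bar>f i\<bar> + \<bar>f (- i)\<bar>) + 1"
  have term_le: "f (c *\<^sub>R i) \<le> \<bar>c\<bar> * (\<bar>f i\<bar> + \<bar>f (- i)\<bar>)" for c i
  proof (cases "c \<ge> 0")
    case True
    then show ?thesis by (simp add: homogeneous mult_left_mono)
  next
    case False
    then have "f (c *\<^sub>R i) = \<bar>c\<bar> * f (- i)" using homogeneous[of "- c" "- i"] by simp
    then show ?thesis by (simp add: mult_left_mono)
  qed
  have sum_le: "f (\<Sum>i\<in>A. g i) \<le> (\<Sum>i\<in>A. f (g i))" if "finite A" for A and g :: "'a \<Rightarrow> 'a"
    using that
  proof (induction A rule: finite_induct)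
    case (insert a A)
    then show ?case using subadditive[of "g a" "\<Sum>i\<in>A. g i"] by simp
  qed simp
  have "f x \<le> B * norm x" for x
  proof -
    have "f x = f (\<Sum>i\<in>Basis. (x \<bullet> i) *\<^sub>R i)" by (simp add: euclidean_representation)
    also have "\<dots> \<le> (\<Sum>i\<in>Basis. f ((x \<bullet> i) *\<^sub>R i))" by (rule sum_le) simp
    also have "\<dots> \<le> (\<Sum>i\<in>Basis. norm x * (\<bar>f i\<bar> + \<bar>f (- i)\<bar>))"
      by (intro sum_mono order.trans[OF term_le] mult_right_mono) (auto simp: Basis_le_norm)
    also have "\<dots> \<le> B * norm x" unfolding sum_distrib_left[symmetric] B_def by (simp add: algebra_simps)
    finally show ?thesis .
  qed
  moreover have "B > 0" unfolding B_def by (intro add_nonneg_pos sum_nonneg) auto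
  ultimately show ?thesis by blast
qed

lemma lipschitz: "\<exists>B>0. \<forall>x y. \<bar>f x - f y\<bar> \<le> B * norm (x - y)"
proof -
  obtain B where B: "B > 0" "\<And>x. f x \<le> B * norm x" using bound by blast
  have le: "f x - f y \<le> B * norm (x - y)" for x y
    using subadditive[of y "x - y"] B(2)[of "x - y"] by simp
  then have "\<bar>f x - f y\<bar> \<le> B * norm (x - y)" for x y
    using le[of x y] le[of y x] by (simp add: abs_le_iff norm_minus_commute)
  with B(1) show ?thesis by blast
qed

lemma continuous: "continuous_on A f"
proof -
  obtain B where B: "B > 0" "\<And>x y. \<bar>f x - f y\<bar> \<le> B * norm (x - y)" using lipschitz by blast
  show ?thesis
  proof (rule lipschitz_on_continuous_on[where L=B])
    show "B-lipschitz_on A f" using B by (intro lipschitz_onI) (auto simp: dist_norm)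
  qed
qed

lemma nonneg:
  assumes "f (- x) = f x"
  shows "f x \<ge> 0"
  using subadditive[of x "- x"] assms by simp

end

lemma sublinear_support_fun:
  assumes K: "convex_body K"
  shows "sublinear (support_fun K)"
proof
  fix x y :: "real ^ 'a" and c :: real
  show "support_fun K (x + y) \<le> support_fun K x + support_fun K y"
    by (intro support_fun_least[OF K]) (simp add: inner_add_left add_mono support_fun_upper[OF K])
  assume c: "c \<ge> 0"
  show "support_fun K (c *\<^sub>R x) = c * support_fun K x"
  proof (cases "c = 0")
    case True
    then show ?thesis using K by (simp add: support_fun_def convex_body_def)
  next
    case False
    with c have "c > 0" by simp
    have le: "support_fun K (c *\<^sub>R x) \<le> c * support_fun K x" if "c > 0" for c x
      using that by (intro support_fun_least[OF K]) (simp add: support_fun_upper[OF K])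
    show ?thesis
      using le[OF \<open>c > 0\<close>, of x] le[of "inverse c" "c *\<^sub>R x"] \<open>c > 0\<close> by (simp add: field_simps)
  qed
qed

lemma support_fun_inject:
  assumes K: "convex_body K" and L: "convex_body L" and eq: "support_fun K = support_fun L"
  shows "K = L"
proof -
  have sub: "K \<subseteq> L" if K: "convex_body K" and L: "convex_body L" and eq: "support_fun K = support_fun L"
    for K L :: "(real ^ 'a) set"
  proof
    fix z assume z: "z \<in> K"
    show "z \<in> L"
    proof (rule ccontr)
      assume "z \<notin> L"
      moreover have "closed L" "convex L" using L by (auto simp: convex_body_def compact_imp_closed)
      ultimately obtain a b where ab: "a \<bullet> z < b" "\<And>x. x \<in> L \<Longrightarrow> a \<bullet> x > b"
        using separating_hyperplane_closed_point by metis
      have "support_fun L (- a) \<le> - b"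
        using ab(2) by (intro support_fun_least[OF L]) (simp add: less_imp_le)
      moreover have "- (a \<bullet> z) \<le> support_fun K (- a)" using support_fun_upper[OF K z, of "- a"] by simp
      ultimately show False using ab(1) eq by simp
    qed
  qed
  show ?thesis using sub[OF K L eq] sub[OF L K eq[symmetric]] by blast
qed

lemma centrally_symmetric_iff_support_fun_even:
  assumes K: "convex_body K"
  shows "centrally_symmetric K \<longleftrightarrow> (\<forall>x. support_fun K (- x) = support_fun K x)"
proof -
  have neg: "convex_body (uminus ` K)" using K
    by (auto simp: convex_body_def compact_negations convex_negations)
  have "support_fun (uminus ` K) = (\<lambda>x. support_fun K (- x))"
    by (simp add: fun_eq_iff support_fun_def image_image)
  then show ?thesis
    using support_fun_inject[OF neg K] by (auto simp: centrally_symmetric_def fun_eq_iff)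
qed

text \<open>The body consists of the linear minorants of \<open>f\<close>. That they come arbitrarily close to \<open>f\<close> at a
  given point \<open>x0\<close> is the Hahn-Banach theorem; here it follows by separating the closed convex
  epigraph from a point slightly below \<open>(x0, f x0)\<close>.\<close>

lemma sublinear_is_support_fun:
  fixes f :: "real ^ 'n \<Rightarrow> real"
  assumes "sublinear f"
  shows "\<exists>L. convex_body L \<and> support_fun L = f"
proof -
  interpret sublinear f by (rule assms)
  define L where "L = {y. \<forall>x. x \<bullet> y \<le> f x}"
  have L_alt: "L = (\<Inter>x. {y. x \<bullet> y \<le> f x})" by (auto simp: L_def)
  have below: "\<exists>y\<in>L. x0 \<bullet> y > f x0 - e" if "e > 0" for x0 e
  proof -
    let ?S = "{p :: (real ^ 'n) \<times> real. f (fst p) \<le> snd p}"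
    have "convex ?S"
    proof (rule convexI, safe)
      fix x y :: "real ^ 'n" and s t u v :: real
      assume a: "f (fst (x, s)) \<le> snd (x, s)" "f (fst (y, t)) \<le> snd (y, t)" "0 \<le> u" "0 \<le> v" "u + v = 1"
      have "f (u *\<^sub>R x + v *\<^sub>R y) \<le> u * f x + v * f y"
        using subadditive[of "u *\<^sub>R x" "v *\<^sub>R y"] a by (simp add: homogeneous)
      also have "\<dots> \<le> u * s + v * t" using a by (intro add_mono mult_left_mono) auto
      finally show "f (fst (u *\<^sub>R (x, s) + v *\<^sub>R (y, t))) \<le> snd (u *\<^sub>R (x, s) + v *\<^sub>R (y, t))" by simp
    qed
    moreover have "closed ?S"
      by (intro closed_Collect_le continuous_intros continuous_on_compose2[OF continuous]) auto
    moreover have "(x0, f x0 - e) \<notin> ?S" using that by simp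
    ultimately obtain p b where pb: "p \<bullet> (x0, f x0 - e) < b" "\<And>q. q \<in> ?S \<Longrightarrow> p \<bullet> q > b"
      using separating_hyperplane_closed_point[of ?S "(x0, f x0 - e)"] by blast
    obtain a \<beta> where p: "p = (a, \<beta>)" by (cases p)
    have b0: "b < 0" using pb(2)[of "(0, 0)"] by (simp add: zero_prod_def[symmetric])
    \<comment> \<open>The epigraph is a cone, so the separating functional is nonnegative on it.\<close>
    have cone: "a \<bullet> x + \<beta> * t \<ge> 0" if "f x \<le> t" for x t
    proof (rule ccontr)
      assume "\<not> ?thesis"
      then have neg: "a \<bullet> x + \<beta> * t < 0" by simp
      define c where "c = b / (a \<bullet> x + \<beta> * t)"
      have "c \<ge> 0" using b0 neg by (simp add: c_def divide_nonpos_neg)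
      then have "(c *\<^sub>R x, c * t) \<in> ?S" using that by (simp add: homogeneous mult_left_mono)
      from pb(2)[OF this] have "b < c * (a \<bullet> x + \<beta> * t)" by (simp add: p algebra_simps)
      then show False using neg by (simp add: c_def)
    qed
    have "\<beta> \<ge> 0" using cone[of 0 1] by simp
    moreover have "\<beta> \<noteq> 0"
    proof
      assume "\<beta> = 0"
      then have "a \<bullet> (- a) \<ge> 0" using cone[of "- a" "f (- a)"] by simp
      then have "a = 0" by (simp add: inner_eq_zero_iff antisym_conv)
      then show False using pb(1) b0 \<open>\<beta> = 0\<close> by (simp add: p)
    qed
    ultimately have \<beta>: "\<beta> > 0" by simp
    define y where "y = (- 1 / \<beta>) *\<^sub>R a"
    have "x \<bullet> y \<le> f x" for x
      using cone[of x "f x"] \<beta> by (simp add: y_def inner_commute field_simps)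
    moreover have "x0 \<bullet> y > f x0 - e"
    proof -
      have "a \<bullet> x0 + \<beta> * (f x0 - e) < 0" using pb(1) b0 by (simp add: p)
      then show ?thesis using \<beta> by (simp add: y_def inner_commute field_simps)
    qed
    ultimately show ?thesis by (auto simp: L_def)
  qed
  have "L \<noteq> {}" using below[of 1 0] by auto
  moreover have "convex L" unfolding L_alt by (intro convex_INT convex_halfspace_le)
  moreover have "closed L" unfolding L_alt by (intro closed_INT closed_halfspace_le ballI)
  moreover have "bounded L"
  proof -
    obtain B where B: "B > 0" "\<And>x. f x \<le> B * norm x" using bound by blast
    have "norm y \<le> B" if "y \<in> L" for y
    proof -
      have "norm y * norm y \<le> B * norm y"
        using that B(2)[of y] unfolding L_def by (metis (mono_tags, lifting) mem_Collect_eq order.trans power2_eq_square power2_norm_eq_inner)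
      then show ?thesis using B(1) by (cases "y = 0") auto
    qed
    then show ?thesis by (rule boundedI)
  qed
  ultimately have L: "convex_body L" by (simp add: convex_body_def compact_eq_bounded_closed)
  have "support_fun L x = f x" for x
  proof (rule antisym)
    show "support_fun L x \<le> f x" by (intro support_fun_least[OF L]) (auto simp: L_def)
    show "f x \<le> support_fun L x"
    proof (rule field_le_epsilon)
      fix e :: real assume "e > 0"
      from below[OF this, of x] obtain y where "y \<in> L" "x \<bullet> y > f x - e" by blast
      then show "f x \<le> support_fun L x + e" using support_fun_upper[OF L, of y x] by simp
    qed
  qed
  with L show ?thesis by blast
qed

section \<open>Zonoids and their spins\<close>

lemma zonoidE:
  fixes K :: "(real ^ 'n) set"
  assumes "zonoid K"
  obtains \<mu> :: "(real ^ 'n) measure" where "sets \<mu> = sets borel" "finite_measure \<mu>"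
    "AE y in \<mu>. norm y = 1" "support_fun K = (\<lambda>x. \<integral>y. \<bar>x \<bullet> y\<bar> \<partial>\<mu>)"
proof -
  obtain \<nu> :: "(real ^ 'n) measure" where
    s\<nu>: "sets \<nu> = sets (restrict_space borel (sphere 0 1))" and f\<nu>: "finite_measure \<nu>"
    and h\<nu>: "\<And>x. support_fun K x = (\<integral>y. \<bar>x \<bullet> y\<bar> \<partial>\<nu>)"
    using assms by (auto simp: zonoid_def)
  have id: "(\<lambda>y. y) \<in> measurable \<nu> borel"
    unfolding measurable_cong_sets[OF s\<nu> refl] by (intro measurable_restrict_space1) simp
  have sp: "space \<nu> = sphere 0 1"
    using sets_eq_imp_space_eq[OF s\<nu>] by (simp add: space_restrict_space)
  show thesis
  proof (rule that)
    show "finite_measure (distr \<nu> borel (\<lambda>y. y))"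
      by (rule finite_measure.finite_measure_distr[OF f\<nu> id])
    show "AE y in distr \<nu> borel (\<lambda>y. y). norm y = 1"
      by (subst AE_distr_iff[OF id]) (auto simp: sp)
    show "support_fun K = (\<lambda>x. \<integral>y. \<bar>x \<bullet> y\<bar> \<partial>distr \<nu> borel (\<lambda>y. y))"
      unfolding fun_eq_iff h\<nu> by (subst integral_distr[OF id]) auto
  qed simp
qed

text \<open>A representing measure on the whole space can be carried to the sphere: by homogeneity, mass at
  \<open>y\<close> may be moved to \<open>y / \<bar>y\<bar>\<close> after multiplication by the factor \<open>\<bar>y\<bar>\<close>.\<close>

lemma zonoidI:
  fixes K :: "(real ^ 'n) set" and M :: "(real ^ 'n) measure"
  assumes K: "convex_body K" "centrally_symmetric K"
    and sets [measurable_cong]: "sets M = sets borel"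
    and int: "integrable M norm"
    and eq: "\<And>x. support_fun K x = (\<integral>y. \<bar>x \<bullet> y\<bar> \<partial>M)"
  shows "zonoid K"
proof -
  obtain e :: "real ^ 'n" where e: "norm e = 1" by (metis norm_Basis SOME_Basis)
  define s where "s y = (if y = 0 then e else y /\<^sub>R norm y)" for y
  have s: "s y \<in> sphere 0 1" "norm y *\<^sub>R s y = y" for y using e by (auto simp: s_def)
  let ?S = "restrict_space borel (sphere 0 1) :: (real ^ 'n) measure"
  have "s \<in> borel_measurable borel" unfolding s_def by measurable
  then have sm [measurable]: "s \<in> measurable borel ?S"
    using s by (intro measurable_restrict_space2) auto
  have idm [measurable]: "(\<lambda>y. \<bar>x \<bullet> y\<bar>) \<in> borel_measurable ?S" for x
    by (intro measurable_restrict_space1) measurable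
  define \<mu> where "\<mu> = distr (density M (\<lambda>y. ennreal (norm y))) ?S s"
  have "finite_measure (density M (\<lambda>y. ennreal (norm y)))"
    using int by (intro finite_measureI) (simp add: emeasure_density nn_integral_eq_integral)
  then have "finite_measure \<mu>"
    unfolding \<mu>_def by (intro finite_measure.finite_measure_distr) measurable
  moreover have "sets \<mu> = sets ?S" by (simp add: \<mu>_def)
  moreover have "support_fun K x = (\<integral>y. \<bar>x \<bullet> y\<bar> \<partial>\<mu>)" for x
  proof -
    have "(\<integral>y. \<bar>x \<bullet> y\<bar> \<partial>\<mu>) = (\<integral>y. norm y * \<bar>x \<bullet> s y\<bar> \<partial>M)"
      unfolding \<mu>_def by (subst integral_distr) (simp_all add: integral_density)
    also have "\<dots> = (\<integral>y. \<bar>x \<bullet> y\<bar> \<partial>M)"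
    proof (rule Bochner_Integration.integral_cong)
      fix y
      have "norm y * \<bar>x \<bullet> s y\<bar> = \<bar>x \<bullet> (norm y *\<^sub>R s y)\<bar>" by (simp add: abs_mult)
      then show "norm y * \<bar>x \<bullet> s y\<bar> = \<bar>x \<bullet> y\<bar>" by (simp only: s)
    qed simp
    finally show ?thesis using eq by simp
  qed
  ultimately show ?thesis using K unfolding zonoid_def by blast
qed

locale spin_setting =
  fixes K :: "(real ^ 'n) set" and u :: "real ^ 'n"
  assumes K: "convex_body K" "centrally_symmetric K"
begin

abbreviation "G \<equiv> stabilizer_O u"
abbreviation "h \<equiv> support_fun K"
abbreviation "m \<equiv> haar G"

sublocale G: compact_orthogonal_group G by (rule compact_orthogonal_group_stabilizer_O)
sublocale h: sublinear h by (rule sublinear_support_fun[OF K(1)])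

lemma sets_m [measurable_cong]: "sets m = sets (restrict_space borel G)"
  and prob_m: "prob_space m"
  using G.normalized_haar_haar by (auto simp: normalized_haar_def)

sublocale m: prob_space m by (rule prob_m)

lemma space_m: "space m = G"
  using sets_eq_imp_space_eq[OF sets_m] by (simp add: space_restrict_space)

lemma norm_G: "T \<in> G \<Longrightarrow> norm (T *v x) = norm x"
  using orthogonal_transformation_matrix[of "(*v) T"] orthogonal_transformation_norm[of "(*v) T"]
  by (auto simp: stabilizer_O_def)

lemma h_even: "h (- x) = h x"
  using K centrally_symmetric_iff_support_fun_even by blast

lemma h_measurable [measurable]: "h \<in> borel_measurable borel"
  by (rule borel_measurable_continuous_onI[OF h.continuous])

lemma h_bound: "\<exists>B>0. \<forall>x. \<bar>h x\<bar> \<le> B * norm x"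
proof -
  obtain B where B: "B > 0" "\<And>x. h x \<le> B * norm x" using h.bound by blast
  then have "\<bar>h x\<bar> \<le> B * norm x" for x using h.nonneg[OF h_even, of x] by simp
  with B(1) show ?thesis by blast
qed

lemma action_measurable [measurable]:
  "(\<lambda>p. fst p *v snd p) \<in> borel_measurable (m \<Otimes>\<^sub>M (borel :: (real ^ 'n) measure))"
proof -
  have id: "(\<lambda>T. T) \<in> measurable m borel"
    unfolding measurable_cong_sets[OF sets_m refl] by (intro measurable_restrict_space1) simp
  have pr: "(\<lambda>p. (fst p, snd p)) \<in> measurable (m \<Otimes>\<^sub>M borel) (borel \<Otimes>\<^sub>M (borel :: (real ^ 'n) measure))"
    by (intro measurable_Pair measurable_compose[OF _ id] measurable_fst measurable_snd)
  show ?thesis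
    using measurable_compose[OF pr borel_measurable_matrix_vector_mult] unfolding fst_conv snd_conv .
qed

lemma action_measurable' [measurable]: "(\<lambda>T. T *v x) \<in> borel_measurable m"
  using measurable_compose[OF measurable_Pair2'[of x borel m] action_measurable] by simp

lemma integrable_h_action: "integrable m (\<lambda>T. h (T *v x))"
proof -
  obtain B where B: "B > 0" "\<And>x. \<bar>h x\<bar> \<le> B * norm x" using h_bound by blast
  show ?thesis
  proof (rule m.integrable_const_bound[where B="B * norm x"])
    show "AE T in m. norm (h (T *v x)) \<le> B * norm x"
      using B(2) norm_G by (intro AE_I2) (metis real_norm_def space_m)
  qed measurable
qed

lemma spin_op_sublinear: "sublinear (spin_op u h)"
proof
  show "spin_op u h (x + y) \<le> spin_op u h x + spin_op u h y" for x y
    unfolding spin_op_def Bochner_Integration.integral_add[OF integrable_h_action integrable_h_action, symmetric]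
    by (intro integral_mono Bochner_Integration.integrable_add integrable_h_action)
       (simp add: matrix_vector_right_distrib h.subadditive)
  show "spin_op u h (c *\<^sub>R x) = c * spin_op u h x" if "c \<ge> 0" for c x
    using that by (simp add: spin_op_def matrix_vector_mult_scaleR h.homogeneous)
qed

text \<open>The definite description in the definition of the spin is meaningful because the averaged support
  function is again sublinear.\<close>

lemma spin_body: "convex_body (spin u K)" "support_fun (spin u K) = spin_op u h"
proof -
  have "\<exists>!L. convex_body L \<and> support_fun L = spin_op u h"
    using sublinear_is_support_fun[OF spin_op_sublinear] support_fun_inject by metis
  from theI'[OF this] show "convex_body (spin u K)" "support_fun (spin u K) = spin_op u h"
    by (simp_all add: spin_def)
qed

lemma spin_centrally_symmetric: "centrally_symmetric (spin u K)"
proof -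
  have "T *v (- x) = - (T *v x)" for T :: "real ^ 'n ^ 'n" and x
    by (simp add: vec_eq_iff matrix_vector_mult_def sum_negf)
  then show ?thesis
    by (simp add: centrally_symmetric_iff_support_fun_even spin_body spin_op_def h_even)
qed

text \<open>Since \<open>(T x) \<bullet> y = x \<bullet> (T\<^sup>t y)\<close>, averaging \<open>\<integral> \<bar>(T x) \<bullet> y\<bar> d\<mu>(y)\<close> over \<open>T\<close> gives the cosine
  transform of the law of \<open>T\<^sup>t y\<close>.\<close>

lemma zonoid_spin:
  assumes "zonoid K"
  shows "zonoid (spin u K)"
proof -
  obtain \<mu> :: "(real ^ 'n) measure" where s\<mu> [measurable_cong]: "sets \<mu> = sets borel"
    and f\<mu>: "finite_measure \<mu>" and norm1: "AE y in \<mu>. norm y = 1"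
    and h\<mu>: "h = (\<lambda>x. \<integral>y. \<bar>x \<bullet> y\<bar> \<partial>\<mu>)"
    using assms by (rule zonoidE)
  interpret \<mu>: finite_measure \<mu> by (rule f\<mu>)
  interpret pair_sigma_finite m \<mu> ..
  have fin: "finite_measure (m \<Otimes>\<^sub>M \<mu>)"
    by (rule finite_measure_pair_measure[OF \<mu>.finite_measure_axioms m.finite_measure_axioms])
  interpret p: finite_measure "m \<Otimes>\<^sub>M \<mu>" by (rule fin)
  define a :: "(real ^ 'n ^ 'n) \<times> (real ^ 'n) \<Rightarrow> real ^ 'n" where "a = (\<lambda>(T, y). transpose T *v y)"
  have am [measurable]: "a \<in> borel_measurable (m \<Otimes>\<^sub>M \<mu>)"
  proof -
    have id: "(\<lambda>T. transpose T) \<in> measurable m borel"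
      unfolding measurable_cong_sets[OF sets_m refl]
      by (intro measurable_restrict_space1 borel_measurable_continuous_onI continuous_intros)
    have pr: "(\<lambda>p. (transpose (fst p), snd p)) \<in> measurable (m \<Otimes>\<^sub>M \<mu>) (borel \<Otimes>\<^sub>M (borel :: (real ^ 'n) measure))"
      unfolding measurable_cong_sets[OF sets_pair_measure_cong[OF refl s\<mu>] refl]
      by (intro measurable_Pair measurable_compose[OF _ id] measurable_fst measurable_snd)
    show ?thesis
      using measurable_compose[OF pr borel_measurable_matrix_vector_mult]
      unfolding fst_conv snd_conv a_def split_beta' .
  qed
  have inner_a: "x \<bullet> a (T, y) = (T *v x) \<bullet> y" for x T y
    by (simp add: a_def dot_lmul_matrix inner_commute del: transpose_matrix_vector)
       (metis dot_lmul_matrix inner_commute transpose_matrix_vector transpose_transpose)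
  have norm_a: "AE p in m \<Otimes>\<^sub>M \<mu>. norm (a p) = 1"
  proof (rule AE_pair_measure)
    show "{p \<in> space (m \<Otimes>\<^sub>M \<mu>). norm (a p) = 1} \<in> sets (m \<Otimes>\<^sub>M \<mu>)" by measurable
    show "AE T in m. AE y in \<mu>. norm (a (T, y)) = 1"
    proof (rule AE_I2)
      fix T assume "T \<in> space m"
      then have T: "transpose T \<in> G" by (simp add: space_m G.G_inv)
      show "AE y in \<mu>. norm (a (T, y)) = 1"
        using norm1 by eventually_elim (simp add: a_def norm_G[OF T] del: transpose_matrix_vector)
    qed
  qed
  define M where "M = distr (m \<Otimes>\<^sub>M \<mu>) borel a"
  show ?thesis
  proof (rule zonoidI[OF spin_body(1) spin_centrally_symmetric])
    show sM: "sets M = sets borel" by (simp add: M_def)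
    show "integrable M norm" unfolding M_def
      by (subst integrable_distr_eq) (auto intro!: p.integrable_const_bound[where B=1] eventually_mono[OF norm_a])
    fix x
    have int: "integrable (m \<Otimes>\<^sub>M \<mu>) (\<lambda>(T, y). \<bar>x \<bullet> a (T, y)\<bar>)"
    proof (rule p.integrable_const_bound[where B="norm x"])
      show "AE p in m \<Otimes>\<^sub>M \<mu>. norm (case p of (T, y) \<Rightarrow> \<bar>x \<bullet> a (T, y)\<bar>) \<le> norm x"
        using norm_a by eventually_elim (metis (mono_tags, lifting) Cauchy_Schwarz_ineq2 case_prod_beta' mult.right_neutral prod.collapse real_norm_def abs_abs)
    qed measurable
    have "support_fun (spin u K) x = (\<integral>T. (\<integral>y. \<bar>x \<bullet> a (T, y)\<bar> \<partial>\<mu>) \<partial>m)"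
      unfolding spin_body spin_op_def h\<mu> inner_a ..
    also have "\<dots> = (\<integral>p. \<bar>x \<bullet> a p\<bar> \<partial>(m \<Otimes>\<^sub>M \<mu>))"
      using integral_fst[OF int] by (simp add: split_beta')
    also have "\<dots> = (\<integral>y. \<bar>x \<bullet> y\<bar> \<partial>M)"
      unfolding M_def by (subst integral_distr) auto
    finally show "support_fun (spin u K) x = (\<integral>y. \<bar>x \<bullet> y\<bar> \<partial>M)" .
  qed
qed

end

section \<open>The absolute value as a superposition of cosines\<close>

lemma integrable_inverse_1_plus_square: "integrable lborel (\<lambda>s::real. inverse (1 + s\<^sup>2))"
  using integrable_inverse_1_plus_square by (simp add: set_integrable_def)

lemma one_minus_cos_bound: "(1 - cos s) / s\<^sup>2 \<le> 4 * inverse (1 + s\<^sup>2)" for s :: real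
proof (cases "s = 0")
  case False
  have "1 - cos s \<le> s\<^sup>2 / 2"
  proof -
    have "1 - cos s = 2 * (sin (s / 2))\<^sup>2" using cos_double_sin[of "s / 2"] by simp
    also have "(sin (s / 2))\<^sup>2 \<le> (s / 2)\<^sup>2"
      using abs_sin_x_le_abs_x[of "s / 2"] by (simp only: abs_le_square_iff)
    finally show ?thesis by (simp add: power_divide)
  qed
  moreover have "1 - cos s \<le> 2" using cos_ge_minus_one[of s] by linarith
  moreover have "(1 - cos s) * (1 + s\<^sup>2) = (1 - cos s) + (1 - cos s) * s\<^sup>2" by (simp add: algebra_simps)
  moreover have "(1 - cos s) * s\<^sup>2 \<le> 2 * s\<^sup>2" using calculation(2) by (intro mult_right_mono) auto
  ultimately have "(1 - cos s) * (1 + s\<^sup>2) \<le> 4 * s\<^sup>2" using zero_le_power2[of s] by linarith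
  then show ?thesis using False by (simp add: field_simps add_pos_nonneg)
qed simp

lemma one_minus_cos_nonneg: "0 \<le> (1 - cos s) / s\<^sup>2" for s :: real
  by (simp add: cos_le_one)

lemma one_minus_cos_integrable: "integrable lborel (\<lambda>s::real. (1 - cos s) / s\<^sup>2)"
  by (rule Bochner_Integration.integrable_bound[OF integrable_mult_right[OF integrable_inverse_1_plus_square, of 4]])
     (use one_minus_cos_bound one_minus_cos_nonneg in \<open>auto simp: abs_of_nonneg cos_le_one\<close>)

text \<open>The value is \<open>\<pi>\<close>.\<close>

definition \<kappa> :: real where "\<kappa> = (\<integral>s. (1 - cos s) / s\<^sup>2 \<partial>lborel)"

lemma \<kappa>_pos: "\<kappa> > 0"
proof -
  have "\<kappa> \<ge> 0" unfolding \<kappa>_def by (intro integral_nonneg_AE) (simp add: one_minus_cos_nonneg)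
  moreover have "\<kappa> \<noteq> 0"
  proof
    assume "\<kappa> = 0"
    then have "AE s in lborel. (1 - cos s) / s\<^sup>2 = (0::real)"
      unfolding \<kappa>_def by (subst (asm) integral_nonneg_eq_0_iff_AE[OF one_minus_cos_integrable])
        (auto simp: one_minus_cos_nonneg)
    then have "AE s in lborel. s \<in> {s::real. cos s = 1} \<union> {0}"
      by eventually_elim auto
    then have "AE s in lebesgue. s \<in> {s::real. cos s = 1} \<union> {0}" by (rule AE_completion)
    moreover have "closed ({s::real. cos s = 1} \<union> {0})"
      by (intro closed_Un closed_Collect_eq continuous_intros closed_singleton)
    ultimately have "pi \<in> {s::real. cos s = 1} \<union> {0}" using mem_closed_if_AE_lebesgue by blast
    then show False by simp
  qed
  ultimately show ?thesis by simp
qed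

text \<open>By scaling, \<open>\<bar>b\<bar> = (1 / \<kappa>) \<integral> (1 - cos (s b)) / s\<^sup>2 ds\<close>. This turns integrals against
  \<open>\<bar>y \<bullet> v\<bar>\<close> into Fourier integrals.\<close>

lemma abs_kernel:
  fixes b :: real
  shows "integrable lborel (\<lambda>s. (1 - cos (s * b)) / s\<^sup>2)" "(\<integral>s. (1 - cos (s * b)) / s\<^sup>2 \<partial>lborel) = \<kappa> * \<bar>b\<bar>"
proof -
  have "integrable lborel (\<lambda>s. (1 - cos (s * b)) / s\<^sup>2) \<and> (\<integral>s. (1 - cos (s * b)) / s\<^sup>2 \<partial>lborel) = \<kappa> * \<bar>b\<bar>"
  proof (cases "b = 0")
    case False
    define g where "g s = (1 - cos (b * s)) / (b * s)\<^sup>2" for s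
    have eq: "(1 - cos (s * b)) / s\<^sup>2 = b\<^sup>2 * g s" for s
      using False by (simp add: g_def power_mult_distrib mult.commute)
    have "integrable lborel g"
      using lborel_integrable_real_affine[OF one_minus_cos_integrable False, of 0] by (simp add: g_def[abs_def])
    moreover have "\<kappa> = \<bar>b\<bar> * (\<integral>s. g s \<partial>lborel)"
      unfolding \<kappa>_def g_def by (subst lborel_integral_real_affine[OF False, of _ 0]) simp
    moreover have "b\<^sup>2 = \<bar>b\<bar> * \<bar>b\<bar>" by (simp add: power2_eq_square)
    ultimately have "b\<^sup>2 * (\<integral>s. g s \<partial>lborel) = \<kappa> * \<bar>b\<bar>" by (simp only: mult_ac)
    then show ?thesis unfolding eq using \<open>integrable lborel g\<close> by simp
  qed simp
  then show "integrable lborel (\<lambda>s. (1 - cos (s * b)) / s\<^sup>2)"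
    "(\<integral>s. (1 - cos (s * b)) / s\<^sup>2 \<partial>lborel) = \<kappa> * \<bar>b\<bar>" by auto
qed

lemma integrable_abs_inner:
  fixes g :: "'a::euclidean_space \<Rightarrow> real"
  assumes "integrable lborel (\<lambda>w. norm w * g w)" and [measurable]: "g \<in> borel_measurable borel"
  shows "integrable lborel (\<lambda>w. \<bar>w \<bullet> x\<bar> * g w)"
proof (rule Bochner_Integration.integrable_bound[OF integrable_mult_right[OF assms(1), of "norm x"]])
  show "AE w in lborel. norm (\<bar>w \<bullet> x\<bar> * g w) \<le> norm (norm x * (norm w * g w))"
  proof (rule AE_I2)
    fix w
    have "\<bar>w \<bullet> x\<bar> * \<bar>g w\<bar> \<le> (norm w * norm x) * \<bar>g w\<bar>"
      by (intro mult_right_mono Cauchy_Schwarz_ineq2) simp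
    then show "norm (\<bar>w \<bullet> x\<bar> * g w) \<le> norm (norm x * (norm w * g w))"
      by (simp add: abs_mult mult_ac)
  qed
qed measurable

lemma abs_inner_integral:
  fixes f :: "'a::euclidean_space \<Rightarrow> real" and v :: 'a
  assumes f [measurable]: "f \<in> borel_measurable borel" and int: "integrable lborel (\<lambda>y. norm y * f y)"
  shows "integrable lborel (\<lambda>s. (\<integral>y. (1 - cos (s * (y \<bullet> v))) * f y \<partial>lborel) / s\<^sup>2)"
    and "\<kappa> * (\<integral>y. \<bar>y \<bullet> v\<bar> * f y \<partial>lborel) = (\<integral>s. (\<integral>y. (1 - cos (s * (y \<bullet> v))) * f y \<partial>lborel) / s\<^sup>2 \<partial>lborel)"
proof -
  let ?F = "\<lambda>y s::real. ((1 - cos (s * (y \<bullet> v))) / s\<^sup>2) * f y"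
  have int_v: "integrable lborel (\<lambda>y. \<bar>y \<bullet> v\<bar> * \<bar>f y\<bar>)"
    using integrable_norm[OF integrable_abs_inner[OF int f, of v]] by (simp add: abs_mult)
  have nF: "norm (?F y s) = ((1 - cos (s * (y \<bullet> v))) / s\<^sup>2) * \<bar>f y\<bar>" for y s
    by (simp add: abs_mult abs_of_nonneg cos_le_one)
  have intF: "integrable (lborel \<Otimes>\<^sub>M lborel) (case_prod ?F)"
  proof (rule lborel_pair.Fubini_integrable)
    have "(\<integral>s. norm (?F y s) \<partial>lborel) = \<kappa> * (\<bar>y \<bullet> v\<bar> * \<bar>f y\<bar>)" for y
      unfolding nF integral_mult_left_zero abs_kernel(2) by simp
    then show "integrable lborel (\<lambda>y. \<integral>s. norm (case (y, s) of (y, s) \<Rightarrow> ?F y s) \<partial>lborel)"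
      using int_v by simp
    show "AE y in lborel. integrable lborel (\<lambda>s. case (y, s) of (y, s) \<Rightarrow> ?F y s)"
      unfolding prod.case by (intro AE_I2 integrable_mult_left abs_kernel(1))
  qed measurable
  have eq: "(\<integral>y. ?F y s \<partial>lborel) = (\<integral>y. (1 - cos (s * (y \<bullet> v))) * f y \<partial>lborel) / s\<^sup>2" for s
    unfolding times_divide_eq_left by (rule integral_divide_zero)
  show "integrable lborel (\<lambda>s. (\<integral>y. (1 - cos (s * (y \<bullet> v))) * f y \<partial>lborel) / s\<^sup>2)"
    using lborel_pair.integrable_snd[OF intF] unfolding eq .
  have "(\<integral>s. (\<integral>y. ?F y s \<partial>lborel) \<partial>lborel) = (\<integral>y. (\<integral>s. ?F y s \<partial>lborel) \<partial>lborel)"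
    by (rule lborel_pair.Fubini_integral[OF intF])
  also have "\<dots> = (\<integral>y. \<kappa> * (\<bar>y \<bullet> v\<bar> * f y) \<partial>lborel)"
    unfolding integral_mult_left_zero abs_kernel(2) by (simp only: mult.assoc)
  finally show "\<kappa> * (\<integral>y. \<bar>y \<bullet> v\<bar> * f y \<partial>lborel) = (\<integral>s. (\<integral>y. (1 - cos (s * (y \<bullet> v))) * f y \<partial>lborel) / s\<^sup>2 \<partial>lborel)"
    unfolding eq by simp
qed

section \<open>Gaussian integrals\<close>

definition gauss :: "real \<Rightarrow> 'a::euclidean_space \<Rightarrow> real" where
  "gauss a x = exp (- (a * norm x)\<^sup>2 / 2)"

lemma gauss_measurable [measurable]: "gauss a \<in> borel_measurable borel"
  unfolding gauss_def by measurable

lemma gauss_nonneg [simp]: "gauss a x \<ge> 0" and gauss_le_1: "gauss a x \<le> 1"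
  by (auto simp: gauss_def)

lemma gauss_minus [simp]: "gauss a (- x) = gauss a x" by (simp add: gauss_def)

lemma gauss_scale: "gauss a (c *\<^sub>R x) = gauss (a * c) x"
  by (simp add: gauss_def power_mult_distrib)

lemma gauss_fourier_1d:
  fixes a z :: real
  assumes a: "a > 0"
  shows "has_bochner_integral lborel (\<lambda>t. complex_of_real (exp (- (a * t)\<^sup>2 / 2)) * iexp (z * t))
    (complex_of_real (sqrt (2 * pi) / a * exp (- (z / a)\<^sup>2 / 2)))"
proof -
  define f where "f t = complex_of_real (std_normal_density t) * iexp (z / a * t)" for t
  have dens: "std_normal_density t = exp (- t\<^sup>2 / 2) / sqrt (2 * pi)" for t
    by (simp add: std_normal_density_def)
  have intd: "integrable lborel f"
    unfolding f_def
    by (rule Bochner_Integration.integrable_bound[OF integrable_std_normal_moment[of 0]])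
       (auto simp: norm_mult)
  have "(\<integral>t. f t \<partial>lborel) = char std_normal_distribution (z / a)"
    unfolding char_def f_def
    by (subst integral_density) (auto simp: normal_density_nonneg scaleR_conv_of_real)
  then have val: "(\<integral>t. f t \<partial>lborel) = complex_of_real (exp (- ((z / a)\<^sup>2) / 2))"
    by (simp add: char_std_normal_distribution)
  have eq: "complex_of_real (exp (- (a * t)\<^sup>2 / 2)) * iexp (z * t) = complex_of_real (sqrt (2 * pi)) * f (0 + a * t)" for t
    using a by (simp add: f_def dens)
  have i: "integrable lborel (\<lambda>t. f (0 + a * t))"
    using lborel_integrable_real_affine[OF intd, of a 0] a by simp
  have "(\<integral>t. f t \<partial>lborel) = a * (\<integral>t. f (0 + a * t) \<partial>lborel)"
    using lborel_integral_real_affine[of a f 0] a by (simp add: scaleR_conv_of_real)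
  then have "(\<integral>t. f (0 + a * t) \<partial>lborel) = complex_of_real (exp (- ((z / a)\<^sup>2) / 2) / a)"
    using a val by (simp add: field_simps)
  with i show ?thesis unfolding eq by (simp add: has_bochner_integral_iff)
qed

text \<open>The integral of \<open>gauss a\<close> over the space; the second argument only fixes the dimension.\<close>

definition gauss_mass :: "real \<Rightarrow> 'a::euclidean_space itself \<Rightarrow> real" where
  "gauss_mass a _ = (sqrt (2 * pi) / a) ^ DIM('a)"

lemma gauss_mass_pos: "a > 0 \<Longrightarrow> gauss_mass a TYPE('a::euclidean_space) > 0"
  by (simp add: gauss_mass_def)

text \<open>Over an orthonormal basis both the Gaussian and the character factorize, so the integral is a
  product of values of the characteristic function of the normal distribution.\<close>

lemma gauss_fourier:
  fixes z :: "'a::euclidean_space"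
  assumes a: "a > 0"
  shows "integrable lborel (\<lambda>y::'a. gauss a y)"
    and "(\<integral>y. gauss a y * cos (y \<bullet> z) \<partial>lborel) = gauss_mass a TYPE('a) * gauss (1 / a) z"
proof -
  let ?f = "\<lambda>b t. complex_of_real (exp (- (a * t)\<^sup>2 / 2)) * iexp ((z \<bullet> b) * t)"
  interpret product_sigma_finite "\<lambda>_::'a. lborel :: real measure" ..
  have one: "integrable lborel (?f b)"
    "(\<integral>t. ?f b t \<partial>lborel) = complex_of_real (sqrt (2 * pi) / a * exp (- ((z \<bullet> b) / a)\<^sup>2 / 2))" for b
    using gauss_fourier_1d[OF a, of "z \<bullet> b"] by (auto simp: has_bochner_integral_iff)
  have prod_eq: "(\<Prod>b\<in>Basis. ?f b (x b)) = complex_of_real (gauss a (\<Sum>b\<in>Basis. x b *\<^sub>R b)) * iexp ((\<Sum>b\<in>Basis. x b *\<^sub>R b) \<bullet> z)"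
    for x :: "'a \<Rightarrow> real"
  proof -
    have "(norm (\<Sum>b\<in>Basis. x b *\<^sub>R b))\<^sup>2 = (\<Sum>b\<in>(Basis::'a set). (x b)\<^sup>2)"
      unfolding power2_norm_eq_inner
      by (subst euclidean_inner) (simp add: inner_sum_left_Basis power2_eq_square)
    then have 1: "gauss a (\<Sum>b\<in>Basis. x b *\<^sub>R b) = (\<Prod>b\<in>(Basis::'a set). exp (- (a * x b)\<^sup>2 / 2))"
      by (simp add: gauss_def power_mult_distrib sum_distrib_left sum_divide_distrib sum_negf flip: exp_sum)
    have 2: "(\<Sum>b\<in>Basis. x b *\<^sub>R b) \<bullet> z = (\<Sum>b\<in>Basis. (z \<bullet> b) * x b)"
      unfolding inner_sum_left inner_scaleR_left by (intro sum.cong refl) (simp add: inner_commute)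
    show ?thesis unfolding prod.distrib 1 2
      by (simp add: sum_distrib_left exp_sum)
  qed
  let ?g = "\<lambda>y::'a. complex_of_real (gauss a y) * iexp (y \<bullet> z)"
  have meas: "?g \<in> borel_measurable borel" by measurable
  have S: "(\<lambda>f. \<Sum>b\<in>Basis. f b *\<^sub>R b) \<in> measurable (\<Pi>\<^sub>M b\<in>Basis. lborel) (borel :: 'a measure)"
    by measurable
  have int: "integrable lborel ?g"
    unfolding lborel_eq[where 'a='a]
    by (subst integrable_distr_eq[OF S meas]) (simp only: prod_eq[symmetric], intro product_integrable_prod one finite_Basis)
  have "(\<integral>y. ?g y \<partial>lborel) = (\<integral>x. (\<Prod>b\<in>Basis. ?f b (x b)) \<partial>(\<Pi>\<^sub>M b\<in>(Basis::'a set). lborel))"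
    unfolding lborel_eq[where 'a='a] prod_eq by (rule integral_distr[OF S meas])
  also have "\<dots> = (\<Prod>b\<in>(Basis::'a set). \<integral>t. ?f b t \<partial>lborel)"
    by (intro product_integral_prod one finite_Basis)
  also have "\<dots> = complex_of_real (\<Prod>b\<in>(Basis::'a set). sqrt (2 * pi) / a * exp (- ((z \<bullet> b) / a)\<^sup>2 / 2))"
    unfolding one by simp
  also have "(\<Prod>b\<in>(Basis::'a set). sqrt (2 * pi) / a * exp (- ((z \<bullet> b) / a)\<^sup>2 / 2))
      = gauss_mass a TYPE('a) * gauss (1 / a) z"
  proof -
    have "(norm z)\<^sup>2 = (\<Sum>b\<in>Basis. (z \<bullet> b)\<^sup>2)"
      unfolding power2_norm_eq_inner by (subst euclidean_inner) (simp add: power2_eq_square)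
    then have "gauss (1 / a) z = (\<Prod>b\<in>Basis. exp (- ((z \<bullet> b) / a)\<^sup>2 / 2))"
      by (simp add: gauss_def power_divide sum_divide_distrib sum_negf flip: exp_sum)
    then show ?thesis unfolding prod.distrib by (simp add: gauss_mass_def)
  qed
  finally have val: "(\<integral>y. ?g y \<partial>lborel) = complex_of_real (gauss_mass a TYPE('a) * gauss (1 / a) z)" .
  have "integrable lborel (\<lambda>y. norm (?g y))" using int by (rule integrable_norm)
  then show "integrable lborel (\<lambda>y::'a. gauss a y)" by (simp add: norm_mult)
  have "(\<integral>y. gauss a y * cos (y \<bullet> z) \<partial>lborel) = (\<integral>y. Re (?g y) \<partial>lborel)"
    by (simp add: Re_exp)
  also have "\<dots> = Re (\<integral>y. ?g y \<partial>lborel)" by (rule integral_Re[OF int])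
  finally show "(\<integral>y. gauss a y * cos (y \<bullet> z) \<partial>lborel) = gauss_mass a TYPE('a) * gauss (1 / a) z"
    unfolding val by simp
qed

lemma gauss_integral: "a > 0 \<Longrightarrow> (\<integral>y. gauss a (y :: 'a) \<partial>lborel) = gauss_mass a TYPE('a::euclidean_space)"
  using gauss_fourier(2)[of a "0::'a"] by (simp add: gauss_def)

text \<open>Part of the Gaussian exponent absorbs any exponential growth:
  \<open>c t - a\<^sup>2 t\<^sup>2 / 2 \<le> (c / a)\<^sup>2 - a\<^sup>2 t\<^sup>2 / 8\<close>.\<close>

lemma integrable_gauss_mult:
  fixes f :: "'a::euclidean_space \<Rightarrow> real"
  assumes a: "a > 0" and [measurable]: "f \<in> borel_measurable borel"
    and f: "\<And>x. \<bar>f x\<bar> \<le> C * exp (c * norm x)"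
  shows "integrable lborel (\<lambda>x. f x * gauss a x)"
proof (rule Bochner_Integration.integrable_bound)
  show "integrable lborel (\<lambda>x::'a. C * exp ((c / a)\<^sup>2) * gauss (a / 2) x)"
    using a by (intro integrable_mult_right gauss_fourier) auto
  have C: "C \<ge> 0" using f[of 0] abs_ge_zero[of "f 0"] by simp
  have "exp (c * norm x) * gauss a x \<le> exp ((c / a)\<^sup>2) * gauss (a / 2) x" for x :: 'a
  proof -
    have "0 \<le> (c / a - a * norm x / 2)\<^sup>2" by simp
    also have "\<dots> = (c / a)\<^sup>2 - c * norm x + (a * norm x)\<^sup>2 / 4"
      using a by (simp add: power2_diff power_divide)
    finally have "c * norm x - (a * norm x)\<^sup>2 / 2 \<le> (c / a)\<^sup>2 - (a * norm x)\<^sup>2 / 8"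
      using zero_le_power2[of "a * norm x"] by linarith
    then show ?thesis by (simp add: gauss_def power_divide flip: exp_add)
  qed
  then have "C * (exp (c * norm x) * gauss a x) \<le> C * (exp ((c / a)\<^sup>2) * gauss (a / 2) x)" for x :: 'a
    using C by (rule mult_left_mono)
  moreover have "\<bar>f x\<bar> * gauss a x \<le> C * exp (c * norm x) * gauss a x" for x
    by (intro mult_right_mono f) simp
  ultimately have "\<bar>f x\<bar> * gauss a x \<le> C * (exp ((c / a)\<^sup>2) * gauss (a / 2) x)" for x
    by (metis mult.assoc order.trans)
  then show "AE x in lborel. norm (f x * gauss a x) \<le> norm (C * exp ((c / a)\<^sup>2) * gauss (a / 2) x)"
    using C by (intro AE_I2) (simp add: abs_mult mult.assoc)
qed measurable

lemma norm_le_exp: "norm x \<le> exp (norm x)"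
  using exp_ge_add_one_self[of "norm x"] by linarith

lemma lborel_integral_scale:
  fixes f :: "'a::euclidean_space \<Rightarrow> real"
  assumes [measurable]: "f \<in> borel_measurable borel" and R: "R > 0"
  shows "(\<integral>x. f x \<partial>lborel) = R ^ DIM('a) * (\<integral>x. f (R *\<^sub>R x) \<partial>lborel)"
proof -
  have "(\<integral>x. f x \<partial>lborel) = (\<integral>x. f x \<partial>density (distr lborel borel (\<lambda>x. 0 + R *\<^sub>R x)) (\<lambda>_. \<bar>R\<bar> ^ DIM('a)))"
    using lborel_affine[of R "0::'a"] R by simp
  also have "\<dots> = R ^ DIM('a) * (\<integral>x. f (R *\<^sub>R x) \<partial>lborel)"
    using R by (subst integral_density) (auto simp: integral_distr)
  finally show ?thesis .
qed

lemma homogeneous_gauss_scale: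
  fixes f :: "'a::euclidean_space \<Rightarrow> real"
  assumes [measurable]: "f \<in> borel_measurable borel" and hom: "\<And>c x. c \<ge> 0 \<Longrightarrow> f (c *\<^sub>R x) = c * f x"
    and a: "a > 0"
  shows "(\<integral>x. f x * gauss a x \<partial>lborel) = (1 / a) ^ Suc DIM('a) * (\<integral>x. f x * gauss 1 x \<partial>lborel)"
proof -
  have "(\<integral>x. f x * gauss a x \<partial>lborel) = (1 / a) ^ DIM('a) * (\<integral>x. f ((1 / a) *\<^sub>R x) * gauss a ((1 / a) *\<^sub>R x) \<partial>lborel)"
    using a by (intro lborel_integral_scale) auto
  also have "(\<integral>x. f ((1 / a) *\<^sub>R x) * gauss a ((1 / a) *\<^sub>R x) \<partial>lborel) = (1 / a) * (\<integral>x. f x * gauss 1 x \<partial>lborel)"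
    using a hom[of "1 / a"] by (simp add: gauss_scale mult.assoc)
  finally show ?thesis by simp
qed

lemma lborel_integral_translate:
  fixes f :: "'a::euclidean_space \<Rightarrow> real"
  assumes [measurable]: "f \<in> borel_measurable borel"
  shows "(\<integral>x. f x \<partial>lborel) = (\<integral>x. f (t + x) \<partial>lborel)"
proof -
  have "(\<integral>x. f x \<partial>lborel) = (\<integral>x. f x \<partial>distr lborel borel (\<lambda>x. t + x))"
    using lborel_affine[of 1 t] by (simp add: density_1)
  then show ?thesis by (simp add: integral_distr)
qed

lemma lborel_integral_reflect:
  fixes f :: "'a::euclidean_space \<Rightarrow> real"
  assumes [measurable]: "f \<in> borel_measurable borel"
  shows "(\<integral>x. f x \<partial>lborel) = (\<integral>x. f (- x) \<partial>lborel)"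
proof -
  have "orthogonal_transformation (uminus :: 'a \<Rightarrow> 'a)"
    by (simp add: orthogonal_transformation linear_uminus)
  from lborel_distr_orthogonal[OF this]
  have "(\<integral>x. f x \<partial>lborel) = (\<integral>x. f x \<partial>distr lborel borel (uminus :: 'a \<Rightarrow> 'a))" by simp
  then show ?thesis by (simp add: integral_distr)
qed

section \<open>Limits of cosine transforms\<close>

text \<open>The first moments of the measures are bounded by the sum of their cosine transforms over a basis,
  hence uniformly. So each measure can be replaced by a probability measure on the unit ball with a
  proportional cosine transform, and weak compactness applies.\<close>

lemma cosine_transform_closed:
  fixes M :: "nat \<Rightarrow> 'a::euclidean_space measure" and f :: "'a \<Rightarrow> real"
  assumes sets: "\<And>k. sets (M k) = sets borel" and int: "\<And>k. integrable (M k) norm"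
    and lim: "\<And>x. (\<lambda>k. \<integral>y. \<bar>x \<bullet> y\<bar> \<partial>M k) \<longlonglongrightarrow> f x"
  shows "\<exists>P. sets P = sets borel \<and> integrable P norm \<and> (\<forall>x. f x = (\<integral>y. \<bar>x \<bullet> y\<bar> \<partial>P))"
proof -
  note [measurable_cong] = sets
  define m where "m k = (\<integral>y. norm y \<partial>M k)" for k
  have m0: "m k \<ge> 0" for k by (simp add: m_def)
  have int_inner: "integrable (M k) (\<lambda>y. \<bar>x \<bullet> y\<bar>)" for k x
  proof (rule Bochner_Integration.integrable_bound[OF integrable_mult_right[OF int, of _ "norm x"]])
    show "AE y in M k. norm \<bar>x \<bullet> y\<bar> \<le> norm (norm x * norm y)"
      using Cauchy_Schwarz_ineq2[of x] by (intro AE_I2) simp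
  qed measurable
  have "\<exists>B>0. \<forall>k. m k \<le> B"
  proof -
    have le: "m k \<le> (\<Sum>b\<in>Basis. \<integral>y. \<bar>b \<bullet> y\<bar> \<partial>M k)" for k
    proof -
      have "m k \<le> (\<integral>y. (\<Sum>b\<in>Basis. \<bar>b \<bullet> y\<bar>) \<partial>M k)"
        unfolding m_def
        by (intro integral_mono int Bochner_Integration.integrable_sum int_inner)
           (subst inner_commute, rule norm_le_l1)
      then show ?thesis by (simp add: int_inner)
    qed
    have "(\<lambda>k. \<Sum>b\<in>Basis. \<integral>y. \<bar>b \<bullet> y\<bar> \<partial>M k) \<longlonglongrightarrow> (\<Sum>b\<in>Basis. f b)"
      by (intro tendsto_sum lim)
    then obtain B where B: "B > 0" "\<And>k. norm (\<Sum>b\<in>Basis. \<integral>y. \<bar>b \<bullet> y\<bar> \<partial>M k) \<le> B"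
      using convergent_imp_Bseq[OF convergentI] BseqE by blast
    have "m k \<le> B" for k using le[of k] B(2)[of k] by simp
    with B(1) show ?thesis by blast
  qed
  then obtain B where B: "B > 0" "\<And>k. m k \<le> B" by blast
  \<comment> \<open>To have total mass 1 and the same factor \<open>1 / B\<close> for all \<open>k\<close>, the measures are normalized and
    their points are moved radially to norm \<open>m k / B\<close>; a cosine transform sees only the product of
    mass and norm.\<close>
  define P where "P k = (if m k = 0 then return borel 0
      else distr (density (M k) (\<lambda>y. ennreal (norm y / m k))) borel (\<lambda>y. (m k / B) *\<^sub>R (y /\<^sub>R norm y)))" for k
  have Psets: "sets (P k) = sets borel" for k by (simp add: P_def)
  have Pprob: "prob_space (P k)" for k
  proof (cases "m k = 0")
    case False
    have "prob_space (density (M k) (\<lambda>y. ennreal (norm y / m k)))"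
    proof
      have "(\<integral>\<^sup>+y. ennreal (norm y / m k) \<partial>M k) = ennreal (\<integral>y. norm y / m k \<partial>M k)"
        using m0 by (intro nn_integral_eq_integral integrable_divide int) auto
      then show "emeasure (density (M k) (\<lambda>y. ennreal (norm y / m k))) (space (density (M k) (\<lambda>y. ennreal (norm y / m k)))) = 1"
        using False by (simp add: emeasure_density m_def)
    qed
    then show ?thesis using False by (simp add: P_def prob_space.prob_space_distr)
  qed (simp add: P_def prob_space_return)
  have Psupp: "AE y in P k. norm y \<le> 1" for k
  proof (cases "m k = 0")
    case True
    then have eq: "P k = return borel 0" by (simp add: P_def)
    show ?thesis unfolding eq by (subst AE_return) auto
  next
    case False
    then have eq: "P k = distr (density (M k) (\<lambda>y. ennreal (norm y / m k))) borel (\<lambda>y. (m k / B) *\<^sub>R (y /\<^sub>R norm y))"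
      by (simp add: P_def)
    have nle: "norm ((m k / B) *\<^sub>R (y /\<^sub>R norm y)) \<le> 1" for y :: 'a
      using B m0[of k] by (cases "y = 0") (auto simp: field_simps)
    show ?thesis unfolding eq
    proof (subst AE_distr_iff)
      show "AE y in density (M k) (\<lambda>y. ennreal (norm y / m k)). norm ((m k / B) *\<^sub>R (y /\<^sub>R norm y)) \<le> 1"
        by (intro AE_I2 nle)
    qed auto
  qed
  have Pint: "(\<integral>y. \<bar>x \<bullet> y\<bar> \<partial>P k) = (\<integral>y. \<bar>x \<bullet> y\<bar> \<partial>M k) / B" for k x
  proof (cases "m k = 0")
    case True
    then have "AE y in M k. norm y = 0"
      using int[of k] unfolding m_def by (subst (asm) integral_nonneg_eq_0_iff_AE) auto
    then have "(\<integral>y. \<bar>x \<bullet> y\<bar> \<partial>M k) = (\<integral>y. 0 \<partial>M k)"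
      by (intro integral_cong_AE) (auto elim: eventually_mono)
    moreover have "(\<integral>y. \<bar>x \<bullet> y\<bar> \<partial>P k) = 0" using True by (simp add: P_def integral_return)
    ultimately show ?thesis by simp
  next
    case False
    have "(\<integral>y. \<bar>x \<bullet> y\<bar> \<partial>P k) = (\<integral>y. (norm y / m k) * \<bar>x \<bullet> ((m k / B) *\<^sub>R (y /\<^sub>R norm y))\<bar> \<partial>M k)"
      using False m0[of k] unfolding P_def by (simp add: integral_distr integral_density)
    also have "\<dots> = (\<integral>y. \<bar>x \<bullet> y\<bar> / B \<partial>M k)"
    proof (rule Bochner_Integration.integral_cong)
      fix y
      show "(norm y / m k) * \<bar>x \<bullet> ((m k / B) *\<^sub>R (y /\<^sub>R norm y))\<bar> = \<bar>x \<bullet> y\<bar> / B"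
        using False m0[of k] B(1) by (cases "y = 0") (simp_all add: abs_mult field_simps)
    qed simp
    finally show ?thesis by simp
  qed
  obtain r N b where r: "strict_mono r" and N: "sets N = sets borel" "prob_space N"
    and b: "AE y in N. norm y \<le> b"
    and conv: "\<And>g :: 'a \<Rightarrow> real. continuous_on UNIV g \<Longrightarrow> (\<lambda>k. \<integral>y. g y \<partial>P (r k)) \<longlonglongrightarrow> (\<integral>y. g y \<partial>N)"
    using prob_measures_cball_compact[where P=P and B=1, OF Psets Pprob Psupp] by blast
  interpret N: prob_space N by (rule N)
  note [measurable_cong] = N(1)
  define M' where "M' = distr N borel (\<lambda>y. B *\<^sub>R y)"
  have "f x = (\<integral>y. \<bar>x \<bullet> y\<bar> \<partial>M')" for x
  proof -
    have "continuous_on UNIV (\<lambda>y. \<bar>x \<bullet> y\<bar>)" by (intro continuous_intros)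
    from conv[OF this] have "(\<lambda>k. (\<integral>y. \<bar>x \<bullet> y\<bar> \<partial>M (r k)) / B) \<longlonglongrightarrow> (\<integral>y. \<bar>x \<bullet> y\<bar> \<partial>N)"
      unfolding Pint .
    moreover have "(\<lambda>k. (\<integral>y. \<bar>x \<bullet> y\<bar> \<partial>M (r k)) / B) \<longlonglongrightarrow> f x / B"
      using LIMSEQ_subseq_LIMSEQ[OF lim r] B(1) by (intro tendsto_divide tendsto_const) (auto simp: o_def)
    ultimately have "f x / B = (\<integral>y. \<bar>x \<bullet> y\<bar> \<partial>N)" using LIMSEQ_unique by blast
    then have "f x = B * (\<integral>y. \<bar>x \<bullet> y\<bar> \<partial>N)" using B(1) by (simp add: field_simps)
    also have "\<dots> = (\<integral>y. \<bar>x \<bullet> y\<bar> \<partial>M')"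
      unfolding M'_def using B(1) by (simp add: integral_distr abs_mult)
    finally show ?thesis .
  qed
  moreover have "integrable M' norm"
    unfolding M'_def
  proof (subst integrable_distr_eq)
    show "integrable N (\<lambda>y. norm (B *\<^sub>R y))"
    proof (rule N.integrable_const_bound[where B="B * b"])
      show "AE y in N. norm (norm (B *\<^sub>R y)) \<le> B * b"
        using b by eventually_elim (use B(1) in simp)
    qed measurable
  qed auto
  ultimately show ?thesis by (intro exI[of _ M']) (simp add: M'_def)
qed

section \<open>Test functions that detect the positivity of a generating measure\<close>

lemma gauss_add: "gauss a (x + y) = gauss a x * gauss a y * exp (- (a\<^sup>2 * (x \<bullet> y)))"
proof -
  have "(norm (x + y))\<^sup>2 = (norm x)\<^sup>2 + (norm y)\<^sup>2 + 2 * (x \<bullet> y)"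
    by (simp add: power2_norm_eq_inner inner_add_left inner_add_right inner_commute)
  then show ?thesis
    by (simp add: gauss_def power_mult_distrib field_simps flip: exp_add)
qed

lemma gauss_diff: "gauss a (x - y) = gauss a x * gauss a y * exp (a\<^sup>2 * (x \<bullet> y))"
  using gauss_add[of a x "- y"] by simp

lemma integrable_cos_gauss:
  fixes z :: "'a::euclidean_space"
  assumes "a > 0"
  shows "integrable lborel (\<lambda>y. gauss a y * cos (y \<bullet> z))"
  by (rule Bochner_Integration.integrable_bound[OF gauss_fourier(1)[OF assms]])
     (auto simp: abs_mult intro!: mult_left_le)

lemma gauss_fourier_cos_cos:
  fixes z p :: "'a::euclidean_space"
  assumes a: "a > 0"
  shows "(\<integral>y. gauss a y * (cos (y \<bullet> z) * cos (y \<bullet> p)) \<partial>lborel)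
    = gauss_mass a TYPE('a) * ((gauss (1 / a) (z + p) + gauss (1 / a) (z - p)) / 2)"
proof -
  have eq: "gauss a y * (cos (y \<bullet> z) * cos (y \<bullet> p))
      = (gauss a y * cos (y \<bullet> (z - p)) + gauss a y * cos (y \<bullet> (z + p))) / 2" for y
    by (simp add: inner_diff_right inner_add_right cos_add cos_diff algebra_simps)
  show ?thesis
    unfolding eq by (simp add: integrable_cos_gauss[OF a] gauss_fourier[OF a] field_simps)
qed

lemma integrable_cos_cos_gauss:
  fixes z p :: "'a::euclidean_space"
  assumes "a > 0"
  shows "integrable lborel (\<lambda>y. gauss a y * (cos (y \<bullet> z) * cos (y \<bullet> p)))"
  by (rule Bochner_Integration.integrable_bound[OF gauss_fourier(1)[OF assms]])
     (auto simp: abs_mult intro!: mult_left_le mult_le_one)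

text \<open>A modulated Gaussian, corrected by a multiple of the Gaussian so that its integral vanishes. For
  large \<open>R\<close>, its Fourier transform is concentrated near \<open>w\<close> and \<open>- w\<close>.\<close>

definition test_fun :: "real \<Rightarrow> 'a::euclidean_space \<Rightarrow> 'a \<Rightarrow> real" where
  "test_fun R w y = (cos (y \<bullet> w) - gauss R w) * gauss (1 / R) y"

lemma test_fun_measurable [measurable]: "test_fun R w \<in> borel_measurable borel"
  unfolding test_fun_def[abs_def] by measurable

lemma test_fun_integrable_mult:
  fixes f :: "'a::euclidean_space \<Rightarrow> real"
  assumes R: "R > 0" and [measurable]: "f \<in> borel_measurable borel"
    and f: "\<And>x. \<bar>f x\<bar> \<le> C * exp (c * norm x)"
  shows "integrable lborel (\<lambda>y. f y * test_fun R w y)"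
proof -
  have C: "C \<ge> 0" using f[of 0] abs_ge_zero[of "f 0"] by simp
  have "integrable lborel (\<lambda>y. (f y * (cos (y \<bullet> w) - gauss R w)) * gauss (1 / R) y)"
  proof (rule integrable_gauss_mult)
    fix y
    have "\<bar>cos (y \<bullet> w) - gauss R w\<bar> \<le> 2"
      using abs_cos_le_one[of "y \<bullet> w"] gauss_le_1[of R w] gauss_nonneg[of R w] by linarith
    then have "\<bar>f y\<bar> * \<bar>cos (y \<bullet> w) - gauss R w\<bar> \<le> (C * exp (c * norm y)) * 2"
      using C by (intro mult_mono f) auto
    then show "\<bar>f y * (cos (y \<bullet> w) - gauss R w)\<bar> \<le> (2 * C) * exp (c * norm y)"
      by (simp add: abs_mult)
  qed (use R in auto)
  then show ?thesis by (simp add: test_fun_def mult.assoc)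
qed

text \<open>The integral of \<open>\<psi> = test_fun R w\<close> vanishes and its Fourier transform is nonnegative: the
  correction term loses against the average of the two shifted Gaussians because \<open>cosh \<ge> 1\<close>. So
  \<open>\<integral> (1 - cos (s (y \<bullet> v))) \<psi>(y) dy \<le> 0\<close> for every \<open>s\<close>, and the claim follows by
  integration against \<open>ds / s\<^sup>2\<close>.\<close>

lemma test_fun_abs_inner_nonpos:
  fixes v w :: "'a::euclidean_space"
  assumes R: "R > 0"
  shows "(\<integral>y. \<bar>y \<bullet> v\<bar> * test_fun R w y \<partial>lborel) \<le> 0"
proof -
  let ?m = "gauss_mass (1 / R) TYPE('a)"
  have m: "?m > 0" using R by (intro gauss_mass_pos) simp
  have R': "1 / R > 0" using R by simp
  have int: "integrable lborel (\<lambda>y. norm y * test_fun R w y)"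
    by (rule test_fun_integrable_mult[OF R, where C=1 and c=1]) (auto simp: norm_le_exp)
  have int1: "integrable lborel (test_fun R w)"
    using test_fun_integrable_mult[OF R, of "\<lambda>_. 1" 1 0] by simp
  have val: "(\<integral>y. cos (y \<bullet> p) * test_fun R w y \<partial>lborel)
      = ?m * (gauss R w * gauss R p * (cosh (R\<^sup>2 * (w \<bullet> p)) - 1))" for p
  proof -
    have "cos (y \<bullet> p) * test_fun R w y
        = gauss (1 / R) y * (cos (y \<bullet> w) * cos (y \<bullet> p)) - gauss R w * (gauss (1 / R) y * cos (y \<bullet> p))" for y
      by (simp add: test_fun_def algebra_simps)
    then have "(\<integral>y. cos (y \<bullet> p) * test_fun R w y \<partial>lborel)
        = ?m * ((gauss R (w + p) + gauss R (w - p)) / 2) - gauss R w * (?m * gauss R p)"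
      by (simp add: integrable_cos_cos_gauss[OF R'] integrable_cos_gauss[OF R'] gauss_fourier_cos_cos[OF R'] gauss_fourier[OF R'])
    then show ?thesis
      by (simp add: gauss_add gauss_diff cosh_def inner_commute[of p w] field_simps)
  qed
  have inner_le: "(\<integral>y. (1 - cos (s * (y \<bullet> v))) * test_fun R w y \<partial>lborel) \<le> 0" for s
  proof -
    have i: "integrable lborel (\<lambda>y. cos (y \<bullet> (s *\<^sub>R v)) * test_fun R w y)"
      by (rule test_fun_integrable_mult[OF R, where C=1 and c=0]) auto
    have "(\<integral>y. (1 - cos (s * (y \<bullet> v))) * test_fun R w y \<partial>lborel)
        = (\<integral>y. cos (y \<bullet> 0) * test_fun R w y \<partial>lborel) - (\<integral>y. cos (y \<bullet> (s *\<^sub>R v)) * test_fun R w y \<partial>lborel)"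
      using i int1 by (simp add: left_diff_distrib)
    also have "\<dots> \<le> 0"
      unfolding val using m cosh_real_ge_1[of "R\<^sup>2 * (w \<bullet> (s *\<^sub>R v))"] by simp
    finally show ?thesis .
  qed
  have "\<kappa> * (\<integral>y. \<bar>y \<bullet> v\<bar> * test_fun R w y \<partial>lborel) =
      (\<integral>s. (\<integral>y. (1 - cos (s * (y \<bullet> v))) * test_fun R w y \<partial>lborel) / s\<^sup>2 \<partial>lborel)"
    by (rule abs_inner_integral(2)[OF _ int]) measurable
  also have "\<dots> = - (\<integral>s. - ((\<integral>y. (1 - cos (s * (y \<bullet> v))) * test_fun R w y \<partial>lborel) / s\<^sup>2) \<partial>lborel)"
    by simp
  also have "\<dots> \<le> 0"
    using inner_le by (simp only: neg_le_0_iff_le, intro integral_nonneg_AE) (simp add: divide_nonpos_nonneg)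
  finally show ?thesis using \<kappa>_pos by (simp add: mult_le_0_iff)
qed

section \<open>Elementary estimates\<close>

lemma one_minus_exp_le: "1 - exp (- t) \<le> t" for t :: real
  using exp_ge_add_one_self[of "- t"] by simp

text \<open>With \<open>u = t / 2\<close>, use \<open>cosh t - 1 = 2 (sinh u)\<^sup>2\<close> and \<open>sinh u \<le> u exp u\<close>.\<close>

lemma cosh_minus_one_le: "cosh t - 1 \<le> t\<^sup>2 / 2 * exp \<bar>t\<bar>" for t :: real
proof -
  have pos: "cosh t - 1 \<le> t\<^sup>2 / 2 * exp t" if "t \<ge> 0" for t :: real
  proof -
    define u where "u = t / 2"
    have u: "u \<ge> 0" "t = 2 * u" using that by (auto simp: u_def)
    have "sinh u = exp u * (1 - exp (- (2 * u))) / 2"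
      by (simp add: sinh_def algebra_simps flip: exp_add)
    also have "\<dots> \<le> exp u * (2 * u) / 2"
      using one_minus_exp_le[of "2 * u"] by (intro divide_right_mono mult_left_mono) auto
    finally have "sinh u \<le> u * exp u" by (simp add: mult.commute)
    then have "(sinh u)\<^sup>2 \<le> (u * exp u)\<^sup>2" using u by (intro power_mono) auto
    moreover have "cosh t - 1 = 2 * (sinh u)\<^sup>2" unfolding u(2) by (simp add: cosh_double cosh_square_eq)
    ultimately have "cosh t - 1 \<le> 2 * (u * exp u)\<^sup>2" by simp
    also have "\<dots> = t\<^sup>2 / 2 * exp t" unfolding u(2)
      by (simp add: power_mult_distrib power2_eq_square flip: exp_add)
    finally show ?thesis .
  qed
  show ?thesis using pos[of t] pos[of "- t"] by (cases "t \<ge> 0") auto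
qed

lemma one_minus_gauss_le: "1 - gauss a x \<le> (a * norm x)\<^sup>2 / 2"
  using one_minus_exp_le[of "(a * norm x)\<^sup>2 / 2"] by (simp add: gauss_def)

lemma gauss_1_cosh_bound: "\<bar>gauss 1 p * cosh t - 1\<bar> \<le> t\<^sup>2 / 2 * exp \<bar>t\<bar> + (norm p)\<^sup>2 / 2"
proof -
  have "gauss 1 p * cosh t - 1 = gauss 1 p * (cosh t - 1) - (1 - gauss 1 p)" by (simp add: algebra_simps)
  moreover have "gauss 1 p * (cosh t - 1) \<le> t\<^sup>2 / 2 * exp \<bar>t\<bar>" "0 \<le> gauss 1 p * (cosh t - 1)"
    using cosh_minus_one_le[of t] gauss_le_1[of 1 p] cosh_real_ge_1[of t]
      mult_right_mono[OF gauss_le_1[of 1 p], of "cosh t - 1"] by auto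
  moreover have "0 \<le> 1 - gauss 1 p" "1 - gauss 1 p \<le> (norm p)\<^sup>2 / 2"
    using gauss_le_1[of 1 p] one_minus_gauss_le[of 1 p] by auto
  ultimately show ?thesis by linarith
qed

lemma norm_mult_gauss_le: "R > 0 \<Longrightarrow> norm y * gauss (1 / R) y \<le> R"
proof -
  assume R: "R > 0"
  define t where "t = norm y / R"
  have t: "t \<ge> 0" using R by (simp add: t_def)
  have "t * exp (- t\<^sup>2 / 2) \<le> 1"
  proof -
    have "0 \<le> (t - 1)\<^sup>2" by simp
    then have "t \<le> 1 + t\<^sup>2 / 2" by (simp add: power2_diff)
    also have "\<dots> \<le> exp (t\<^sup>2 / 2)" using exp_ge_add_one_self[of "t\<^sup>2 / 2"] by simp
    finally show ?thesis by (simp add: exp_minus field_simps)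
  qed
  then have "R * (t * exp (- t\<^sup>2 / 2)) \<le> R * 1" using R by (intro mult_left_mono) auto
  then show ?thesis using R by (simp add: t_def gauss_def)
qed

text \<open>The weight on the scales between the smoothing scale 1 and the cut-off scale \<open>R\<close>. Its integral
  \<open>2 ln R\<close> diverges as \<open>R \<rightarrow> \<infinity>\<close>, so that the main term outweighs every bounded error.\<close>

definition log_kernel :: "real \<Rightarrow> real \<Rightarrow> real" where
  "log_kernel R s = indicator {1..R} \<bar>s\<bar> / \<bar>s\<bar>"

lemma log_kernel_integrable: "integrable lborel (log_kernel R)"
proof (rule Bochner_Integration.integrable_bound)
  show "integrable lborel (indicator {-R..R} :: real \<Rightarrow> real)"
    by (intro integrable_real_indicator) (auto simp: emeasure_lborel_Icc_eq)
  show "log_kernel R \<in> borel_measurable lborel" unfolding log_kernel_def[abs_def] by measurable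
  show "AE s in lborel. norm (log_kernel R s) \<le> norm (indicator {-R..R} s :: real)"
    by (intro AE_I2) (auto simp: log_kernel_def indicator_def abs_if field_simps)
qed

lemma log_kernel_integral_ge:
  assumes "R \<ge> 1"
  shows "ln R \<le> (\<integral>s. log_kernel R s \<partial>lborel)"
proof -
  have F: "has_bochner_integral lborel (\<lambda>x. (1 / x) * indicator {1..R} x) (ln R - ln 1)"
    by (rule has_bochner_integral_FTC_Icc_real) (use assms in \<open>auto intro!: derivative_eq_intros continuous_intros simp: divide_inverse\<close>)
  then have "ln R = (\<integral>x. (1 / x) * indicator {1..R} x \<partial>lborel)" by (simp add: has_bochner_integral_iff)
  also have "\<dots> \<le> (\<integral>s. log_kernel R s \<partial>lborel)"
  proof (rule integral_mono[OF _ log_kernel_integrable])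
    show "integrable lborel (\<lambda>x. (1 / x) * indicator {1..R} x)" using F by (simp add: has_bochner_integral_iff)
    show "(1 / x) * indicator {1..R} x \<le> log_kernel R x" for x
      by (auto simp: log_kernel_def indicator_def)
  qed
  finally show ?thesis .
qed

text \<open>A common majorant for all error terms: the first summand dominates the errors around scale 1,
  the second those around scale \<open>R\<close>. Both have the same integral, so the total error is
  bounded uniformly in \<open>R\<close>.\<close>

definition error_kernel :: "real \<Rightarrow> real \<Rightarrow> real" where
  "error_kernel R s = inverse (1 + s\<^sup>2) + R / (R\<^sup>2 + s\<^sup>2)"

lemma error_kernel:
  assumes R: "R > 0"
  shows "integrable lborel (error_kernel R)"
    and "(\<integral>s. error_kernel R s \<partial>lborel) = 2 * (\<integral>s. inverse (1 + s\<^sup>2) \<partial>lborel :: real)"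
proof -
  have nz: "R\<^sup>2 + s\<^sup>2 > 0" for s using R by (simp add: add_pos_nonneg)
  have eq: "R / (R\<^sup>2 + s\<^sup>2) = (1 / R) * inverse (1 + (0 + (1 / R) * s)\<^sup>2)" for s
    using R nz[of s] by (simp add: power_divide field_simps power2_eq_square)
  have R': "1 / R \<noteq> 0" using R by simp
  have i: "integrable lborel (\<lambda>s. inverse (1 + (0 + (1 / R) * s)\<^sup>2))"
    by (rule lborel_integrable_real_affine[OF integrable_inverse_1_plus_square R'])
  have v: "(\<integral>s. inverse (1 + s\<^sup>2) \<partial>lborel :: real) = (1 / R) * (\<integral>s. inverse (1 + (0 + (1 / R) * s)\<^sup>2) \<partial>lborel)"
    using lborel_integral_real_affine[OF R', of "\<lambda>s. inverse (1 + s\<^sup>2)" 0] R by simp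
  have split: "error_kernel R = (\<lambda>s. inverse (1 + s\<^sup>2) + (1 / R) * inverse (1 + (0 + (1 / R) * s)\<^sup>2))"
    unfolding error_kernel_def[abs_def] eq ..
  show "integrable lborel (error_kernel R)"
    unfolding split by (intro Bochner_Integration.integrable_add integrable_inverse_1_plus_square integrable_mult_right i)
  show "(\<integral>s. error_kernel R s \<partial>lborel) = 2 * (\<integral>s. inverse (1 + s\<^sup>2) \<partial>lborel :: real)"
    unfolding split
    by (subst Bochner_Integration.integral_add[OF integrable_inverse_1_plus_square integrable_mult_right[OF i]], subst integral_mult_right_zero)
       (simp only: v[symmetric])
qed

lemma error_kernel_bounds:
  assumes R: "R \<ge> 1"
  shows "\<bar>s\<bar> \<le> 1 \<Longrightarrow> 1 \<le> 2 * error_kernel R s"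
    and "1 \<le> \<bar>s\<bar> \<Longrightarrow> 1 / s\<^sup>2 \<le> 2 * error_kernel R s"
    and "\<bar>s\<bar> \<le> R \<Longrightarrow> \<bar>s\<bar> / R\<^sup>2 \<le> 2 * error_kernel R s"
    and "R \<le> \<bar>s\<bar> \<Longrightarrow> R / s\<^sup>2 \<le> 2 * error_kernel R s"
    and "0 \<le> error_kernel R s"
proof -
  have p: "1 + s\<^sup>2 > 0" "R\<^sup>2 + s\<^sup>2 > 0" using R by (auto simp: add_pos_nonneg)
  have nn: "0 \<le> inverse (1 + s\<^sup>2)" "0 \<le> R / (R\<^sup>2 + s\<^sup>2)" using p R by auto
  then show "0 \<le> error_kernel R s" by (simp add: error_kernel_def)
  show "1 \<le> 2 * error_kernel R s" if "\<bar>s\<bar> \<le> 1"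
  proof -
    have "s\<^sup>2 \<le> 1" using that by (simp add: abs_square_le_1)
    then have "1 \<le> 2 * inverse (1 + s\<^sup>2)" using p by (simp add: field_simps)
    then show ?thesis using nn unfolding error_kernel_def distrib_left by linarith
  qed
  show "1 / s\<^sup>2 \<le> 2 * error_kernel R s" if "1 \<le> \<bar>s\<bar>"
  proof -
    have s: "1 \<le> s\<^sup>2" using that power_mono[of 1 "\<bar>s\<bar>" 2] by simp
    then have "s\<^sup>2 > 0" by linarith
    then have "1 / s\<^sup>2 \<le> 2 * inverse (1 + s\<^sup>2)" using p s by (simp add: field_simps)
    then show ?thesis using nn unfolding error_kernel_def distrib_left by linarith
  qed
  show "\<bar>s\<bar> / R\<^sup>2 \<le> 2 * error_kernel R s" if "\<bar>s\<bar> \<le> R"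
  proof -
    have s: "s\<^sup>2 \<le> R\<^sup>2" using that R by (simp add: abs_le_square_iff[symmetric])
    have "\<bar>s\<bar> / R\<^sup>2 \<le> R / R\<^sup>2" using that by (intro divide_right_mono) auto
    also have "\<dots> \<le> 2 * (R / (R\<^sup>2 + s\<^sup>2))"
    proof -
      have "R * (R\<^sup>2 + s\<^sup>2) \<le> R * (2 * R\<^sup>2)" using s R by (intro mult_left_mono) auto
      then show ?thesis using p R by (simp add: field_simps)
    qed
    finally show ?thesis using nn unfolding error_kernel_def distrib_left by linarith
  qed
  show "R / s\<^sup>2 \<le> 2 * error_kernel R s" if "R \<le> \<bar>s\<bar>"
  proof -
    have s: "R\<^sup>2 \<le> s\<^sup>2" using that R power_mono[of R "\<bar>s\<bar>" 2] by simp
    have s0: "s\<^sup>2 > 0" using that R by auto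
    have "R * (R\<^sup>2 + s\<^sup>2) \<le> R * (2 * s\<^sup>2)" using s R by (intro mult_left_mono) auto
    then have "R / s\<^sup>2 \<le> 2 * (R / (R\<^sup>2 + s\<^sup>2))" using p s0 by (simp add: field_simps)
    then show ?thesis using nn unfolding error_kernel_def distrib_left by linarith
  qed
qed

section \<open>Recovering the generating measure\<close>

locale even_sublinear = sublinear f for f :: "'a::euclidean_space \<Rightarrow> real" +
  assumes even: "f (- x) = f x"
begin

lemma f_nonneg: "f x \<ge> 0"
  using even by (rule nonneg)

lemma f_measurable [measurable]: "f \<in> borel_measurable borel"
  by (rule borel_measurable_continuous_onI[OF continuous])

lemma f_scale: "f (s *\<^sub>R x) = \<bar>s\<bar> * f x"
  using homogeneous[of s x] homogeneous[of "- s" x] even[of "s *\<^sub>R x"] by (cases "s \<ge> 0") auto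

lemma f_bound: "\<exists>B>0. \<forall>x. \<bar>f x\<bar> \<le> B * norm x"
  using bound f_nonneg by (simp only: abs_of_nonneg)

lemma f_exp_bound: "\<exists>B>0. \<forall>x. \<bar>f x\<bar> \<le> B * exp (1 * norm x)"
proof -
  obtain B where B: "B > 0" "\<And>x. \<bar>f x\<bar> \<le> B * norm x" using f_bound by blast
  have "\<bar>f x\<bar> \<le> B * exp (1 * norm x)" for x
    unfolding mult_1 using B(1) by (intro order.trans[OF B(2)] mult_left_mono norm_le_exp) simp
  with B(1) show ?thesis by blast
qed

lemma integrable_f_gauss: "a > 0 \<Longrightarrow> integrable lborel (\<lambda>y. f y * gauss a y)"
proof -
  assume a: "a > 0"
  obtain B where "\<And>x. \<bar>f x\<bar> \<le> B * exp (1 * norm x)" using f_exp_bound by blast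
  then show ?thesis by (rule integrable_gauss_mult[OF a f_measurable])
qed

lemma gauss_mass_1_pos: "gauss_mass 1 TYPE('a) > 0" by (rule gauss_mass_pos) simp

text \<open>In the following definitions, \<open>h R = (\<lambda>y. f y * gauss (1 / R) y)\<close> is \<open>f\<close> cut off at scale
  \<open>R\<close>. These are the integral of \<open>h R\<close>, its Fourier transform, and the convolution of \<open>h R\<close>
  with a Gaussian of scale 1.\<close>

definition gauss_moment :: "real \<Rightarrow> real" where
  "gauss_moment R = (\<integral>y. f y * gauss (1 / R) y \<partial>lborel)"

definition gauss_transform :: "real \<Rightarrow> 'a \<Rightarrow> real" where
  "gauss_transform R w = (\<integral>y. f y * gauss (1 / R) y * cos (y \<bullet> w) \<partial>lborel)"

definition smoothed :: "real \<Rightarrow> 'a \<Rightarrow> real" where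
  "smoothed R p = (\<integral>y. f y * gauss (1 / R) y * gauss 1 (y - p) \<partial>lborel)"

text \<open>A smoothed version of the negative Fourier transform of \<open>f\<close>. As a function of \<open>w\<close>, it is minus
  the integral of \<open>f\<close> against \<open>test_fun R w\<close>, see \<open>spectral_density_eq\<close>.\<close>

definition spectral_density :: "real \<Rightarrow> 'a \<Rightarrow> real" where
  "spectral_density R w = gauss_moment R * gauss R w - gauss_transform R w"

lemma integrable_gauss_transform_integrand: "R > 0 \<Longrightarrow> integrable lborel (\<lambda>y. f y * gauss (1 / R) y * cos (y \<bullet> w))"
  by (rule Bochner_Integration.integrable_bound[OF integrable_f_gauss[of "1 / R"]])
     (auto simp: abs_mult intro!: mult_left_le)

lemma gauss_transform_measurable [measurable]: "gauss_transform R \<in> borel_measurable borel"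
  unfolding gauss_transform_def[abs_def] by measurable

lemma spectral_density_measurable [measurable]: "spectral_density R \<in> borel_measurable borel"
  unfolding spectral_density_def[abs_def] by measurable

lemma gauss_transform_bound: "R > 0 \<Longrightarrow> \<bar>gauss_transform R w\<bar> \<le> gauss_moment R"
proof -
  assume R: "R > 0"
  have "\<bar>gauss_transform R w\<bar> \<le> (\<integral>y. norm (f y * gauss (1 / R) y * cos (y \<bullet> w)) \<partial>lborel)"
    unfolding gauss_transform_def real_norm_def[symmetric] by (rule integral_norm_bound)
  also have "\<dots> \<le> gauss_moment R"
    unfolding gauss_moment_def
    by (intro integral_mono integrable_norm integrable_gauss_transform_integrand integrable_f_gauss)
       (use R f_nonneg in \<open>auto simp: abs_mult intro!: mult_left_le\<close>)
  finally show ?thesis .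
qed

lemma gauss_moment_nonneg: "gauss_moment R \<ge> 0"
  unfolding gauss_moment_def by (intro integral_nonneg_AE AE_I2) (simp add: f_nonneg)

lemma spectral_density_eq: "R > 0 \<Longrightarrow> spectral_density R w = - (\<integral>y. f y * test_fun R w y \<partial>lborel)"
proof -
  assume R: "R > 0"
  have "f y * test_fun R w y = f y * gauss (1 / R) y * cos (y \<bullet> w) - f y * gauss (1 / R) y * gauss R w" for y
    by (simp add: test_fun_def algebra_simps)
  then show ?thesis
    using R integrable_gauss_transform_integrand[of R w] integrable_f_gauss[of "1 / R"]
    by (simp add: spectral_density_def gauss_moment_def gauss_transform_def)
qed

text \<open>Fourier inversion in smoothed form: cutting off the Fourier transform by a Gaussian amounts to
  convolution with a Gaussian. By Fubini's theorem this is a statement about Gaussian integrals only.\<close>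

lemma gauss_transform_fourier:
  assumes R: "R > 0"
  shows "(\<integral>w. gauss_transform R w * gauss 1 w * cos (w \<bullet> p) \<partial>lborel) = gauss_mass 1 TYPE('a) * smoothed R p"
proof -
  let ?g = "\<lambda>y. f y * gauss (1 / R) y" and ?m = "gauss_mass 1 TYPE('a)"
  let ?F = "\<lambda>w y. ?g y * cos (y \<bullet> w) * (gauss 1 w * cos (w \<bullet> p))"
  have g0: "?g y \<ge> 0" for y by (simp add: f_nonneg)
  have gi: "integrable lborel ?g" using R by (intro integrable_f_gauss) simp
  have dom: "integrable (lborel \<Otimes>\<^sub>M lborel) (\<lambda>(w :: 'a, y). gauss 1 w * ?g y)"
  proof (rule lborel_pair.Fubini_integrable)
    have "(\<integral>y. norm (gauss 1 w * ?g y) \<partial>lborel) = gauss 1 w * (\<integral>y. ?g y \<partial>lborel)" for w :: 'a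
      using g0 by (simp add: abs_mult f_nonneg)
    then show "integrable lborel (\<lambda>w :: 'a. \<integral>y. norm (case (w, y) of (w, y) \<Rightarrow> gauss 1 w * ?g y) \<partial>lborel)"
      using gauss_fourier(1)[of 1, where 'a='a] by simp
    show "AE w :: 'a in lborel. integrable lborel (\<lambda>y. case (w, y) of (w, y) \<Rightarrow> gauss 1 w * ?g y)"
      unfolding prod.case by (intro AE_I2 integrable_mult_right gi)
  qed measurable
  have intF: "integrable (lborel \<Otimes>\<^sub>M lborel) (case_prod ?F)"
  proof (rule Bochner_Integration.integrable_bound[OF dom])
    have "\<bar>?F w y\<bar> \<le> gauss 1 w * ?g y" for w y
    proof -
      have "\<bar>?F w y\<bar> = gauss 1 w * ?g y * (\<bar>cos (y \<bullet> w)\<bar> * \<bar>cos (w \<bullet> p)\<bar>)"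
        using f_nonneg[of y] by (simp add: abs_mult)
      also have "\<dots> \<le> gauss 1 w * ?g y * 1"
        using f_nonneg[of y] by (intro mult_left_mono mult_le_one) auto
      finally show ?thesis by simp
    qed
    then show "AE z in lborel \<Otimes>\<^sub>M lborel. norm (case_prod ?F z) \<le> norm (case z of (w, y) \<Rightarrow> gauss 1 w * ?g y)"
      using f_nonneg by (intro AE_I2) (auto simp: abs_mult split: prod.split)
  qed measurable
  have "(\<integral>w. gauss_transform R w * gauss 1 w * cos (w \<bullet> p) \<partial>lborel) = (\<integral>w. (\<integral>y. ?F w y \<partial>lborel) \<partial>lborel)"
    unfolding gauss_transform_def integral_mult_left_zero by (simp only: mult.assoc)
  also have "\<dots> = (\<integral>y. (\<integral>w. ?F w y \<partial>lborel) \<partial>lborel)"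
    by (rule lborel_pair.Fubini_integral[OF intF, symmetric])
  also have "\<dots> = (\<integral>y. ?g y * (?m * ((gauss 1 (y + p) + gauss 1 (y - p)) / 2)) \<partial>lborel)"
  proof (rule Bochner_Integration.integral_cong[OF refl])
    fix y
    have "(\<integral>w. ?F w y \<partial>lborel) = (\<integral>w. ?g y * (gauss 1 w * (cos (w \<bullet> y) * cos (w \<bullet> p))) \<partial>lborel)"
      by (intro Bochner_Integration.integral_cong refl) (simp only: inner_commute mult_ac)
    also have "\<dots> = ?g y * (?m * ((gauss 1 (y + p) + gauss 1 (y - p)) / 2))"
      unfolding integral_mult_right_zero using gauss_fourier_cos_cos[of 1 y p] by simp
    finally show "(\<integral>w. ?F w y \<partial>lborel) = ?g y * (?m * ((gauss 1 (y + p) + gauss 1 (y - p)) / 2))" .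
  qed
  also have "\<dots> = ?m / 2 * ((\<integral>y. ?g y * gauss 1 (y + p) \<partial>lborel) + (\<integral>y. ?g y * gauss 1 (y - p) \<partial>lborel))"
  proof -
    have i: "integrable lborel (\<lambda>y. ?g y * gauss 1 (y + q))" for q
      by (rule Bochner_Integration.integrable_bound[OF gi])
         (auto simp: abs_mult f_nonneg gauss_le_1 intro!: mult_left_le)
    have "?g y * (?m * ((gauss 1 (y + p) + gauss 1 (y - p)) / 2))
        = ?m / 2 * (?g y * gauss 1 (y + p) + ?g y * gauss 1 (y + (- p)))" for y
      by (simp add: algebra_simps add_divide_distrib)
    then show ?thesis
      by (simp only: integral_mult_right_zero Bochner_Integration.integral_add[OF i i] diff_conv_add_uminus)
  qed
  also have "(\<integral>y. ?g y * gauss 1 (y + p) \<partial>lborel) = (\<integral>y. ?g y * gauss 1 (y - p) \<partial>lborel)"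
  proof -
    have "(\<integral>y. ?g y * gauss 1 (y + p) \<partial>lborel) = (\<integral>y. ?g (- y) * gauss 1 (- y + p) \<partial>lborel)"
      by (rule lborel_integral_reflect) measurable
    moreover have "gauss 1 (- y + p) = gauss 1 (y - p)" for y
      using gauss_minus[of 1 "y - p"] by simp
    ultimately show ?thesis by (simp add: even)
  qed
  finally show ?thesis by (simp add: smoothed_def)
qed

definition spectral_cosine :: "real \<Rightarrow> 'a \<Rightarrow> real" where
  "spectral_cosine R x = (\<integral>w. \<bar>w \<bullet> x\<bar> * (spectral_density R w * gauss 1 w) \<partial>lborel)"

lemma integrable_norm_gauss_transform: "R > 0 \<Longrightarrow> integrable lborel (\<lambda>w. norm w * (gauss_transform R w * gauss 1 w))"
proof -
  assume R: "R > 0"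
  have "integrable lborel (\<lambda>w. (norm w * gauss_transform R w) * gauss 1 w)"
  proof (rule integrable_gauss_mult)
    fix w :: 'a
    have "norm w * \<bar>gauss_transform R w\<bar> \<le> exp (norm w) * gauss_moment R"
      using gauss_moment_nonneg by (intro mult_mono norm_le_exp gauss_transform_bound R) auto
    then show "\<bar>norm w * gauss_transform R w\<bar> \<le> gauss_moment R * exp (1 * norm w)"
      by (simp add: abs_mult mult.commute)
  qed auto
  then show ?thesis by (simp add: mult.assoc)
qed

lemma integrable_norm_gauss: "a > 0 \<Longrightarrow> integrable lborel (\<lambda>w::'a. norm w * gauss a w)"
  by (rule integrable_gauss_mult[where C=1 and c=1]) (auto simp: norm_le_exp)

lemma integrable_norm_gauss_gauss: "integrable lborel (\<lambda>w::'a. norm w * (gauss R w * gauss 1 w))"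
  by (rule Bochner_Integration.integrable_bound[OF integrable_norm_gauss[of 1]])
     (auto simp: abs_mult gauss_le_1 intro!: mult_left_mono mult_left_le_one_le)

lemma integrable_norm_spectral_density: "R > 0 \<Longrightarrow> integrable lborel (\<lambda>w. norm w * (spectral_density R w * gauss 1 w))"
proof -
  assume R: "R > 0"
  have "norm w * (spectral_density R w * gauss 1 w)
      = gauss_moment R * (norm w * (gauss R w * gauss 1 w)) - norm w * (gauss_transform R w * gauss 1 w)" for w
    by (simp add: spectral_density_def algebra_simps)
  then show ?thesis
    using integrable_norm_gauss_transform[OF R] integrable_norm_gauss_gauss[of R] by simp
qed

text \<open>The part of the cosine transform that stems from the correction term of the test functions.\<close>

definition correction :: "real \<Rightarrow> 'a \<Rightarrow> real" where
  "correction R x = gauss_moment R * (\<integral>w. \<bar>w \<bullet> x\<bar> * (gauss R w * gauss 1 w) \<partial>lborel)"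

text \<open>Representing \<open>\<bar>w \<bullet> x\<bar>\<close> by cosines reduces the cosine transform of the spectral density to the
  smoothed function along the line through \<open>x\<close>.\<close>

lemma spectral_cosine_eq:
  assumes R: "R > 0"
  shows "integrable lborel (\<lambda>s. (smoothed R (s *\<^sub>R x) - smoothed R 0) / s\<^sup>2)"
    and "\<kappa> * spectral_cosine R x = \<kappa> * correction R x
      + gauss_mass 1 TYPE('a) * (\<integral>s. (smoothed R (s *\<^sub>R x) - smoothed R 0) / s\<^sup>2 \<partial>lborel)"
proof -
  let ?F = "\<lambda>w. - (gauss_transform R w * gauss 1 w)" and ?m = "gauss_mass 1 TYPE('a)"
  have int: "integrable lborel (\<lambda>w. norm w * ?F w)" using integrable_norm_gauss_transform[OF R] by simp
  have F [measurable]: "?F \<in> borel_measurable borel" by measurable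
  have hg: "integrable lborel (\<lambda>w. gauss_transform R w * gauss 1 w)"
    by (rule integrable_gauss_mult[where C="gauss_moment R" and c=0]) (auto simp: gauss_transform_bound R)
  have hgc: "integrable lborel (\<lambda>w. gauss_transform R w * gauss 1 w * cos (w \<bullet> p))" for p
    by (rule Bochner_Integration.integrable_bound[OF hg]) (auto simp: abs_mult intro!: mult_left_le)
  have inner: "(\<integral>w. (1 - cos (s * (w \<bullet> x))) * ?F w \<partial>lborel) = ?m * (smoothed R (s *\<^sub>R x) - smoothed R 0)" for s
  proof -
    have "(1 - cos (s * (w \<bullet> x))) * ?F w
        = gauss_transform R w * gauss 1 w * cos (w \<bullet> (s *\<^sub>R x)) - gauss_transform R w * gauss 1 w * cos (w \<bullet> 0)" for w
      by (simp add: algebra_simps)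
    then have "(\<integral>w. (1 - cos (s * (w \<bullet> x))) * ?F w \<partial>lborel)
        = (\<integral>w. gauss_transform R w * gauss 1 w * cos (w \<bullet> (s *\<^sub>R x)) \<partial>lborel) - (\<integral>w. gauss_transform R w * gauss 1 w * cos (w \<bullet> 0) \<partial>lborel)"
      by (simp only: Bochner_Integration.integral_diff[OF hgc hgc])
    then show ?thesis unfolding gauss_transform_fourier[OF R] by (simp only: right_diff_distrib)
  qed
  have eq: "(\<integral>w. (1 - cos (s * (w \<bullet> x))) * ?F w \<partial>lborel) / s\<^sup>2 = ?m * ((smoothed R (s *\<^sub>R x) - smoothed R 0) / s\<^sup>2)" for s
    unfolding inner by simp
  have "integrable lborel (\<lambda>s. ?m * ((smoothed R (s *\<^sub>R x) - smoothed R 0) / s\<^sup>2))"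
    using abs_inner_integral(1)[OF _ int, of x] unfolding eq by simp
  then have "integrable lborel (\<lambda>s. inverse ?m *
      (?m * ((smoothed R (s *\<^sub>R x) - smoothed R 0) / s\<^sup>2)))"
    by (rule integrable_mult_right)
  moreover have "inverse ?m * (?m * z) = z" for z
    using gauss_mass_1_pos by (simp flip: mult.assoc)
  ultimately show "integrable lborel (\<lambda>s. (smoothed R (s *\<^sub>R x) - smoothed R 0) / s\<^sup>2)"
    by (simp only:)
  have "\<kappa> * (\<integral>w. \<bar>w \<bullet> x\<bar> * ?F w \<partial>lborel) = ?m * (\<integral>s. (smoothed R (s *\<^sub>R x) - smoothed R 0) / s\<^sup>2 \<partial>lborel)"
    using abs_inner_integral(2)[OF F int, of x] unfolding eq integral_mult_right_zero .
  moreover have "spectral_cosine R x = correction R x + (\<integral>w. \<bar>w \<bullet> x\<bar> * ?F w \<partial>lborel)"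
  proof -
    have i1: "integrable lborel (\<lambda>w. \<bar>w \<bullet> x\<bar> * (gauss R w * gauss 1 w))"
      by (rule integrable_abs_inner[OF integrable_norm_gauss_gauss]) measurable
    have i2: "integrable lborel (\<lambda>w. \<bar>w \<bullet> x\<bar> * ?F w)"
      by (rule integrable_abs_inner[OF int]) measurable
    have "\<bar>w \<bullet> x\<bar> * (spectral_density R w * gauss 1 w) = gauss_moment R * (\<bar>w \<bullet> x\<bar> * (gauss R w * gauss 1 w)) + \<bar>w \<bullet> x\<bar> * ?F w" for w
      by (simp add: spectral_density_def algebra_simps)
    then show ?thesis
      unfolding spectral_cosine_def correction_def
      by (simp only: Bochner_Integration.integral_add[OF integrable_mult_right[OF i1] i2] integral_mult_right_zero)
  qed
  ultimately show "\<kappa> * spectral_cosine R x = \<kappa> * correction R x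
      + ?m * (\<integral>s. (smoothed R (s *\<^sub>R x) - smoothed R 0) / s\<^sup>2 \<partial>lborel)"
    by (simp add: right_diff_distrib)
qed

text \<open>The moment grows like \<open>R ^ (n + 1)\<close>, and the integral against \<open>gauss R\<close> decays at exactly the
  inverse rate, both by homogeneity of degree 1.\<close>

lemma correction_bound:
  fixes x :: 'a
  assumes R: "R > 0"
  shows "0 \<le> correction R x"
    and "correction R x
      \<le> gauss_moment 1 * (norm x * (\<integral>w. norm w * gauss 1 (w::'a) \<partial>lborel))"
proof -
  show "0 \<le> correction R x" unfolding correction_def
    by (intro mult_nonneg_nonneg gauss_moment_nonneg integral_nonneg_AE AE_I2) simp_all
  have "(\<integral>w. \<bar>w \<bullet> x\<bar> * (gauss R w * gauss 1 w) \<partial>lborel) \<le> (\<integral>w. norm x * (norm w * gauss R (w::'a)) \<partial>lborel)"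
  proof (rule integral_mono)
    show "integrable lborel (\<lambda>w. \<bar>w \<bullet> x\<bar> * (gauss R w * gauss 1 w))"
      by (rule integrable_abs_inner[OF integrable_norm_gauss_gauss]) measurable
    show "integrable lborel (\<lambda>w::'a. norm x * (norm w * gauss R w))"
      by (intro integrable_mult_right integrable_norm_gauss R)
    fix w
    have "\<bar>w \<bullet> x\<bar> * (gauss R w * gauss 1 w) \<le> (norm w * norm x) * (gauss R w * 1)"
      by (intro mult_mono Cauchy_Schwarz_ineq2 gauss_le_1) auto
    then show "\<bar>w \<bullet> x\<bar> * (gauss R w * gauss 1 w) \<le> norm x * (norm w * gauss R w)"
      by (simp add: mult_ac)
  qed
  also have "\<dots> = norm x * ((1 / R) ^ Suc DIM('a) * (\<integral>w. norm w * gauss 1 (w::'a) \<partial>lborel))"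
    using homogeneous_gauss_scale[of "norm :: 'a \<Rightarrow> real" R] R by simp
  finally have le: "(\<integral>w. \<bar>w \<bullet> x\<bar> * (gauss R w * gauss 1 w) \<partial>lborel)
      \<le> norm x * ((1 / R) ^ Suc DIM('a) * (\<integral>w. norm w * gauss 1 (w::'a) \<partial>lborel))" .
  have "gauss_moment R = R ^ Suc DIM('a) * gauss_moment 1"
    using homogeneous_gauss_scale[OF f_measurable homogeneous, of "1 / R"] R by (simp add: gauss_moment_def)
  then have "gauss_moment R * (norm x * ((1 / R) ^ Suc DIM('a) * (\<integral>w. norm w * gauss 1 (w::'a) \<partial>lborel)))
      = gauss_moment 1 * (norm x * (\<integral>w. norm w * gauss 1 (w::'a) \<partial>lborel))"
    using R by (simp add: power_one_over field_simps)
  then show "correction R x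
      \<le> gauss_moment 1 * (norm x * (\<integral>w. norm w * gauss 1 (w::'a) \<partial>lborel))"
    unfolding correction_def using mult_left_mono[OF le gauss_moment_nonneg[of R]] by simp
qed

lemma integrable_smoothed: "R > 0 \<Longrightarrow> integrable lborel (\<lambda>y. f y * gauss (1 / R) y * gauss 1 (y + p))"
  by (rule Bochner_Integration.integrable_bound[OF integrable_f_gauss[of "1 / R"]])
     (auto simp: abs_mult f_nonneg gauss_le_1 intro!: mult_left_le)

lemma smoothed_even: "smoothed R (- p) = smoothed R p"
proof -
  have "smoothed R (- p) = (\<integral>y. f (- y) * gauss (1 / R) (- y) * gauss 1 (- y - (- p)) \<partial>lborel)"
    unfolding smoothed_def by (rule lborel_integral_reflect) measurable
  moreover have "gauss 1 (- y - (- p)) = gauss 1 (y - p)" for y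
    using gauss_minus[of 1 "y - p"] by simp
  ultimately show ?thesis by (simp add: smoothed_def even)
qed

text \<open>As \<open>f\<close> is even, averaging over \<open>\<plusminus> s x\<close> removes the first-order term in \<open>s\<close>. The expansion is
  that of the Gaussian factor, as \<open>f\<close> is merely Lipschitz.\<close>

lemma smoothed_near_zero:
  "\<exists>C\<ge>0. \<forall>R>0. \<forall>s. \<bar>s\<bar> \<le> 1 \<longrightarrow> \<bar>smoothed R (s *\<^sub>R x) - smoothed R 0\<bar> \<le> C * s\<^sup>2"
proof -
  obtain B where B: "B > 0" "\<And>x. \<bar>f x\<bar> \<le> B * exp (1 * norm x)" using f_exp_bound by blast
  define M where "M y = (norm y)\<^sup>2 * (norm x)\<^sup>2 / 2 * exp (norm y * norm x) + (norm x)\<^sup>2 / 2" for y :: 'a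
  have M0: "M y \<ge> 0" for y by (simp add: M_def)
  have intM: "integrable lborel (\<lambda>y. f y * M y * gauss 1 y)"
  proof (rule integrable_gauss_mult)
    show "(\<lambda>y. f y * M y) \<in> borel_measurable borel" unfolding M_def[abs_def] by measurable
    fix y :: 'a
    have "(norm y)\<^sup>2 \<le> exp (2 * norm y)"
      using power_mono[OF norm_le_exp[of y], of 2] by (simp add: exp_double)
    then have "(norm y)\<^sup>2 * exp (norm y * norm x) \<le> exp (2 * norm y) * exp (norm y * norm x)"
      by (intro mult_right_mono) auto
    also have "\<dots> = exp ((2 + norm x) * norm y)" by (simp add: algebra_simps flip: exp_add)
    finally have 1: "(norm x)\<^sup>2 / 2 * ((norm y)\<^sup>2 * exp (norm y * norm x)) \<le> (norm x)\<^sup>2 / 2 * exp ((2 + norm x) * norm y)"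
      by (intro mult_left_mono) auto
    have 2: "(norm x)\<^sup>2 / 2 * 1 \<le> (norm x)\<^sup>2 / 2 * exp ((2 + norm x) * norm y)"
      by (intro mult_left_mono) auto
    have "M y \<le> (norm x)\<^sup>2 * exp ((2 + norm x) * norm y)"
      using add_mono[OF 1 2] by (simp add: M_def mult_ac)
    then have "\<bar>f y\<bar> * M y \<le> (B * exp (1 * norm y)) * ((norm x)\<^sup>2 * exp ((2 + norm x) * norm y))"
      using B M0 by (intro mult_mono) auto
    also have "\<dots> = B * (norm x)\<^sup>2 * (exp (1 * norm y) * exp ((2 + norm x) * norm y))" by (simp only: mult_ac)
    also have "exp (1 * norm y) * exp ((2 + norm x) * norm y) = exp ((3 + norm x) * norm y)"
      by (simp add: algebra_simps flip: exp_add)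
    finally show "\<bar>f y * M y\<bar> \<le> (B * (norm x)\<^sup>2) * exp ((3 + norm x) * norm y)"
      using M0 by (simp add: abs_mult)
  qed simp
  define C where "C = (\<integral>y. f y * M y * gauss 1 y \<partial>lborel)"
  have "\<bar>smoothed R (s *\<^sub>R x) - smoothed R 0\<bar> \<le> C * s\<^sup>2" if R: "R > 0" and s: "\<bar>s\<bar> \<le> 1" for R s
  proof -
    let ?g = "\<lambda>y. f y * gauss (1 / R) y" and ?p = "s *\<^sub>R x"
    let ?D = "\<lambda>y. ?g y * gauss 1 y * (gauss 1 ?p * cosh (y \<bullet> ?p) - 1)"
    have i: "integrable lborel (\<lambda>y. ?g y * gauss 1 (y + q))" for q by (rule integrable_smoothed[OF R])
    have D: "?D y = (?g y * gauss 1 (y + (- ?p)) + ?g y * gauss 1 (y + ?p)) / 2 - ?g y * gauss 1 (y + 0)" for y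
      by (simp add: gauss_add gauss_diff cosh_def field_simps)
    have sm: "smoothed R q = (\<integral>y. ?g y * gauss 1 (y + - q) \<partial>lborel)" for q
      by (simp add: smoothed_def)
    have "(\<integral>y. ?D y \<partial>lborel) = ((\<integral>y. ?g y * gauss 1 (y + - ?p) \<partial>lborel)
        + (\<integral>y. ?g y * gauss 1 (y + ?p) \<partial>lborel)) / 2 - (\<integral>y. ?g y * gauss 1 (y + 0) \<partial>lborel)"
      unfolding D using i[of ?p] i[of "- ?p"] i[of 0] by simp
    then have eq: "smoothed R ?p - smoothed R 0 = (\<integral>y. ?D y \<partial>lborel)"
      using sm[of ?p] sm[of "- ?p"] sm[of 0] smoothed_even[of R ?p] by simp
    have "\<bar>smoothed R ?p - smoothed R 0\<bar> \<le> (\<integral>y. norm (?D y) \<partial>lborel)"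
      unfolding eq real_norm_def[symmetric] by (rule integral_norm_bound)
    also have "\<dots> \<le> (\<integral>y. s\<^sup>2 * (f y * M y * gauss 1 y) \<partial>lborel)"
    proof (rule integral_mono)
      show "integrable lborel (\<lambda>y. norm (?D y))"
        unfolding D using i[of ?p] i[of "- ?p"] i[of 0] by (intro integrable_norm) simp
      show "integrable lborel (\<lambda>y. s\<^sup>2 * (f y * M y * gauss 1 y))" using intM by simp
      fix y :: 'a
      have t: "\<bar>y \<bullet> ?p\<bar> \<le> \<bar>s\<bar> * (norm y * norm x)"
        using Cauchy_Schwarz_ineq2[of y x] by (simp add: abs_mult mult_left_mono)
      have t1: "\<bar>y \<bullet> ?p\<bar> \<le> norm y * norm x"
        using t mult_right_mono[OF s, of "norm y * norm x"] by simp
      have t2: "(y \<bullet> ?p)\<^sup>2 \<le> s\<^sup>2 * ((norm y)\<^sup>2 * (norm x)\<^sup>2)"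
        using power_mono[OF t, of 2] by (simp add: power_mult_distrib)
      have "\<bar>gauss 1 ?p * cosh (y \<bullet> ?p) - 1\<bar> \<le> (y \<bullet> ?p)\<^sup>2 / 2 * exp \<bar>y \<bullet> ?p\<bar> + (norm ?p)\<^sup>2 / 2"
        by (rule gauss_1_cosh_bound)
      also have "\<dots> \<le> s\<^sup>2 * ((norm y)\<^sup>2 * (norm x)\<^sup>2) / 2 * exp (norm y * norm x) + (norm ?p)\<^sup>2 / 2"
        using t1 t2 by (intro add_right_mono mult_mono) auto
      also have "\<dots> = s\<^sup>2 * M y" by (simp add: M_def power_mult_distrib field_simps)
      finally have le: "\<bar>gauss 1 ?p * cosh (y \<bullet> ?p) - 1\<bar> \<le> s\<^sup>2 * M y" .
      have "norm (?D y) = f y * gauss (1 / R) y * gauss 1 y * \<bar>gauss 1 ?p * cosh (y \<bullet> ?p) - 1\<bar>"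
        using f_nonneg by (simp add: abs_mult)
      also have "\<dots> \<le> f y * 1 * gauss 1 y * (s\<^sup>2 * M y)"
        using f_nonneg M0 by (intro mult_mono le gauss_le_1 mult_nonneg_nonneg) auto
      finally show "norm (?D y) \<le> s\<^sup>2 * (f y * M y * gauss 1 y)" by (simp add: mult_ac)
    qed
    finally show ?thesis by (simp add: C_def mult.commute)
  qed
  moreover have "C \<ge> 0"
    unfolding C_def by (intro integral_nonneg_AE AE_I2) (simp add: f_nonneg M0)
  ultimately show ?thesis by blast
qed

lemma smoothed_translate: "smoothed R p = (\<integral>z. f (p + z) * gauss (1 / R) (p + z) * gauss 1 z \<partial>lborel)"
proof -
  have "smoothed R p = (\<integral>z. f (p + z) * gauss (1 / R) (p + z) * gauss 1 (p + z - p) \<partial>lborel)"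
    unfolding smoothed_def by (rule lborel_integral_translate) measurable
  then show ?thesis by simp
qed

lemma f_gauss_bound: "\<exists>B>0. \<forall>R>0. \<forall>y. \<bar>f y\<bar> * gauss (1 / R) y \<le> B * R"
proof -
  obtain B where B: "B > 0" "\<And>x. \<bar>f x\<bar> \<le> B * norm x" using f_bound by blast
  have "\<bar>f y\<bar> * gauss (1 / R) y \<le> B * R" if "R > 0" for R y
  proof -
    have "\<bar>f y\<bar> * gauss (1 / R) y \<le> (B * norm y) * gauss (1 / R) y"
      by (intro mult_right_mono B) simp
    also have "\<dots> \<le> B * R"
      using mult_left_mono[OF norm_mult_gauss_le[OF that, of y], of B] B(1) by (simp add: mult.assoc)
    finally show ?thesis .
  qed
  with B(1) show ?thesis by blast
qed

lemma integrable_smoothed_translate: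
  assumes R: "R > 0"
  shows "integrable lborel (\<lambda>z. f (p + z) * gauss (1 / R) (p + z) * gauss 1 z)"
proof -
  obtain B where B: "B > 0" "\<And>R y. R > 0 \<Longrightarrow> \<bar>f y\<bar> * gauss (1 / R) y \<le> B * R"
    using f_gauss_bound by blast
  show ?thesis
  proof (rule integrable_gauss_mult)
    fix z :: 'a
    show "\<bar>f (p + z) * gauss (1 / R) (p + z)\<bar> \<le> (B * R) * exp (0 * norm z)"
      using B(2)[OF R, of "p + z"] by (simp add: abs_mult)
  qed auto
qed

lemma smoothed_far:
  "\<exists>C\<ge>0. \<forall>R>0. \<forall>p. \<bar>smoothed R p\<bar> \<le> C * R"
proof -
  obtain B where B: "B > 0" "\<And>R y. R > 0 \<Longrightarrow> \<bar>f y\<bar> * gauss (1 / R) y \<le> B * R"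
    using f_gauss_bound by blast
  have "\<bar>smoothed R p\<bar> \<le> B * gauss_mass 1 TYPE('a) * R" if R: "R > 0" for R p
  proof -
    have "\<bar>smoothed R p\<bar> \<le> (\<integral>z. norm (f (p + z) * gauss (1 / R) (p + z) * gauss 1 z) \<partial>lborel)"
      unfolding smoothed_translate real_norm_def[symmetric] by (rule integral_norm_bound)
    also have "\<dots> \<le> (\<integral>z. (B * R) * gauss 1 (z :: 'a) \<partial>lborel)"
    proof (rule integral_mono)
      show "integrable lborel (\<lambda>z. norm (f (p + z) * gauss (1 / R) (p + z) * gauss 1 z))"
        by (intro integrable_norm integrable_smoothed_translate R)
      show "integrable lborel (\<lambda>z :: 'a. (B * R) * gauss 1 z)"
        by (intro integrable_mult_right gauss_fourier(1)) simp
      fix z :: 'a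
      show "norm (f (p + z) * gauss (1 / R) (p + z) * gauss 1 z) \<le> (B * R) * gauss 1 z"
        using B(2)[OF R, of "p + z"] by (simp add: abs_mult mult_right_mono)
    qed
    also have "\<dots> = B * gauss_mass 1 TYPE('a) * R"
      using gauss_integral[of 1, where 'a='a] by simp
    finally show ?thesis .
  qed
  then show ?thesis using B(1) gauss_mass_1_pos by (intro exI[of _ "B * gauss_mass 1 TYPE('a)"]) auto
qed

lemma smoothed_zero: "\<exists>C\<ge>0. \<forall>R. \<bar>smoothed R 0\<bar> \<le> C"
proof -
  have "\<bar>smoothed R 0\<bar> \<le> (\<integral>y. f y * gauss 1 y \<partial>lborel)" for R
  proof -
    have "\<bar>smoothed R 0\<bar> \<le> (\<integral>y. norm (f y * gauss (1 / R) y * gauss 1 y) \<partial>lborel)"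
      unfolding smoothed_def real_norm_def[symmetric] using integral_norm_bound[of lborel "\<lambda>y. f y * gauss (1 / R) y * gauss 1 y"] by simp
    also have "\<dots> \<le> (\<integral>y. f y * gauss 1 y \<partial>lborel)"
    proof (rule integral_mono)
      have le: "\<bar>f y * gauss (1 / R) y * gauss 1 y\<bar> \<le> f y * gauss 1 y" for y
      proof -
        have "f y * gauss (1 / R) y * gauss 1 y \<le> f y * 1 * gauss 1 y"
          using f_nonneg by (intro mult_right_mono mult_left_mono gauss_le_1) auto
        then show ?thesis using f_nonneg by (simp add: abs_mult)
      qed
      then show "norm (f y * gauss (1 / R) y * gauss 1 y) \<le> f y * gauss 1 y" for y by simp
      show i: "integrable lborel (\<lambda>y. f y * gauss 1 y)" by (intro integrable_f_gauss) simp
      show "integrable lborel (\<lambda>y. norm (f y * gauss (1 / R) y * gauss 1 y))"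
        by (rule Bochner_Integration.integrable_bound[OF i]) (use le f_nonneg in \<open>auto simp: abs_mult\<close>)
    qed
    finally show ?thesis .
  qed
  then show ?thesis
    by (intro exI[of _ "\<integral>y. f y * gauss 1 y \<partial>lborel"]) (auto intro!: integral_nonneg_AE simp: f_nonneg)
qed

text \<open>On scales between 1 and \<open>R\<close>, smoothing changes \<open>f (s x)\<close> by a bounded amount since \<open>f\<close> is
  Lipschitz, and the cut-off changes it by the relative amount \<open>O(s\<^sup>2 / R\<^sup>2)\<close>.\<close>

lemma smoothed_middle:
  "\<exists>C\<ge>0. \<forall>R s. 1 \<le> \<bar>s\<bar> \<longrightarrow> \<bar>s\<bar> \<le> R \<longrightarrow>
     \<bar>smoothed R (s *\<^sub>R x) - gauss_mass 1 TYPE('a) * (\<bar>s\<bar> * f x)\<bar> \<le> C * (1 + \<bar>s\<bar> ^ 3 / R\<^sup>2)"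
proof -
  obtain L where L: "L > 0" "\<And>x y. \<bar>f x - f y\<bar> \<le> L * norm (x - y)" using lipschitz by blast
  let ?m = "gauss_mass 1 TYPE('a)"
  define E where "E z = L * norm z + f x * (norm z)\<^sup>2" for z :: 'a
  have E0: "E z \<ge> 0" for z using L(1) f_nonneg by (simp add: E_def)
  have intE: "integrable lborel (\<lambda>z. E z * gauss 1 z)"
  proof (rule integrable_gauss_mult)
    show "E \<in> borel_measurable borel" unfolding E_def[abs_def] by measurable
    fix z :: 'a
    have "(norm z)\<^sup>2 \<le> exp (2 * norm z)"
      using power_mono[OF norm_le_exp[of z], of 2] by (simp add: exp_double)
    then have 2: "f x * (norm z)\<^sup>2 \<le> f x * exp (2 * norm z)" using f_nonneg by (intro mult_left_mono)
    have "norm z \<le> exp (2 * norm z)"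
      using norm_le_exp[of z] by (rule order.trans) simp
    then have 1: "L * norm z \<le> L * exp (2 * norm z)" using L(1) by (intro mult_left_mono) auto
    show "\<bar>E z\<bar> \<le> (L + f x) * exp (2 * norm z)"
      using add_mono[OF 1 2] E0[of z] by (simp add: E_def distrib_right)
  qed simp
  define C1 where "C1 = (\<integral>z. E z * gauss 1 z \<partial>lborel)"
  define C2 where "C2 = f x * (norm x)\<^sup>2 * ?m"
  have C1: "C1 \<ge> 0" unfolding C1_def by (intro integral_nonneg_AE AE_I2) (simp add: E0)
  have C2: "C2 \<ge> 0" unfolding C2_def using f_nonneg gauss_mass_1_pos by simp
  have main: "\<bar>smoothed R (s *\<^sub>R x) - ?m * (\<bar>s\<bar> * f x)\<bar> \<le> C1 + C2 * (\<bar>s\<bar> ^ 3 / R\<^sup>2)"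
    if s: "1 \<le> \<bar>s\<bar>" "\<bar>s\<bar> \<le> R" for R s
  proof -
    have R: "R > 0" using s by simp
    let ?p = "s *\<^sub>R x" and ?k = "\<bar>s\<bar> ^ 3 / R\<^sup>2"
    let ?D = "\<lambda>z. f (?p + z) * gauss (1 / R) (?p + z) * gauss 1 z - (\<bar>s\<bar> * f x) * gauss 1 z"
    have gi: "integrable lborel (\<lambda>z :: 'a. gauss 1 z)" by (rule gauss_fourier(1)) simp
    have iD: "integrable lborel ?D"
      by (intro Bochner_Integration.integrable_diff integrable_smoothed_translate R integrable_mult_right gi)
    have eq: "smoothed R ?p - ?m * (\<bar>s\<bar> * f x) = (\<integral>z. ?D z \<partial>lborel)"
      unfolding smoothed_translate
      by (subst Bochner_Integration.integral_diff[OF integrable_smoothed_translate[OF R] integrable_mult_right[OF gi]])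
         (simp add: gauss_integral mult.commute)
    have "\<bar>smoothed R ?p - ?m * (\<bar>s\<bar> * f x)\<bar> \<le> (\<integral>z. norm (?D z) \<partial>lborel)"
      using integral_norm_bound[of lborel ?D] unfolding eq real_norm_def .
    also have "\<dots> \<le> (\<integral>z. E z * gauss 1 z + (f x * (norm x)\<^sup>2 * ?k) * gauss 1 z \<partial>lborel)"
    proof (rule integral_mono[where f="\<lambda>z. norm (?D z)"])
      show "integrable lborel (\<lambda>z. norm (?D z))" by (rule integrable_norm[OF iD])
      show "integrable lborel (\<lambda>z. E z * gauss 1 z + (f x * (norm x)\<^sup>2 * ?k) * gauss 1 z)"
        by (intro Bochner_Integration.integrable_add intE integrable_mult_right gi)
      fix z :: 'a
      have fp: "f ?p = \<bar>s\<bar> * f x" by (rule f_scale)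
      have eq': "f (?p + z) * gauss (1 / R) (?p + z) - f ?p
          = (f (?p + z) - f ?p) * gauss (1 / R) (?p + z) - f ?p * (1 - gauss (1 / R) (?p + z))"
        by (simp add: algebra_simps)
      have "\<bar>f (?p + z) * gauss (1 / R) (?p + z) - f ?p\<bar>
          \<le> \<bar>f (?p + z) - f ?p\<bar> * gauss (1 / R) (?p + z) + f ?p * (1 - gauss (1 / R) (?p + z))"
        unfolding eq' using f_nonneg[of ?p] gauss_le_1[of "1 / R" "?p + z"]
        by (intro order.trans[OF abs_triangle_ineq4]) (simp add: abs_mult)
      also have "\<dots> \<le> L * norm z * 1 + (\<bar>s\<bar> * f x) * (((norm x)\<^sup>2 * s\<^sup>2 + (norm z)\<^sup>2) / R\<^sup>2)"
      proof (rule add_mono)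
        show "\<bar>f (?p + z) - f ?p\<bar> * gauss (1 / R) (?p + z) \<le> L * norm z * 1"
          using L(2)[of "?p + z" ?p] L(1) by (intro mult_mono gauss_le_1) auto
        have "1 - gauss (1 / R) (?p + z) \<le> (1 / R * norm (?p + z))\<^sup>2 / 2" by (rule one_minus_gauss_le)
        also have "\<dots> \<le> ((norm x)\<^sup>2 * s\<^sup>2 + (norm z)\<^sup>2) / R\<^sup>2"
        proof -
          have "(norm (?p + z))\<^sup>2 \<le> (norm ?p + norm z)\<^sup>2" by (intro power_mono norm_triangle_ineq) auto
          also have "\<dots> \<le> 2 * ((norm ?p)\<^sup>2 + (norm z)\<^sup>2)"
            using zero_le_power2[of "norm ?p - norm z"] by (simp add: power2_sum power2_diff)
          finally have "(norm (?p + z))\<^sup>2 / 2 \<le> (norm x)\<^sup>2 * s\<^sup>2 + (norm z)\<^sup>2"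
            by (simp add: power_mult_distrib mult.commute)
          then have "(norm (?p + z))\<^sup>2 / 2 / R\<^sup>2 \<le> ((norm x)\<^sup>2 * s\<^sup>2 + (norm z)\<^sup>2) / R\<^sup>2"
            by (intro divide_right_mono) auto
          then show ?thesis by (simp add: power_mult_distrib power_divide mult.commute)
        qed
        finally show "f ?p * (1 - gauss (1 / R) (?p + z)) \<le> (\<bar>s\<bar> * f x) * (((norm x)\<^sup>2 * s\<^sup>2 + (norm z)\<^sup>2) / R\<^sup>2)"
          unfolding fp using f_nonneg by (intro mult_left_mono) auto
      qed
      also have "\<dots> = L * norm z + f x * (norm x)\<^sup>2 * ?k + f x * (norm z)\<^sup>2 * (\<bar>s\<bar> / R\<^sup>2)"
        by (simp add: power3_eq_cube power2_eq_square add_divide_distrib distrib_left mult_ac abs_mult_self_eq)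
      also have "\<dots> \<le> L * norm z + f x * (norm x)\<^sup>2 * ?k + f x * (norm z)\<^sup>2 * 1"
      proof (intro add_left_mono mult_left_mono)
        have "\<bar>s\<bar> * 1 \<le> R * R" using s by (intro mult_mono) auto
        then show "\<bar>s\<bar> / R\<^sup>2 \<le> 1" using R by (simp add: power2_eq_square)
      qed (use f_nonneg in auto)
      finally have "\<bar>f (?p + z) * gauss (1 / R) (?p + z) - \<bar>s\<bar> * f x\<bar> \<le> E z + f x * (norm x)\<^sup>2 * ?k"
        unfolding fp E_def by simp
      then have "\<bar>f (?p + z) * gauss (1 / R) (?p + z) - \<bar>s\<bar> * f x\<bar> * gauss 1 z \<le> (E z + f x * (norm x)\<^sup>2 * ?k) * gauss 1 z"
        by (intro mult_right_mono) auto
      moreover have "norm (?D z) = \<bar>f (?p + z) * gauss (1 / R) (?p + z) - \<bar>s\<bar> * f x\<bar> * gauss 1 z"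
        unfolding left_diff_distrib[symmetric] by (simp add: abs_mult)
      ultimately show "norm (?D z) \<le> E z * gauss 1 z + (f x * (norm x)\<^sup>2 * ?k) * gauss 1 z"
        by (simp add: distrib_right)
    qed
    also have "\<dots> = C1 + C2 * ?k"
      by (subst Bochner_Integration.integral_add[OF intE integrable_mult_right[OF gi]])
         (simp add: C1_def C2_def gauss_integral)
    finally show ?thesis .
  qed
  show ?thesis
  proof (intro exI[of _ "C1 + C2"] conjI allI impI)
    show "0 \<le> C1 + C2" using C1 C2 by simp
    fix R s :: real assume s: "1 \<le> \<bar>s\<bar>" "\<bar>s\<bar> \<le> R"
    have k: "0 \<le> \<bar>s\<bar> ^ 3 / R\<^sup>2" by simp
    have "C1 + C2 * (\<bar>s\<bar> ^ 3 / R\<^sup>2) \<le> (C1 + C2) * (1 + \<bar>s\<bar> ^ 3 / R\<^sup>2)"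
      using mult_nonneg_nonneg[OF C1 k] C2 unfolding distrib_left distrib_right mult_1_right by linarith
    then show "\<bar>smoothed R (s *\<^sub>R x) - ?m * (\<bar>s\<bar> * f x)\<bar> \<le> (C1 + C2) * (1 + \<bar>s\<bar> ^ 3 / R\<^sup>2)"
      using main[OF s] by linarith
  qed
qed

text \<open>The estimates on the three ranges of scales combine as follows: divided by \<open>s\<^sup>2\<close>, the main term
  \<open>\<bar>s\<bar> f x\<close> becomes the logarithmic kernel, and everything else is dominated by the error kernel.\<close>

lemma smoothed_error:
  "\<exists>C\<ge>0. \<forall>R\<ge>1. \<forall>s. \<bar>(smoothed R (s *\<^sub>R x) - smoothed R 0) / s\<^sup>2
      - gauss_mass 1 TYPE('a) * f x * log_kernel R s\<bar> \<le> C * error_kernel R s"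
proof -
  let ?m = "gauss_mass 1 TYPE('a)"
  obtain C1 where C1: "C1 \<ge> 0" "\<And>R s. R > 0 \<Longrightarrow> \<bar>s\<bar> \<le> 1 \<Longrightarrow> \<bar>smoothed R (s *\<^sub>R x) - smoothed R 0\<bar> \<le> C1 * s\<^sup>2"
    using smoothed_near_zero by blast
  obtain C2 where C2: "C2 \<ge> 0" "\<And>R s. 1 \<le> \<bar>s\<bar> \<Longrightarrow> \<bar>s\<bar> \<le> R \<Longrightarrow>
     \<bar>smoothed R (s *\<^sub>R x) - ?m * (\<bar>s\<bar> * f x)\<bar> \<le> C2 * (1 + \<bar>s\<bar> ^ 3 / R\<^sup>2)"
    using smoothed_middle by blast
  obtain C3 where C3: "C3 \<ge> 0" "\<And>R p. R > 0 \<Longrightarrow> \<bar>smoothed R p\<bar> \<le> C3 * R" using smoothed_far by blast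
  obtain C4 where C4: "C4 \<ge> 0" "\<And>R. \<bar>smoothed R 0\<bar> \<le> C4" using smoothed_zero by blast
  define nf where "nf = ?m * f x"
  have near: "\<bar>(smoothed R (s *\<^sub>R x) - smoothed R 0) / s\<^sup>2\<bar> \<le> C1" if "R \<ge> 1" "\<bar>s\<bar> \<le> 1" for R s
    using C1(2)[of R s] that C1(1) by (cases "s = 0") (auto simp: abs_divide field_simps)
  define C where "C = 4 * (C1 + C2 + C3 + C4 + \<bar>nf\<bar>)"
  have "\<bar>(smoothed R (s *\<^sub>R x) - smoothed R 0) / s\<^sup>2 - nf * log_kernel R s\<bar> \<le> C * error_kernel R s"
    if R: "R \<ge> 1" for R s
  proof -
    note E = error_kernel_bounds[OF R, of s]
    have nf0: "\<bar>nf\<bar> \<ge> 0" by simp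
    consider "\<bar>s\<bar> < 1" | "1 \<le> \<bar>s\<bar>" "\<bar>s\<bar> \<le> R" | "R < \<bar>s\<bar>" by linarith
    then show ?thesis
    proof cases
      case 1
      then have "log_kernel R s = 0" by (simp add: log_kernel_def)
      moreover have "C1 \<le> C1 * (2 * error_kernel R s)"
        using mult_left_mono[OF E(1), of C1] C1(1) 1 by simp
      moreover have "\<dots> \<le> C * error_kernel R s"
        unfolding C_def using C1(1) C2(1) C3(1) C4(1) E(5) mult_right_mono[of "2 * C1" "4 * (C1 + C2 + C3 + C4 + \<bar>nf\<bar>)" "error_kernel R s"]
        by simp
      ultimately show ?thesis using near[OF R, of s] 1 by simp
    next
      case 2
      then have s2: "s\<^sup>2 > 0" by auto
      have lk: "nf * log_kernel R s = ?m * (\<bar>s\<bar> * f x) / s\<^sup>2"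
      proof -
        have "s\<^sup>2 = \<bar>s\<bar> * \<bar>s\<bar>" by (simp add: power2_eq_square)
        moreover have "\<bar>s\<bar> \<noteq> 0" using 2 by auto
        ultimately show ?thesis using 2 by (simp only: log_kernel_def nf_def) (simp add: field_simps)
      qed
      have "\<bar>(smoothed R (s *\<^sub>R x) - smoothed R 0) / s\<^sup>2 - nf * log_kernel R s\<bar>
          = \<bar>(smoothed R (s *\<^sub>R x) - ?m * (\<bar>s\<bar> * f x)) - smoothed R 0\<bar> / s\<^sup>2"
        unfolding lk diff_divide_distrib[symmetric] by (simp add: algebra_simps)
      also have "\<dots> \<le> (C2 * (1 + \<bar>s\<bar> ^ 3 / R\<^sup>2) + C4) / s\<^sup>2"
        using C2(2)[OF 2] C4(2)[of R] by (intro divide_right_mono) auto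
      also have "\<dots> = (C2 + C4) * (1 / s\<^sup>2) + C2 * (\<bar>s\<bar> / R\<^sup>2)"
      proof -
        have "\<bar>s\<bar> ^ 3 = \<bar>s\<bar> * s\<^sup>2" by (simp add: power3_eq_cube power2_eq_square)
        then show ?thesis using s2 R by (simp add: field_simps)
      qed
      also have "\<dots> \<le> (C2 + C4) * (2 * error_kernel R s) + C2 * (2 * error_kernel R s)"
        using C2(1) C4(1) 2 by (intro add_mono mult_left_mono E(2) E(3)) auto
      also have "\<dots> = (4 * C2 + 2 * C4) * error_kernel R s" by (simp add: algebra_simps)
      also have "\<dots> \<le> C * error_kernel R s"
        unfolding C_def using C1(1) C2(1) C3(1) C4(1) E(5) by (intro mult_right_mono) auto
      finally show ?thesis .
    next
      case 3
      then have s2: "s\<^sup>2 > 0" using R by auto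
      have "log_kernel R s = 0" using 3 by (simp add: log_kernel_def)
      then have "\<bar>(smoothed R (s *\<^sub>R x) - smoothed R 0) / s\<^sup>2 - nf * log_kernel R s\<bar>
          = \<bar>smoothed R (s *\<^sub>R x) - smoothed R 0\<bar> / s\<^sup>2" by (simp add: abs_divide)
      also have "\<dots> \<le> (C3 * R + C4 * R) / s\<^sup>2"
      proof (intro divide_right_mono)
        have "C4 * 1 \<le> C4 * R" using R C4(1) by (intro mult_left_mono)
        then show "\<bar>smoothed R (s *\<^sub>R x) - smoothed R 0\<bar> \<le> C3 * R + C4 * R"
          using C3(2)[of R "s *\<^sub>R x"] C4(2)[of R] R by linarith
      qed simp
      also have "\<dots> = (C3 + C4) * (R / s\<^sup>2)" by (simp add: distrib_right)
      also have "\<dots> \<le> (C3 + C4) * (2 * error_kernel R s)"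
        using C3(1) C4(1) 3 by (intro mult_left_mono E(4)) auto
      also have "\<dots> = (2 * C3 + 2 * C4) * error_kernel R s" by (simp add: algebra_simps)
      also have "\<dots> \<le> C * error_kernel R s"
        unfolding C_def using C1(1) C2(1) C3(1) C4(1) E(5) by (intro mult_right_mono) auto
      finally show ?thesis .
    qed
  qed
  moreover have "C \<ge> 0" unfolding C_def using C1(1) C2(1) C3(1) C4(1) by simp
  ultimately show ?thesis unfolding nf_def by blast
qed

text \<open>Up to a bounded error, the cosine transform of the cut-off spectral density is proportional to
  \<open>f x\<close>, with a factor that does not depend on \<open>x\<close>.\<close>

lemma spectral_cosine_asymptotic:
  "\<exists>C. \<forall>R\<ge>1. \<bar>\<kappa> * spectral_cosine R x - (gauss_mass 1 TYPE('a))\<^sup>2 * f x * (\<integral>s. log_kernel R s \<partial>lborel)\<bar> \<le> C"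
proof -
  let ?m = "gauss_mass 1 TYPE('a)"
  obtain C where C: "C \<ge> 0" "\<And>R s. R \<ge> 1 \<Longrightarrow> \<bar>(smoothed R (s *\<^sub>R x) - smoothed R 0) / s\<^sup>2
      - ?m * f x * log_kernel R s\<bar> \<le> C * error_kernel R s"
    using smoothed_error by blast
  define J where "J = (\<integral>s. inverse (1 + s\<^sup>2) \<partial>lborel :: real)"
  define K where "K = \<kappa> * (gauss_moment 1 * (norm x * (\<integral>w. norm w * gauss 1 (w :: 'a) \<partial>lborel)))"
  have "\<bar>\<kappa> * spectral_cosine R x - ?m\<^sup>2 * f x * (\<integral>s. log_kernel R s \<partial>lborel)\<bar> \<le> K + ?m * (C * (2 * J))"
    if R: "R \<ge> 1" for R
  proof -
    have R0: "R > 0" using R by simp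
    let ?P = "\<lambda>s. (smoothed R (s *\<^sub>R x) - smoothed R 0) / s\<^sup>2"
    let ?T = "correction R x"
    have iL: "integrable lborel (\<lambda>s. ?m * f x * log_kernel R s)"
      by (intro integrable_mult_right log_kernel_integrable)
    have iP: "integrable lborel ?P" by (rule spectral_cosine_eq(1)[OF R0])
    have d: "(\<integral>s. ?P s \<partial>lborel) - ?m * f x * (\<integral>s. log_kernel R s \<partial>lborel)
        = (\<integral>s. ?P s - ?m * f x * log_kernel R s \<partial>lborel)"
      by (subst Bochner_Integration.integral_diff[OF iP iL]) simp
    have "\<bar>(\<integral>s. ?P s \<partial>lborel) - ?m * f x * (\<integral>s. log_kernel R s \<partial>lborel)\<bar>
        \<le> (\<integral>s. norm (?P s - ?m * f x * log_kernel R s) \<partial>lborel)"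
      using integral_norm_bound[of lborel "\<lambda>s. ?P s - ?m * f x * log_kernel R s"] unfolding d real_norm_def .
    also have "\<dots> \<le> (\<integral>s. C * error_kernel R s \<partial>lborel)"
    proof (rule integral_mono[where f="\<lambda>s. norm (?P s - ?m * f x * log_kernel R s)"])
      show "integrable lborel (\<lambda>s. norm (?P s - ?m * f x * log_kernel R s))"
        by (intro integrable_norm Bochner_Integration.integrable_diff iP iL)
      show "integrable lborel (\<lambda>s. C * error_kernel R s)"
        by (intro integrable_mult_right error_kernel(1) R0)
      show "norm (?P s - ?m * f x * log_kernel R s) \<le> C * error_kernel R s" for s
        using C(2)[OF R, of s] by simp
    qed
    also have "\<dots> = C * (2 * J)" using error_kernel(2)[OF R0] by (simp add: J_def)
    finally have 1: "\<bar>(\<integral>s. ?P s \<partial>lborel) - ?m * f x * (\<integral>s. log_kernel R s \<partial>lborel)\<bar> \<le> C * (2 * J)" .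
    have eq: "\<kappa> * spectral_cosine R x - ?m\<^sup>2 * f x * (\<integral>s. log_kernel R s \<partial>lborel)
        = \<kappa> * ?T + ?m * ((\<integral>s. ?P s \<partial>lborel) - ?m * f x * (\<integral>s. log_kernel R s \<partial>lborel))"
      unfolding spectral_cosine_eq(2)[OF R0] by (simp add: algebra_simps power2_eq_square)
    have "0 \<le> \<kappa> * ?T" "\<kappa> * ?T \<le> K"
      unfolding K_def using correction_bound[OF R0, of x] \<kappa>_pos by (auto intro: mult_left_mono mult_nonneg_nonneg simp del: mult_le_cancel_left_pos)
    moreover have "\<bar>?m * ((\<integral>s. ?P s \<partial>lborel) - ?m * f x * (\<integral>s. log_kernel R s \<partial>lborel))\<bar> \<le> ?m * (C * (2 * J))"
      unfolding abs_mult using 1 gauss_mass_1_pos by (simp add: abs_of_pos)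
    ultimately show ?thesis unfolding eq by linarith
  qed
  then show ?thesis by blast
qed

text \<open>Normalized by the logarithm, the spectral densities, which are nonnegative by hypothesis, have
  cosine transforms that converge to \<open>f\<close>.\<close>

lemma cosine_transform_of_measure:
  assumes neg: "\<And>R w. R > 0 \<Longrightarrow> (\<integral>y. f y * test_fun R w y \<partial>lborel) \<le> 0"
  shows "\<exists>M. sets M = sets borel \<and> integrable M norm \<and> (\<forall>x. f x = (\<integral>y. \<bar>x \<bullet> y\<bar> \<partial>M))"
proof -
  let ?m = "gauss_mass 1 TYPE('a)"
  define l where "l R = (\<integral>s. log_kernel R s \<partial>lborel)" for R
  \<comment> \<open>Starting at 2 keeps the logarithm positive for all \<open>k\<close>.\<close>
  define R where "R k = real k + 2" for k :: nat
  have R1: "R k \<ge> 1" and R0: "R k > 0" for k by (auto simp: R_def)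
  have l_ge: "ln (R k) \<le> l (R k)" for k unfolding l_def by (rule log_kernel_integral_ge[OF R1])
  have l_pos: "l (R k) > 0" for k
  proof -
    have "0 < ln (R k)" by (simp add: R_def)
    then show ?thesis using l_ge[of k] by linarith
  qed
  have "filterlim R at_top sequentially"
    by (rule filterlim_at_top_mono[OF filterlim_real_sequentially]) (simp add: R_def)
  then have "filterlim (\<lambda>k. ln (R k)) at_top sequentially"
    by (rule filterlim_compose[OF ln_at_top])
  then have l_top: "filterlim (\<lambda>k. l (R k)) at_top sequentially"
    by (rule filterlim_at_top_mono) (simp add: l_ge)
  define c where "c k = \<kappa> / (?m\<^sup>2 * l (R k))" for k
  have c0: "c k \<ge> 0" for k using \<kappa>_pos l_pos[of k] by (simp add: c_def)
  have density_nonneg: "spectral_density (R k) w \<ge> 0" for k w unfolding spectral_density_eq[OF R0] using neg[OF R0] by simp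
  define \<rho> where "\<rho> k w = c k * (spectral_density (R k) w * gauss 1 w)" for k w
  have \<rho>0: "\<rho> k w \<ge> 0" for k w unfolding \<rho>_def by (intro mult_nonneg_nonneg c0 density_nonneg) simp
  have [measurable]: "\<rho> k \<in> borel_measurable borel" for k unfolding \<rho>_def[abs_def] by measurable
  define M where "M k = density lborel (\<lambda>w. ennreal (\<rho> k w))" for k
  show ?thesis
  proof (rule cosine_transform_closed[where M=M])
    show "sets (M k) = sets borel" for k by (simp add: M_def)
    have eq: "\<rho> k w * norm w = c k * (norm w * (spectral_density (R k) w * gauss 1 w))" for k w
      by (simp add: \<rho>_def)
    have "integrable lborel (\<lambda>w. \<rho> k w * norm w)" for k
      unfolding eq by (intro integrable_mult_right integrable_norm_spectral_density R0)
    then show "integrable (M k) norm" for k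
      unfolding M_def by (subst integrable_density) (auto simp: \<rho>0)
    fix x
    have int: "(\<integral>y. \<bar>x \<bullet> y\<bar> \<partial>M k) = \<kappa> * spectral_cosine (R k) x / (?m\<^sup>2 * l (R k))" for k
    proof -
      have "(\<integral>y. \<bar>x \<bullet> y\<bar> \<partial>M k) = (\<integral>y. \<rho> k y * \<bar>x \<bullet> y\<bar> \<partial>lborel)"
        unfolding M_def by (subst integral_density) (auto simp: \<rho>0)
      also have "\<dots> = (\<integral>y. c k * (\<bar>y \<bullet> x\<bar> * (spectral_density (R k) y * gauss 1 y)) \<partial>lborel)"
        by (intro Bochner_Integration.integral_cong refl) (simp add: \<rho>_def inner_commute)
      also have "\<dots> = c k * spectral_cosine (R k) x"
        unfolding spectral_cosine_def integral_mult_right_zero ..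
      finally show ?thesis by (simp add: c_def)
    qed
    obtain C where C: "\<And>R. R \<ge> 1 \<Longrightarrow> \<bar>\<kappa> * spectral_cosine R x - ?m\<^sup>2 * f x * l R\<bar> \<le> C"
      using spectral_cosine_asymptotic unfolding l_def by blast
    have diff: "\<bar>(\<integral>y. \<bar>x \<bullet> y\<bar> \<partial>M k) - f x\<bar> \<le> C / ?m\<^sup>2 * inverse (l (R k))" for k
    proof -
      have p: "?m\<^sup>2 * l (R k) > 0" using gauss_mass_1_pos l_pos[of k] by simp
      have "(\<integral>y. \<bar>x \<bullet> y\<bar> \<partial>M k) - f x = (\<kappa> * spectral_cosine (R k) x - ?m\<^sup>2 * f x * l (R k)) / (?m\<^sup>2 * l (R k))"
        unfolding int diff_divide_distrib using gauss_mass_1_pos l_pos[of k] by simp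
      then have "\<bar>(\<integral>y. \<bar>x \<bullet> y\<bar> \<partial>M k) - f x\<bar> = \<bar>\<kappa> * spectral_cosine (R k) x - ?m\<^sup>2 * f x * l (R k)\<bar> / (?m\<^sup>2 * l (R k))"
        using p by (simp add: abs_divide)
      also have "\<dots> \<le> C / (?m\<^sup>2 * l (R k))" using C[OF R1] p by (intro divide_right_mono) auto
      finally show ?thesis by (simp add: divide_inverse mult_ac)
    qed
    have "(\<lambda>k. C / ?m\<^sup>2 * inverse (l (R k))) \<longlonglongrightarrow> 0"
      by (intro tendsto_mult_right_zero tendsto_inverse_0_at_top l_top)
    then have "(\<lambda>k. (\<integral>y. \<bar>x \<bullet> y\<bar> \<partial>M k) - f x) \<longlonglongrightarrow> 0"
      by (rule Lim_null_comparison[rotated]) (intro always_eventually allI, unfold real_norm_def, rule diff)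
    then show "(\<lambda>k. \<integral>y. \<bar>x \<bullet> y\<bar> \<partial>M k) \<longlonglongrightarrow> f x" by (rule LIM_zero_cancel)
  qed
qed

end

section \<open>The characterization of zonoids by their spins\<close>

context spin_setting
begin

lemma stabilizer_orthogonal: "T \<in> G \<Longrightarrow> orthogonal_transformation ((*v) T)"
  using orthogonal_transformation_matrix[of "(*v) T"] by (auto simp: stabilizer_O_def)

lemma test_fun_invariant:
  assumes T: "T \<in> G"
  shows "test_fun R (c *\<^sub>R u) (T *v y) = test_fun R (c *\<^sub>R u) y"
proof -
  have "(T *v y) \<bullet> u = (T *v y) \<bullet> (T *v u)" using T by (simp add: stabilizer_O_def)
  also have "\<dots> = y \<bullet> u" using stabilizer_orthogonal[OF T] by (simp add: orthogonal_transformation_def)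
  finally show ?thesis by (simp add: test_fun_def gauss_def norm_G[OF T])
qed

text \<open>The test function with frequency on the axis of \<open>u\<close> is invariant under the stabilizer of \<open>u\<close>, and
  so is Lebesgue measure. Hence every single \<open>T\<close> leaves the integral unchanged, and so does the
  average.\<close>

lemma spin_op_test_fun:
  assumes R: "R > 0"
  shows "(\<integral>y. spin_op u h y * test_fun R (c *\<^sub>R u) y \<partial>lborel) = (\<integral>y. h y * test_fun R (c *\<^sub>R u) y \<partial>lborel)"
proof -
  let ?\<psi> = "test_fun R (c *\<^sub>R u)"
  obtain B where B: "B > 0" "\<And>x. \<bar>h x\<bar> \<le> B * norm x" using h_bound by blast
  interpret pair_sigma_finite m "lborel :: (real ^ 'n) measure" ..
  have inorm: "integrable lborel (\<lambda>y. norm (B * norm y * ?\<psi> y))"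
  proof (rule integrable_norm, rule test_fun_integrable_mult[OF R, where C=B and c=1])
    show "\<bar>B * norm y\<bar> \<le> B * exp (1 * norm y)" for y :: "real ^ 'n"
      using B(1) mult_left_mono[OF norm_le_exp[of y], of B] by (simp add: abs_mult)
  qed measurable
  have hB: "\<bar>h (T *v y) * ?\<psi> y\<bar> \<le> norm (B * norm y * ?\<psi> y)" if "T \<in> G" for T y
  proof -
    have "\<bar>h (T *v y)\<bar> \<le> B * norm y" using B(2)[of "T *v y"] norm_G[OF that] by simp
    then show ?thesis using B(1) by (simp add: abs_mult mult_right_mono)
  qed
  have act: "(\<lambda>p. fst p *v snd p) \<in> borel_measurable (m \<Otimes>\<^sub>M (lborel :: (real ^ 'n) measure))"
    using action_measurable by (simp cong: measurable_cong_sets sets_pair_measure_cong)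
  have meas: "(\<lambda>(T, y). h (T *v y) * ?\<psi> y) \<in> borel_measurable (m \<Otimes>\<^sub>M lborel)"
  proof -
    have "(\<lambda>p. h (fst p *v snd p)) \<in> borel_measurable (m \<Otimes>\<^sub>M (lborel :: (real ^ 'n) measure))"
      by (rule measurable_compose[OF act h_measurable])
    moreover have "(\<lambda>p. ?\<psi> (snd p)) \<in> borel_measurable (m \<Otimes>\<^sub>M (lborel :: (real ^ 'n) measure))"
      by measurable
    ultimately show ?thesis unfolding split_beta' by (rule borel_measurable_times)
  qed
  have hT [measurable]: "(\<lambda>y. h (T *v y)) \<in> borel_measurable borel" for T :: "real ^ 'n ^ 'n"
    by (intro measurable_compose[OF _ h_measurable] borel_measurable_continuous_onI continuous_intros)
  have int: "integrable (m \<Otimes>\<^sub>M lborel) (\<lambda>(T, y). h (T *v y) * ?\<psi> y)"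
  proof (rule Fubini_integrable[OF meas])
    show "AE T in m. integrable lborel (\<lambda>y. case (T, y) of (T, y) \<Rightarrow> h (T *v y) * ?\<psi> y)"
    proof (rule AE_I2)
      fix T assume "T \<in> space m"
      then have T: "T \<in> G" by (simp add: space_m)
      show "integrable lborel (\<lambda>y. case (T, y) of (T, y) \<Rightarrow> h (T *v y) * ?\<psi> y)"
        unfolding prod.case
        by (rule Bochner_Integration.integrable_bound[OF inorm]) (use hB[OF T] in auto)
    qed
    show "integrable m (\<lambda>T. \<integral>y. norm (case (T, y) of (T, y) \<Rightarrow> h (T *v y) * ?\<psi> y) \<partial>lborel)"
    proof (rule m.integrable_const_bound)
      show "AE T in m. norm (\<integral>y. norm (case (T, y) of (T, y) \<Rightarrow> h (T *v y) * ?\<psi> y) \<partial>lborel)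
          \<le> (\<integral>y. norm (B * norm y * ?\<psi> y) \<partial>lborel)"
      proof (rule AE_I2)
        fix T assume "T \<in> space m"
        then have T: "T \<in> G" by (simp add: space_m)
        have "(\<integral>y. norm (h (T *v y) * ?\<psi> y) \<partial>lborel) \<le> (\<integral>y. norm (B * norm y * ?\<psi> y) \<partial>lborel)"
        proof (rule integral_mono[where f="\<lambda>y. norm (h (T *v y) * ?\<psi> y)"])
          show "integrable lborel (\<lambda>y. norm (h (T *v y) * ?\<psi> y))"
            by (rule Bochner_Integration.integrable_bound[OF inorm]) (use hB[OF T] in auto)
          show "norm (h (T *v y) * ?\<psi> y) \<le> norm (B * norm y * ?\<psi> y)" for y
            using hB[OF T, of y] by simp
        qed (rule inorm)
        then show "norm (\<integral>y. norm (case (T, y) of (T, y) \<Rightarrow> h (T *v y) * ?\<psi> y) \<partial>lborel)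
          \<le> (\<integral>y. norm (B * norm y * ?\<psi> y) \<partial>lborel)" by simp
      qed
      show "(\<lambda>T. \<integral>y. norm (case (T, y) of (T, y) \<Rightarrow> h (T *v y) * ?\<psi> y) \<partial>lborel) \<in> borel_measurable m"
        by (rule lborel.borel_measurable_lebesgue_integral) (use meas in \<open>simp add: split_beta'\<close>)
    qed
  qed
  have "(\<integral>y. spin_op u h y * ?\<psi> y \<partial>lborel) = (\<integral>y. (\<integral>T. h (T *v y) * ?\<psi> y \<partial>m) \<partial>lborel)"
    by (simp add: spin_op_def)
  also have "\<dots> = (\<integral>T. (\<integral>y. h (T *v y) * ?\<psi> y \<partial>lborel) \<partial>m)"
    by (rule Fubini_integral[OF int])
  also have "\<dots> = (\<integral>T. (\<integral>y. h y * ?\<psi> y \<partial>lborel) \<partial>m)"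
  proof (rule Bochner_Integration.integral_cong[OF refl])
    fix T assume "T \<in> space m"
    then have T: "T \<in> G" by (simp add: space_m)
    have Tm: "(*v) T \<in> borel_measurable lborel"
      by (simp, intro borel_measurable_continuous_onI continuous_intros)
    have "(\<integral>y. h y * ?\<psi> y \<partial>lborel) = (\<integral>y. h y * ?\<psi> y \<partial>distr lborel borel ((*v) T))"
      using lborel_distr_orthogonal[OF stabilizer_orthogonal[OF T]] by simp
    also have "\<dots> = (\<integral>y. h (T *v y) * ?\<psi> (T *v y) \<partial>lborel)"
      by (rule integral_distr[OF Tm]) measurable
    also have "\<dots> = (\<integral>y. h (T *v y) * ?\<psi> y \<partial>lborel)"
      by (simp only: test_fun_invariant[OF T])
    finally show "(\<integral>y. h (T *v y) * ?\<psi> y \<partial>lborel) = (\<integral>y. h y * ?\<psi> y \<partial>lborel)" ..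
  qed
  also have "\<dots> = (\<integral>y. h y * ?\<psi> y \<partial>lborel)" by (simp add: m.prob_space)
  finally show ?thesis .
qed

end

text \<open>By Fubini's theorem, it suffices to consider a single segment, that is, the function
  \<open>\<bar>y \<bullet> v\<bar>\<close>.\<close>

lemma zonoid_test_fun_nonpos:
  fixes L :: "(real ^ 'n) set"
  assumes L: "zonoid L" and R: "R > 0"
  shows "(\<integral>y. support_fun L y * test_fun R w y \<partial>lborel) \<le> 0"
proof -
  obtain \<mu> :: "(real ^ 'n) measure" where [measurable_cong]: "sets \<mu> = sets borel"
    and f\<mu>: "finite_measure \<mu>" and norm1: "AE y in \<mu>. norm y = 1"
    and h\<mu>: "support_fun L = (\<lambda>x. \<integral>v. \<bar>x \<bullet> v\<bar> \<partial>\<mu>)"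
    using L by (rule zonoidE)
  interpret \<mu>: finite_measure \<mu> by (rule f\<mu>)
  interpret pair_sigma_finite "lborel :: (real ^ 'n) measure" \<mu> ..
  let ?\<psi> = "test_fun R w"
  have in0: "integrable lborel (\<lambda>y. norm y * ?\<psi> y)"
    by (rule test_fun_integrable_mult[OF R, where C=1 and c=1]) (auto simp: norm_le_exp)
  have bnd: "AE v in \<mu>. \<bar>y \<bullet> v\<bar> \<le> norm y" for y
    using norm1 by eventually_elim (use Cauchy_Schwarz_ineq2[of y] in \<open>metis mult.right_neutral\<close>)
  have inv: "integrable \<mu> (\<lambda>v. \<bar>y \<bullet> v\<bar>)" for y
    by (rule \<mu>.integrable_const_bound[where B="norm y"]) (use bnd in auto)
  have int: "integrable (lborel \<Otimes>\<^sub>M \<mu>) (\<lambda>(y, v). \<bar>y \<bullet> v\<bar> * ?\<psi> y)"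
  proof (rule Fubini_integrable)
    have eq: "(\<integral>v. norm (case (y, v) of (y, v) \<Rightarrow> \<bar>y \<bullet> v\<bar> * ?\<psi> y) \<partial>\<mu>) = support_fun L y * \<bar>?\<psi> y\<bar>" for y
      by (simp add: abs_mult h\<mu>)
    have bd: "support_fun L y \<le> measure \<mu> (space \<mu>) * norm y" "0 \<le> support_fun L y" for y
    proof -
      have "support_fun L y \<le> (\<integral>v. norm y \<partial>\<mu>)" unfolding h\<mu> by (intro integral_mono_AE inv bnd) auto
      then show "support_fun L y \<le> measure \<mu> (space \<mu>) * norm y" by simp
      show "0 \<le> support_fun L y" unfolding h\<mu> by (intro integral_nonneg_AE) simp
    qed
    have [measurable]: "support_fun L \<in> borel_measurable borel"
      using sublinear.continuous[OF sublinear_support_fun] L by (intro borel_measurable_continuous_onI) (auto simp: zonoid_def)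
    show "integrable lborel (\<lambda>y. \<integral>v. norm (case (y, v) of (y, v) \<Rightarrow> \<bar>y \<bullet> v\<bar> * ?\<psi> y) \<partial>\<mu>)"
      unfolding eq
    proof (rule Bochner_Integration.integrable_bound[OF integrable_mult_right[OF in0, of "measure \<mu> (space \<mu>)"]])
      show "AE y in lborel. norm (support_fun L y * \<bar>?\<psi> y\<bar>) \<le> norm (measure \<mu> (space \<mu>) * (norm y * ?\<psi> y))"
      proof (rule AE_I2)
        fix y
        have "support_fun L y * \<bar>?\<psi> y\<bar> \<le> measure \<mu> (space \<mu>) * norm y * \<bar>?\<psi> y\<bar>"
          using bd by (intro mult_right_mono) auto
        then show "norm (support_fun L y * \<bar>?\<psi> y\<bar>) \<le> norm (measure \<mu> (space \<mu>) * (norm y * ?\<psi> y))"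
          using bd(2)[of y] by (simp add: abs_mult)
      qed
    qed measurable
    show "AE y in lborel. integrable \<mu> (\<lambda>v. case (y, v) of (y, v) \<Rightarrow> \<bar>y \<bullet> v\<bar> * ?\<psi> y)"
      using inv by (intro AE_I2) simp
  qed measurable
  have "(\<integral>y. support_fun L y * ?\<psi> y \<partial>lborel) = (\<integral>y. (\<integral>v. \<bar>y \<bullet> v\<bar> * ?\<psi> y \<partial>\<mu>) \<partial>lborel)"
    by (simp add: h\<mu>)
  also have "\<dots> = (\<integral>v. (\<integral>y. \<bar>y \<bullet> v\<bar> * ?\<psi> y \<partial>lborel) \<partial>\<mu>)"
    by (rule Fubini_integral[OF int, symmetric])
  also have "\<dots> = - (\<integral>v. - (\<integral>y. \<bar>y \<bullet> v\<bar> * ?\<psi> y \<partial>lborel) \<partial>\<mu>)" by simp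
  also have "\<dots> \<le> 0"
    using test_fun_abs_inner_nonpos[OF R, of _ w] by (simp only: neg_le_0_iff_le, intro integral_nonneg_AE) simp
  finally show ?thesis .
qed

theorem theorem1p2:
  fixes K :: "(real ^ 'n) set"
  assumes "CARD('n) \<ge> 2"
    and "convex_body K" and "centrally_symmetric K"
  shows "zonoid K \<longleftrightarrow> (\<forall>u\<in>sphere 0 1. zonoid (spin u K))"
proof
  assume "zonoid K"
  then show "\<forall>u\<in>sphere 0 1. zonoid (spin u K)"
    using spin_setting.zonoid_spin[OF spin_setting.intro[OF assms(2,3)]] by blast
next
  assume spins: "\<forall>u\<in>sphere 0 1. zonoid (spin u K)"
  have even: "support_fun K (- x) = support_fun K x" for x
    using assms(2,3) centrally_symmetric_iff_support_fun_even by blast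
  interpret h: even_sublinear "support_fun K"
    using sublinear_support_fun[OF assms(2)] even by (intro even_sublinear.intro even_sublinear_axioms.intro)
  have "(\<integral>y. support_fun K y * test_fun R w y \<partial>lborel) \<le> 0" if R: "R > 0" for R and w :: "real ^ 'n"
  proof -
    obtain e :: "real ^ 'n" where e: "norm e = 1" by (metis norm_Basis SOME_Basis)
    \<comment> \<open>The direction of \<open>w\<close> is the only spin that is needed for the test function at \<open>w\<close>.\<close>
    define u where "u = (if w = 0 then e else w /\<^sub>R norm w)"
    have u: "u \<in> sphere 0 1" "norm w *\<^sub>R u = w" using e by (auto simp: u_def)
    interpret spin_setting K u using assms(2,3) by (rule spin_setting.intro)
    have "(\<integral>y. support_fun K y * test_fun R w y \<partial>lborel) = (\<integral>y. support_fun (spin u K) y * test_fun R w y \<partial>lborel)"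
      using spin_op_test_fun[OF R, of "norm w"] unfolding u(2) spin_body(2) by simp
    also have "\<dots> \<le> 0" using spins u(1) R by (intro zonoid_test_fun_nonpos) auto
    finally show ?thesis .
  qed
  then obtain M :: "(real ^ 'n) measure" where "sets M = sets borel" "integrable M norm"
    "\<And>x. support_fun K x = (\<integral>y. \<bar>x \<bullet> y\<bar> \<partial>M)"
    using h.cosine_transform_of_measure by blast
  then show "zonoid K" by (rule zonoidI[OF assms(2,3)])
qed

end
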